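(* Let $\alpha$ be a Liouville number. Then there exists a dense $G_\delta$ set $B\subset\mathbb T$ such that if $\beta\in B$, then any reparametrized linear flow (in the sense of the context) with angle $\alpha$ and stopping points at $(0,0)$ and $(0,\beta)$ has an extreme historic behaviour.
   Context: For an irrational $\alpha=[a_0;a_1,a_2,\dots]$ (continued fraction), $p_n/q_n=[a_0;a_1,\dots,a_n]$ denotes its $n$-th convergent in lowest terms, $q_n>0$. Here $\alpha$ is called a Liouville number if for every $k>0$ there are infinitely many $n$ with $a_{n+1}>q_n^k$. Let $\mathbb T=\mathbb R/\mathbb Z$, $\mathbb T^2=\mathbb R^2/\mathbb Z^2$, and let $\lambda^2$ be Lebesgue (Haar) measure on $\mathbb T^2$. A reparametrized linear flow with angle $\alpha$ and stopping points at $\mathbf p$ and $\mathbf q$ is the flow $\phi^t$ on $\mathbb T^2$ generated by a vector field $X=\varphi X_0$ such that: $X_0=(1,\alpha)$ with $\alpha\in\mathbb R$ irrational; $\varphi:\mathbb T^2\to[0,\infty)$ is of class $C^3$; $\varphi$ vanishes at two distinct points $\mathbf p,\mathbf q$ and is positive elsewhere; the Hessians $D^2\varphi(\mathbf p)$ and $D^2\varphi(\mathbf q)$ are positive definite. For $\mathbf x\in\mathbb T^2$ and $t>0$ the empirical measure $\mu^t_{\mathbf x}$ is the Borel probability with $\int f\,d\mu^t_{\mathbf x}=\frac1t\int_0^t f(\phi^s(\mathbf x))\,ds$ for continuous $f$, and $p\omega(\mathbf x)=\bigcap_{T>0}\overline{\{\mu^t_{\mathbf x}:t\ge T\}}$ (weak-*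 closure). The flow has an extreme historic behaviour if $p\omega(\mathbf x)=\{s\delta_{\mathbf p}+(1-s)\delta_{\mathbf q}:0\le s\le1\}$ for $\lambda^2$-a.e. $\mathbf x$. *)

theory Defs
  imports "HOL-Probability.Probability"
begin

section \<open>Continued fractions and Liouville numbers\<close>

primrec complete_quotient :: "real \<Rightarrow> nat \<Rightarrow> real" where
  "complete_quotient \<alpha> 0 = \<alpha>"
| "complete_quotient \<alpha> (Suc n) = 1 / frac (complete_quotient \<alpha> n)"

definition partial_quotient :: "real \<Rightarrow> nat \<Rightarrow> int" where
  "partial_quotient \<alpha> n = \<lfloor>complete_quotient \<alpha> n\<rfloor>"

text \<open>The value of the finite continued fraction with the given list of partial quotients.\<close>

fun cf_value :: "int list \<Rightarrow> rat" where
  "cf_value [] = 0"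
| "cf_value [a] = of_int a"
| "cf_value (a # b # as) = of_int a + 1 / cf_value (b # as)"

definition convergent_of :: "real \<Rightarrow> nat \<Rightarrow> rat" where
  "convergent_of \<alpha> n = cf_value (map (partial_quotient \<alpha>) [0..<Suc n])"

text \<open>\<^const>\<open>quotient_of\<close> returns numerator and positive denominator in lowest terms.\<close>

definition convergent_denom :: "real \<Rightarrow> nat \<Rightarrow> int" where
  "convergent_denom \<alpha> n = snd (quotient_of (convergent_of \<alpha> n))"

definition liouville_number :: "real \<Rightarrow> bool" where
  "liouville_number \<alpha> \<longleftrightarrow>
     \<alpha> \<notin> \<rat> \<and>
     (\<forall>k::real. k > 0 \<longrightarrow>
        (\<exists>\<^sub>\<infinity>n. real_of_int (partial_quotient \<alpha> (Suc n))
               > real_of_int (convergent_denom \<alpha> n) powr k))"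


section \<open>The circle and the two-dimensional torus\<close>

quotient_type circle = real / "\<lambda>x y. x - y \<in> \<int>"
  morphisms rep_circle to_circle
proof (rule equivpI)
  show "reflp (\<lambda>x y::real. x - y \<in> \<int>)"
    by (simp add: reflp_def)
  show "symp (\<lambda>x y::real. x - y \<in> \<int>)"
    by (metis (mono_tags, lifting) Ints_minus minus_diff_eq sympI)
  show "transp (\<lambda>x y::real. x - y \<in> \<int>)"
    by (rule transpI) (metis Ints_add diff_add_cancel add_diff_eq)
qed

lemma to_circle_eq_iff: "to_circle x = to_circle y \<longleftrightarrow> x - y \<in> \<int>"
  by (fact circle.abs_eq_iff)

instantiation circle :: topological_space
begin

definition open_circle :: "circle set \<Rightarrow> bool" where
  "open_circle U \<longleftrightarrow> open (to_circle -` U)"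

instance
proof
  show "open (UNIV :: circle set)"
    by (simp add: open_circle_def)
  show "open (S \<inter> T)" if "open S" "open T" for S T :: "circle set"
    using that by (simp add: open_circle_def open_Int)
  show "open (\<Union>K)" if "\<forall>S\<in>K. open S" for K :: "circle set set"
    using that by (auto simp: open_circle_def vimage_Union)
qed

end

text \<open>The product topology on the torus is the quotient topology of the plane,
  because \<^const>\<open>to_circle\<close> is an open map.\<close>

type_synonym torus = "circle \<times> circle"

definition to_torus :: "real \<times> real \<Rightarrow> torus" where
  "to_torus z = (to_circle (fst z), to_circle (snd z))"

definition torus_lebesgue :: "torus measure" where
  "torus_lebesgue = distr (restrict_space lborel ({0..<1} \<times> {0..<1})) borel to_torus"

lemma continuous_on_to_circle: "continuous_on UNIV to_circle"
  by (simp add: continuous_on_open_vimage open_circle_def)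

lemma continuous_on_to_torus: "continuous_on UNIV to_torus"
  unfolding to_torus_def
  by (intro continuous_on_Pair continuous_on_compose2 [OF continuous_on_to_circle] continuous_intros) auto

lemma prob_space_torus_lebesgue: "prob_space torus_lebesgue"
proof -
  have m: "to_torus \<in> restrict_space lborel ({0..<1} \<times> {0..<1}) \<rightarrow>\<^sub>M borel"
    using borel_measurable_continuous_onI [OF continuous_on_to_torus]
    by (intro measurable_restrict_space1) simp
  have s: "({0..<1} \<times> {0..<1} :: (real \<times> real) set) \<in> sets borel"
    by (intro borel_Times) auto
  have "emeasure lborel ({0..<1} \<times> {0..<1} :: (real \<times> real) set) = 1"
    by (simp add: lborel_prod [symmetric] lborel.emeasure_pair_measure_Times)
  then have "prob_space (restrict_space lborel ({0..<1} \<times> {0..<1} :: (real \<times> real) set))"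
    using s by (intro prob_spaceI) (simp add: space_restrict_space emeasure_restrict_space)
  then show ?thesis
    unfolding torus_lebesgue_def using m by (rule prob_space.prob_space_distr)
qed


section \<open>Reparametrized linear flows\<close>

primrec C_k :: "nat \<Rightarrow> ('a::euclidean_space \<Rightarrow> real) \<Rightarrow> bool" where
  "C_k 0 f \<longleftrightarrow> continuous_on UNIV f"
| "C_k (Suc n) f \<longleftrightarrow>
     (\<forall>z. f differentiable (at z)) \<and>
     (\<forall>v. C_k n (\<lambda>z. frechet_derivative f (at z) v))"

definition hessian :: "('a::euclidean_space \<Rightarrow> real) \<Rightarrow> 'a \<Rightarrow> 'a \<Rightarrow> 'a \<Rightarrow> real" where
  "hessian f z u v = frechet_derivative (\<lambda>w. frechet_derivative f (at w) v) (at z) u"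

text \<open>Smoothness and derivatives on the torus are those of the periodic lift to the plane.\<close>

definition torus_C_k :: "nat \<Rightarrow> (torus \<Rightarrow> real) \<Rightarrow> bool" where
  "torus_C_k n f \<longleftrightarrow> C_k n (\<lambda>z. f (to_torus z))"

definition torus_hessian_pos_def :: "(torus \<Rightarrow> real) \<Rightarrow> torus \<Rightarrow> bool" where
  "torus_hessian_pos_def f p \<longleftrightarrow>
     (\<forall>z. to_torus z = p \<longrightarrow> (\<forall>v. v \<noteq> 0 \<longrightarrow> hessian (\<lambda>w. f (to_torus w)) z v v > 0))"

text \<open>Integral curves are described through their lifts to the plane. The flow property of
  \<open>\<Psi>\<close> is not a separate requirement: for a locally Lipschitz field the integral curves are unique.\<close>

definition generates_flow :: "(torus \<Rightarrow> real \<times> real) \<Rightarrow> (real \<Rightarrow> torus \<Rightarrow> torus) \<Rightarrow> bool" where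
  "generates_flow X \<Psi> \<longleftrightarrow>
     (\<forall>z. \<exists>Z. Z 0 = z \<and>
        (\<forall>t. (Z has_vector_derivative X (to_torus (Z t))) (at t)) \<and>
        (\<forall>t. \<Psi> t (to_torus z) = to_torus (Z t)))"

lemma generates_flow_continuous_orbit:
  assumes "generates_flow X \<Psi>"
  shows "continuous_on UNIV (\<lambda>t. \<Psi> t x)"
proof -
  obtain z where z: "x = to_torus z"
  proof
    show "x = to_torus (rep_circle (fst x), rep_circle (snd x))"
      by (simp add: to_torus_def Quotient3_abs_rep [OF Quotient3_circle])
  qed
  obtain Z where Z: "\<And>t. (Z has_vector_derivative X (to_torus (Z t))) (at t)"
      "\<And>t. \<Psi> t (to_torus z) = to_torus (Z t)"
    using assms unfolding generates_flow_def by meson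
  have "continuous_on UNIV Z"
    using Z(1) by (meson continuous_at_imp_continuous_on has_vector_derivative_continuous)
  then have "continuous_on UNIV (\<lambda>t. to_torus (Z t))"
    by (rule continuous_on_compose2 [OF continuous_on_to_torus]) auto
  then show ?thesis
    by (simp add: z Z(2))
qed

definition reparam_linear_flow ::
  "real \<Rightarrow> torus \<Rightarrow> torus \<Rightarrow> (torus \<Rightarrow> real) \<Rightarrow> (real \<Rightarrow> torus \<Rightarrow> torus) \<Rightarrow> bool" where
  "reparam_linear_flow \<alpha> p q \<phi> \<Psi> \<longleftrightarrow>
     \<alpha> \<notin> \<rat> \<and>
     torus_C_k 3 \<phi> \<and>
     p \<noteq> q \<and> \<phi> p = 0 \<and> \<phi> q = 0 \<and> (\<forall>x. x \<noteq> p \<and> x \<noteq> q \<longrightarrow> \<phi> x > 0) \<and>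
     torus_hessian_pos_def \<phi> p \<and> torus_hessian_pos_def \<phi> q \<and>
     generates_flow (\<lambda>x. \<phi> x *\<^sub>R (1, \<alpha>)) \<Psi>"


section \<open>Empirical measures and historic behaviour\<close>

definition borel_probabilities :: "'a::topological_space measure set" where
  "borel_probabilities = {\<mu>. prob_space \<mu> \<and> sets \<mu> = sets borel}"

definition weak_star_topology :: "'a::topological_space measure topology" where
  "weak_star_topology = topology_generated_by
     {{\<mu> \<in> borel_probabilities. (LINT x|\<mu>. f x) \<in> U} | (f :: 'a \<Rightarrow> real) U.
        continuous_on UNIV f \<and> open U}"

text \<open>On the torus a Borel probability is determined by the integrals of continuous functions,
  so at most one \<open>\<mu>\<close> satisfies the following predicate.\<close>

definition is_empirical_measure ::
  "(real \<Rightarrow> torus \<Rightarrow> torus) \<Rightarrow> torus \<Rightarrow> real \<Rightarrow> torus measure \<Rightarrow> bool" where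
  "is_empirical_measure \<Psi> x t \<mu> \<longleftrightarrow>
     \<mu> \<in> borel_probabilities \<and>
     (\<forall>f :: torus \<Rightarrow> real. continuous_on UNIV f \<longrightarrow>
        (LINT y|\<mu>. f y) = 1 / t * integral {0..t} (\<lambda>s. f (\<Psi> s x)))"

lemma is_empirical_measure_distr:
  assumes "continuous_on UNIV (\<lambda>s. \<Psi> s x)" "t > 0"
  shows "is_empirical_measure \<Psi> x t
           (distr (uniform_measure lborel {0..t}) borel (\<lambda>s. \<Psi> s x))"
proof -
  have m: "(\<lambda>s. \<Psi> s x) \<in> uniform_measure lborel {0..t} \<rightarrow>\<^sub>M borel"
    using borel_measurable_continuous_onI [OF assms(1)] by (simp add: measurable_def)
  have p: "prob_space (uniform_measure lborel {0..t})"
    using assms(2) by (intro prob_space_uniform_measure) auto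
  have "(LINT y|distr (uniform_measure lborel {0..t}) borel (\<lambda>s. \<Psi> s x). f y)
          = 1 / t * integral {0..t} (\<lambda>s. f (\<Psi> s x))"
    if f: "continuous_on UNIV f" for f :: "torus \<Rightarrow> real"
  proof -
    have fm: "f \<in> borel_measurable borel"
      using f by (rule borel_measurable_continuous_onI)
    have c: "continuous_on UNIV (\<lambda>s. f (\<Psi> s x))"
      by (rule continuous_on_compose2 [OF f assms(1)]) auto
    have cm: "(\<lambda>s. f (\<Psi> s x)) \<in> borel_measurable lborel"
      using borel_measurable_continuous_onI [OF c] by simp
    have "(LINT y|distr (uniform_measure lborel {0..t}) borel (\<lambda>s. \<Psi> s x). f y)
            = (LINT s|uniform_measure lborel {0..t}. f (\<Psi> s x))"
      by (rule integral_distr [OF m fm])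
    also have "(LINT s|uniform_measure lborel {0..t}. f (\<Psi> s x)) =
                 (LINT s|density lborel (\<lambda>s. ennreal (indicator {0..t} s / t)). f (\<Psi> s x))"
    proof -
      have "uniform_measure lborel {0..t} =
              density lborel (\<lambda>s. ennreal (indicator {0..t} s / t))"
        unfolding uniform_measure_def using assms(2)
        by (intro arg_cong2 [where f = density] refl ext)
           (auto simp: indicator_def divide_ennreal ennreal_1 [symmetric] simp del: ennreal_1)
      then show ?thesis by simp
    qed
    also have "\<dots> = (LINT s|lborel. (indicator {0..t} s / t) *\<^sub>R f (\<Psi> s x))"
      using assms(2) by (intro integral_density cm) auto
    also have "\<dots> = 1 / t * (LINT s:{0..t}|lborel. f (\<Psi> s x))"
      by (simp add: set_lebesgue_integral_def)
    also have "(LINT s:{0..t}|lborel. f (\<Psi> s x)) = integral {0..t} (\<lambda>s. f (\<Psi> s x))"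
      by (rule set_borel_integral_eq_integral(2),
          rule borel_integrable_atLeastAtMost', rule continuous_on_subset [OF c]) auto
    finally show ?thesis .
  qed
  then show ?thesis
    using prob_space.prob_space_distr [OF p m]
    by (simp add: is_empirical_measure_def borel_probabilities_def)
qed

definition p_omega :: "(real \<Rightarrow> torus \<Rightarrow> torus) \<Rightarrow> torus \<Rightarrow> torus measure set" where
  "p_omega \<Psi> x =
     (\<Inter>T\<in>{0<..}. weak_star_topology closure_of {\<mu>. \<exists>t\<ge>T. is_empirical_measure \<Psi> x t \<mu>})"

definition convex_combination ::
  "real \<Rightarrow> 'a::topological_space measure \<Rightarrow> 'a measure \<Rightarrow> 'a measure" where
  "convex_combination s \<mu> \<nu> =
     measure_of UNIV (sets borel) (\<lambda>A. ennreal s * emeasure \<mu> A + ennreal (1 - s) * emeasure \<nu> A)"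

definition dirac_segment :: "'a::topological_space \<Rightarrow> 'a \<Rightarrow> 'a measure set" where
  "dirac_segment p q =
     {convex_combination s (return borel p) (return borel q) | s. 0 \<le> s \<and> s \<le> 1}"

definition extreme_historic_behaviour ::
  "(real \<Rightarrow> torus \<Rightarrow> torus) \<Rightarrow> torus \<Rightarrow> torus \<Rightarrow> bool" where
  "extreme_historic_behaviour \<Psi> p q \<longleftrightarrow>
     (AE x in torus_lebesgue. p_omega \<Psi> x = dirac_segment p q)"

lemma emeasure_convex_combination:
  fixes \<mu> \<nu> :: "'a::topological_space measure"
  assumes "sets \<mu> = sets borel" "sets \<nu> = sets borel" "A \<in> sets borel"
  shows "emeasure (convex_combination s \<mu> \<nu>) A =
           ennreal s * emeasure \<mu> A + ennreal (1 - s) * emeasure \<nu> A"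
proof -
  have 1: "sigma_algebra UNIV (sets (borel :: 'a measure))"
    using sets.sigma_algebra_axioms[of "borel :: 'a measure"] by simp
  have "countably_additive (sets borel)
          (\<lambda>A. ennreal s * emeasure \<mu> A + ennreal (1 - s) * emeasure \<nu> A)"
    using assms(1,2)
    by (auto simp: countably_additive_def suminf_add [symmetric] suminf_emeasure)
  then show ?thesis
    unfolding convex_combination_def
    using assms(3) 1 by (intro emeasure_measure_of_sigma) (auto simp: positive_def)
qed

end

theory Submission
  imports Defs
begin

text \<open>Let \<open>y\<close> be the height at which the line of slope \<open>\<alpha>\<close> through the initial point crosses the
  vertical axis. Since \<open>\<phi>\<close> is comparable to the product of the squared distances to the stopping
  points, the time spent near \<open>(0, 0)\<close> is comparable to the sum of \<open>1 / \<parallel>y + i\<alpha>\<parallel>\<close>, and the time spent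
  near \<open>(0, b)\<close> to the sum of \<open>1 / \<parallel>y - b + i\<alpha>\<parallel>\<close>, over the crossings \<open>i\<close> made so far, where
  \<open>\<parallel>x\<parallel>\<close> is the distance to the nearest integer. These sums grow superlinearly, so almost all time
  is spent near the two points, and every limit of empirical measures lies on the segment.

  Let \<open>q\<close> be a denominator with \<open>\<theta> = q\<alpha> - a\<close> smaller than a large power of \<open>1/q\<close>. The first \<open>q\<close>
  crossings form a grid of mesh \<open>1/q\<close> which then drifts by \<open>\<theta>\<close> in every round of \<open>q\<close> crossings.
  While the grid keeps a distance \<open>e/q\<close> from \<open>b\<close>, a round contributes \<open>O(q log q)\<close> to the second sum,
  hence \<open>O(log q / \<theta>)\<close> in total, whereas one passage of the grid through \<open>0\<close> contributes about
  \<open>log (1 / \<theta>) / \<theta>\<close> to the first sum, which is much more. If \<open>qb\<close> is slightly larger than an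
  integer (in the direction of the drift), then for most \<open>y\<close> the grid passes \<open>0\<close> before it gets
  near \<open>b\<close>; if \<open>qb\<close> is slightly smaller, the roles of the points are exchanged. For generic \<open>b\<close>
  both situations occur for infinitely many \<open>q\<close>, and Borel--Cantelli gives almost every \<open>y\<close>.\<close>

section \<open>Distance to the nearest integer\<close>

text \<open>The contest between the two sums is decided by logarithms. If
  \<open>\<theta> * q ^ K \<le> 1\<close>, then \<open>log (1 / \<theta>)\<close> is at least K
  times \<open>log q\<close>, and since the bound for the other sum deteriorates like
  \<open>1 / e\<close>, forcing the ratio of the sums below e takes an exponent of order
  \<open>1 / e^2\<close>. As e has to tend to 0, every exponent is called for. A single sequence
  \<open>e j\<close> governs the ratio that is reached, the width of the window prescribed for
  \<open>q * b\<close>, and the measure of the heights y that are given up because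
  \<open>q * y\<close> is too close to an integer. The first use asks for a null sequence,
  Borel-Cantelli for a summable one. The windows are open and recur with spacing
  \<open>1 / q\<close>, which is why Baire's theorem applies to them. The estimates reach only
  neighbourhoods of the two ends of the segment; the points between come from the continuity of the
  time averages in t.\<close>

definition nid :: "real \<Rightarrow> real" where
  "nid x = \<bar>x - of_int (round x)\<bar>"

lemma nid_nonneg [simp]: "0 \<le> nid x"
  by (simp add: nid_def)

lemma nid_le: "nid x \<le> \<bar>x - of_int k\<bar>"
  unfolding nid_def by (rule round_diff_minimal)

lemma nid_attained: "\<exists>k::int. nid x = \<bar>x - of_int k\<bar>"
  unfolding nid_def by blast

lemma nid_le_half: "nid x \<le> 1/2"
  using of_int_round_abs_le[of x] by (simp add: nid_def abs_minus_commute)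

lemma nid_le_abs: "nid x \<le> \<bar>x\<bar>"
  using nid_le[of x 0] by simp

lemma nid_triangle: "nid (x + y) \<le> nid x + nid y"
proof -
  obtain k l :: int where "nid x = \<bar>x - of_int k\<bar>" "nid y = \<bar>y - of_int l\<bar>"
    using nid_attained by metis
  moreover have "nid (x + y) \<le> \<bar>x + y - of_int (k + l)\<bar>"
    by (rule nid_le)
  ultimately show ?thesis by simp
qed

lemma nid_minus [simp]: "nid (- x) = nid x"
proof -
  have "nid (- x) \<le> nid x" for x
  proof -
    obtain k :: int where "nid x = \<bar>x - of_int k\<bar>" using nid_attained by metis
    then show ?thesis using nid_le[of "- x" "- k"] by simp
  qed
  from this[of x] this[of "- x"] show ?thesis by simp
qed

lemma nid_of_int [simp]: "nid (of_int k) = 0"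
  by (simp add: nid_def)

lemma nid_add_of_int [simp]: "nid (x + of_int k) = nid x"
  using nid_triangle[of x "of_int k"] nid_triangle[of "x + of_int k" "- of_int k"] by simp

lemma nid_lipschitz: "\<bar>nid x - nid y\<bar> \<le> \<bar>x - y\<bar>"
  using nid_triangle[of y "x - y"] nid_triangle[of x "y - x"] nid_le_abs[of "x - y"]
    nid_le_abs[of "y - x"] by simp

lemma nid_eq_0_iff: "nid x = 0 \<longleftrightarrow> x \<in> \<int>"
  unfolding nid_def by (metis Ints_cases Ints_of_int abs_eq_0 eq_iff_diff_eq_0 round_of_int)

lemma nid_pos: "x \<notin> \<int> \<Longrightarrow> 0 < nid x"
  using nid_eq_0_iff nid_nonneg by (metis less_eq_real_def)

lemma nid_mult_nat: "nid (real n * x) \<le> real n * nid x"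
proof -
  obtain k :: int where k: "nid x = \<bar>x - of_int k\<bar>" using nid_attained by metis
  have "nid (real n * x) \<le> \<bar>real n * x - of_int (int n * k)\<bar>" by (rule nid_le)
  also have "\<dots> = \<bar>real n * (x - of_int k)\<bar>" by (simp add: algebra_simps)
  also have "\<dots> = real n * nid x" by (simp add: k abs_mult)
  finally show ?thesis .
qed

lemma nid_eq_abs: "\<bar>x\<bar> \<le> 1/2 \<Longrightarrow> nid x = \<bar>x\<bar>"
proof (rule antisym[OF nid_le_abs])
  assume a: "\<bar>x\<bar> \<le> 1/2"
  obtain k :: int where k: "nid x = \<bar>x - of_int k\<bar>" using nid_attained by metis
  show "\<bar>x\<bar> \<le> nid x"
  proof (cases "k = 0")
    case False
    then have "1 \<le> \<bar>real_of_int k\<bar>" by linarith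
    then show ?thesis using a k by linarith
  qed (use k in simp)
qed

lemma nid_lower:
  assumes "e \<le> x" "x \<le> 1 - e"
  shows "e \<le> nid x"
proof -
  obtain k :: int where k: "nid x = \<bar>x - of_int k\<bar>" using nid_attained by metis
  have "k \<le> 0 \<or> k \<ge> 1" by linarith
  then have "real_of_int k \<le> 0 \<or> real_of_int k \<ge> 1" by linarith
  then show ?thesis using assms k by linarith
qed

lemma continuous_on_nid: "continuous_on UNIV nid"
proof (rule lipschitz_on_continuous_on)
  show "1-lipschitz_on UNIV nid"
    by (rule lipschitz_onI) (auto simp: dist_real_def nid_lipschitz)
qed

lemma continuous_on_nid' [continuous_intros]:
  "continuous_on A f \<Longrightarrow> continuous_on A (\<lambda>x. nid (f x))"
  by (rule continuous_on_compose2[OF continuous_on_nid]) auto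

section \<open>Continued fractions\<close>

text \<open>The indices of \<open>cf_num\<close> and \<open>cf_den\<close> are shifted by one: the \<open>n\<close>-th convergent is
  \<open>cf_num a (Suc n) / cf_den a (Suc n)\<close>.\<close>

fun cf_num :: "(nat \<Rightarrow> int) \<Rightarrow> nat \<Rightarrow> int" where
  "cf_num a 0 = 1"
| "cf_num a (Suc 0) = a 0"
| "cf_num a (Suc (Suc n)) = a (Suc n) * cf_num a (Suc n) + cf_num a n"

fun cf_den :: "(nat \<Rightarrow> int) \<Rightarrow> nat \<Rightarrow> int" where
  "cf_den a 0 = 0"
| "cf_den a (Suc 0) = 1"
| "cf_den a (Suc (Suc n)) = a (Suc n) * cf_den a (Suc n) + cf_den a n"

lemma cf_det: "cf_num a (Suc n) * cf_den a n - cf_num a n * cf_den a (Suc n) = (-1) ^ Suc n"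
  by (induction n) (auto simp: algebra_simps)

lemma cf_den_ge:
  assumes "\<And>n. n \<ge> 1 \<Longrightarrow> a n \<ge> 1"
  shows "cf_den a n \<ge> 0 \<and> cf_den a (Suc n) \<ge> 1 \<and> cf_den a (Suc n) \<ge> int n"
proof (induction n rule: less_induct)
  case (less n)
  consider "n = 0" | "n = 1" | m where "n = Suc (Suc m)" by (metis One_nat_def not0_implies_Suc)
  then show ?case
  proof cases
    case 3
    have *: "cf_den a (Suc n) \<ge> cf_den a n + cf_den a (Suc m)"
      using assms[of n] less[of "Suc m"] 3 mult_right_mono[of 1 "a n" "cf_den a n"] by simp
    then show ?thesis using less[of "Suc m"] less[of m] 3 by (auto simp del: cf_den.simps)
  qed (use assms[of 1] in auto)
qed

text \<open>The innermost entry is real so that the recursion covers both the convergents and the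
  expansion of \<open>\<alpha>\<close> by its complete quotients.\<close>

fun cf_real :: "int list \<Rightarrow> real \<Rightarrow> real" where
  "cf_real [] x = x"
| "cf_real (b # bs) x = of_int b + 1 / cf_real bs x"

lemma cf_real_append: "cf_real (bs @ [c]) x = cf_real bs (of_int c + 1 / x)"
  by (induction bs) auto

text \<open>The classical Moebius form of a continued fraction in its innermost entry. The
  conditionals supply the continuants of index -1, which are 0 above and 1 below and which truncated
  subtraction cannot express.\<close>

lemma cf_real_eq:
  assumes "\<And>n. n \<ge> 1 \<Longrightarrow> a n \<ge> 1" "x > 0"
  shows "cf_real (map a [0..<n]) x =
    (x * cf_num a n + (if n = 0 then 0 else cf_num a (n - 1))) /
    (if n = 0 then 1 else (x * cf_den a n + cf_den a (n - 1)))"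
  using assms(2)
proof (induction n arbitrary: x)
  case (Suc n)
  show ?case
  proof (cases "n = 0")
    case True
    then show ?thesis using Suc.prems by (simp add: field_simps)
  next
    case False
    then obtain m where m: "n = Suc m" by (metis not0_implies_Suc)
    have pos: "of_int (a n) + 1 / x > 0"
      using assms(1)[of n] Suc.prems m
      by (smt (verit) divide_pos_pos le_add1 of_int_1_le_iff plus_1_eq_Suc)
    have d: "cf_den a m \<ge> 0" "cf_den a n \<ge> 1"
      using cf_den_ge[of a m, OF assms(1)] m by auto
    have eq: "cf_real (map a [0..<Suc n]) x = cf_real (map a [0..<n]) (of_int (a n) + 1 / x)"
      by (simp add: cf_real_append)
    also have "\<dots> = ((of_int (a n) + 1 / x) * cf_num a n + cf_num a m) /
                    ((of_int (a n) + 1 / x) * cf_den a n + cf_den a m)"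
      using Suc.IH[OF pos] m by simp
    also have "\<dots> = (x * ((of_int (a n) + 1 / x) * cf_num a n + cf_num a m)) /
                    (x * ((of_int (a n) + 1 / x) * cf_den a n + cf_den a m))"
      using Suc.prems by simp
    also have "x * ((of_int (a n) + 1 / x) * cf_num a n + cf_num a m) = x * cf_num a (Suc n) + cf_num a n"
      using Suc.prems m by (simp add: algebra_simps)
    also have "x * ((of_int (a n) + 1 / x) * cf_den a n + cf_den a m) = x * cf_den a (Suc n) + cf_den a n"
      using Suc.prems m by (simp add: algebra_simps)
    finally show ?thesis by simp
  qed
qed simp

lemma complete_quotient_irrational:
  "\<alpha> \<notin> \<rat> \<Longrightarrow> complete_quotient \<alpha> n \<notin> \<rat>"
proof (induction n)
  case (Suc n)
  have "frac (complete_quotient \<alpha> n) \<notin> \<rat>"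
  proof
    assume "frac (complete_quotient \<alpha> n) \<in> \<rat>"
    then have "frac (complete_quotient \<alpha> n) + of_int \<lfloor>complete_quotient \<alpha> n\<rfloor> \<in> \<rat>"
      by (intro Rats_add) auto
    then show False using Suc by (simp add: frac_def)
  qed
  then show ?case
    by (metis Rats_inverse complete_quotient.simps(2) inverse_eq_divide inverse_inverse_eq)
qed simp

lemma complete_quotient_gt_1:
  assumes "\<alpha> \<notin> \<rat>" shows "complete_quotient \<alpha> (Suc n) > 1"
proof -
  have "frac (complete_quotient \<alpha> n) \<noteq> 0"
    using complete_quotient_irrational[OF assms, of n]
    by (metis Ints_subset_Rats frac_eq_0_iff subsetD)
  then show ?thesis
    using frac_ge_0[of "complete_quotient \<alpha> n"] frac_lt_1[of "complete_quotient \<alpha> n"]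
    by (simp add: less_eq_real_def)
qed

lemma partial_quotient_ge_1:
  assumes "\<alpha> \<notin> \<rat>" "n \<ge> 1" shows "partial_quotient \<alpha> n \<ge> 1"
proof -
  obtain m where "n = Suc m" using assms(2) by (metis One_nat_def Suc_le_D)
  then show ?thesis
    using complete_quotient_gt_1[OF assms(1), of m] by (simp add: partial_quotient_def)
qed

lemma cf_real_complete_quotient:
  assumes "\<alpha> \<notin> \<rat>"
  shows "cf_real (map (partial_quotient \<alpha>) [0..<n]) (complete_quotient \<alpha> n) = \<alpha>"
proof (induction n)
  case (Suc n)
  have "complete_quotient \<alpha> n = of_int (partial_quotient \<alpha> n) + 1 / complete_quotient \<alpha> (Suc n)"
    by (simp add: partial_quotient_def frac_def)
  then show ?case using Suc by (simp add: cf_real_append del: complete_quotient.simps)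
qed simp

lemma cf_value_eq_cf_real:
  "bs \<noteq> [] \<Longrightarrow> of_rat (cf_value (b # bs)) = of_int b + 1 / (of_rat (cf_value bs) :: real)"
  by (cases bs) (auto simp: of_rat_add of_rat_divide)

lemma cf_value_append: "of_rat (cf_value (bs @ [c])) = cf_real bs (of_int c)"
  by (induction bs) (auto simp: cf_value_eq_cf_real)

lemma convergent_of_eq:
  assumes "\<alpha> \<notin> \<rat>"
  defines "a \<equiv> partial_quotient \<alpha>"
  shows "convergent_of \<alpha> n = Fract (cf_num a (Suc n)) (cf_den a (Suc n))"
proof -
  have a: "a n \<ge> 1" if "n \<ge> 1" for n
    using partial_quotient_ge_1[OF assms(1) that] by (simp add: a_def)
  have d: "cf_den a (Suc n) \<ge> 1" "cf_den a n \<ge> 0" using cf_den_ge[of a n, OF a] by auto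
  have "(of_rat (convergent_of \<alpha> n) :: real) = cf_real (map a [0..<n]) (of_int (a n))"
    unfolding convergent_of_def a_def using cf_value_append by simp
  also have "\<dots> = of_int (cf_num a (Suc n)) / of_int (cf_den a (Suc n))"
  proof (cases n)
    case (Suc m)
    then have "a n > 0" using a[of n] by simp
    then show ?thesis using cf_real_eq[of a "of_int (a n)" n, OF a] Suc by simp
  qed simp
  also have "\<dots> = of_rat (Fract (cf_num a (Suc n)) (cf_den a (Suc n)))"
    using d by (simp add: of_rat_rat)
  finally show ?thesis by simp
qed

text \<open>With x the next complete quotient, the Moebius form and the determinant identity give
  \<open>1 / (x * Q + Q')\<close> for the distance of \<open>Q * \<alpha>\<close> from
  \<open>P\<close>, and x is at least the next partial quotient. The bound by n makes the
  denominators unbounded.\<close>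

lemma convergent_denom_approx:
  assumes "\<alpha> \<notin> \<rat>"
  shows "\<exists>p. coprime p (convergent_denom \<alpha> n) \<and> convergent_denom \<alpha> n \<ge> 1 \<and> convergent_denom \<alpha> n \<ge> int n \<and>
    0 < \<bar>of_int (convergent_denom \<alpha> n) * \<alpha> - of_int p\<bar> \<and>
    \<bar>of_int (convergent_denom \<alpha> n) * \<alpha> - of_int p\<bar> * (of_int (partial_quotient \<alpha> (Suc n)) * of_int (convergent_denom \<alpha> n)) \<le> 1"
proof -
  define a where "a = partial_quotient \<alpha>"
  define P Q P' Q' where "P = cf_num a (Suc n)" "Q = cf_den a (Suc n)"
    "P' = cf_num a n" "Q' = cf_den a n"
  have a: "a n \<ge> 1" if "n \<ge> 1" for n
    using partial_quotient_ge_1[OF assms that] by (simp add: a_def)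
  have Q: "Q \<ge> 1" "Q \<ge> int n" "Q' \<ge> 0"
    using cf_den_ge[of a n, OF a] by (auto simp: P_Q_P'_Q'_def)
  have det: "P * Q' - P' * Q = (-1) ^ Suc n" unfolding P_Q_P'_Q'_def by (rule cf_det)
  have cop: "coprime P Q"
  proof (rule coprimeI)
    fix c assume "c dvd P" "c dvd Q"
    then have "c dvd P * Q' - P' * Q" by simp
    then have "c dvd (-1) ^ Suc n * (-1) ^ Suc n" using det by (metis dvd_mult)
    then show "is_unit c" by (simp flip: power_mult_distrib del: power_Suc)
  qed
  have "quotient_of (convergent_of \<alpha> n) = (P, Q)"
    using convergent_of_eq[OF assms, of n] Q cop
    by (simp add: quotient_of_Fract P_Q_P'_Q'_def a_def normalize_def split: if_splits)
  then have den: "convergent_denom \<alpha> n = Q" by (simp add: convergent_denom_def)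
  define x where "x = complete_quotient \<alpha> (Suc n)"
  have x: "x > 1" unfolding x_def by (rule complete_quotient_gt_1[OF assms])
  have xa: "of_int (a (Suc n)) \<le> x" by (simp add: x_def a_def partial_quotient_def)
  have D: "x * Q + Q' > 0" using x Q by (smt (verit) mult_le_0_iff of_int_0_le_iff of_int_1_le_iff)
  have "cf_real (map a [0..<Suc n]) x = (x * P + P') / (x * Q + Q')"
    using cf_real_eq[of a x "Suc n", OF a] x by (simp add: P_Q_P'_Q'_def del: upt_Suc)
  moreover have "cf_real (map a [0..<Suc n]) x = \<alpha>"
    unfolding x_def a_def by (rule cf_real_complete_quotient[OF assms])
  ultimately have "\<alpha> = (x * P + P') / (x * Q + Q')" by simp
  then have "of_int Q * \<alpha> - of_int P = (Q * (x * P + P') - P * (x * Q + Q')) / (x * Q + Q')"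
    by (rule ssubst) (use D in \<open>simp add: diff_divide_distrib\<close>)
  also have "Q * (x * P + P') - P * (x * Q + Q') = - of_int (P * Q' - P' * Q)"
    by (simp add: algebra_simps)
  finally have e: "\<bar>of_int Q * \<alpha> - of_int P\<bar> = 1 / (x * Q + Q')"
    using D by (simp add: det power_abs)
  have "of_int (a (Suc n)) * of_int Q \<le> x * Q + Q'"
    by (rule add_increasing2) (use xa Q in \<open>auto intro!: mult_right_mono\<close>)
  then have "\<bar>of_int Q * \<alpha> - of_int P\<bar> * (of_int (a (Suc n)) * of_int Q) \<le> 1"
    using D by (simp add: e)
  moreover have "0 < \<bar>of_int Q * \<alpha> - of_int P\<bar>" using e D by simp
  ultimately show ?thesis using Q cop den by (auto simp: a_def)
qed

text \<open>The form in which the Liouville property is consumed, free of continued fractions.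
  Coprimality is recorded because it makes \<open>i * a\<close> run through all residues modulo
  q.\<close>

definition liouville_approximable :: "real \<Rightarrow> bool" where
  "liouville_approximable \<alpha> \<longleftrightarrow> (\<forall>K N :: nat. \<exists>q a. q \<ge> N \<and> coprime a (int q) \<and>
     0 < \<bar>real q * \<alpha> - of_int a\<bar> \<and> \<bar>real q * \<alpha> - of_int a\<bar> * real q ^ K \<le> 1)"

lemma liouville_number_approximable:
  assumes "liouville_number \<alpha>"
  shows "liouville_approximable \<alpha>"
  unfolding liouville_approximable_def
proof (intro allI)
  fix K N :: nat
  have irr: "\<alpha> \<notin> \<rat>" using assms by (simp add: liouville_number_def)
  have "\<exists>\<^sub>\<infinity>n. real_of_int (partial_quotient \<alpha> (Suc n)) > real_of_int (convergent_denom \<alpha> n) powr (real K + 1)"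
    using assms by (auto simp: liouville_number_def)
  \<comment> \<open>The exponent is \<open>K + 1\<close> because the definition of a Liouville
    number speaks of positive exponents and K may be 0.\<close>
  then obtain n where n: "n > N"
    "real_of_int (partial_quotient \<alpha> (Suc n)) > real_of_int (convergent_denom \<alpha> n) powr (real K + 1)"
    by (meson INFM_nat)
  define Q where "Q = convergent_denom \<alpha> n"
  obtain p where p: "coprime p Q" "Q \<ge> 1" "Q \<ge> int n" "0 < \<bar>of_int Q * \<alpha> - of_int p\<bar>"
    "\<bar>of_int Q * \<alpha> - of_int p\<bar> * (of_int (partial_quotient \<alpha> (Suc n)) * of_int Q) \<le> 1"
    using convergent_denom_approx[OF irr, of n] unfolding Q_def by blast
  have Q: "real_of_int Q \<ge> 1" using p by simp
  have "real_of_int Q ^ K = real_of_int Q powr K" using Q by (simp add: powr_realpow)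
  also have "\<dots> \<le> real_of_int Q powr (real K + 1)" using Q by (intro powr_mono) auto
  also have "\<dots> \<le> of_int (partial_quotient \<alpha> (Suc n))" using n by (simp add: Q_def)
  also have "\<dots> \<le> of_int (partial_quotient \<alpha> (Suc n)) * of_int Q"
    using Q calculation mult_left_mono[of 1 "of_int Q" "of_int (partial_quotient \<alpha> (Suc n))::real"]
    by (smt (verit) zero_le_power)
  finally have "\<bar>of_int Q * \<alpha> - of_int p\<bar> * of_int Q ^ K \<le> 1"
    using p(5) mult_left_mono[of "of_int Q ^ K" _ "\<bar>of_int Q * \<alpha> - of_int p\<bar>"] by (meson abs_ge_zero order_trans)
  then show "\<exists>q a. q \<ge> N \<and> coprime a (int q) \<and>
     0 < \<bar>real q * \<alpha> - of_int a\<bar> \<and> \<bar>real q * \<alpha> - of_int a\<bar> * real q ^ K \<le> 1"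
    using p n by (intro exI[of _ "nat Q"] exI[of _ p]) auto
qed

section \<open>Reciprocal distances along a rotation orbit\<close>

text \<open>The cell, in the partition of the circle into q arcs of length \<open>1 / q\<close>,
  that contains \<open>y + i * a / q\<close>, the rational model of the orbit point
  \<open>y + i * \<alpha>\<close>.\<close>

definition residue_index :: "nat \<Rightarrow> int \<Rightarrow> real \<Rightarrow> nat \<Rightarrow> nat" where
  "residue_index q a y i = nat ((\<lfloor>real q * y\<rfloor> + int i * a) mod int q)"

lemma bij_betw_residue_index:
  assumes "coprime a (int q)" "q > 0"
  shows "bij_betw (residue_index q a y) {..<q} {..<q}"
proof -
  let ?m = "\<lfloor>real q * y\<rfloor>"
  have "inj_on (residue_index q a y) {..<q}"
  proof (rule inj_onI)
    fix i j assume ij: "i \<in> {..<q}" "j \<in> {..<q}" "residue_index q a y i = residue_index q a y j"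
    then have "(?m + int i * a) mod int q = (?m + int j * a) mod int q"
      using assms(2) by (simp add: residue_index_def nat_eq_iff)
    then have "int q dvd (int i - int j) * a"
      by (simp add: mod_eq_dvd_iff left_diff_distrib)
    then have "int q dvd int i - int j"
      using assms(1) by (metis coprime_commute coprime_dvd_mult_left_iff)
    moreover have "\<bar>int i - int j\<bar> < int q" using ij by auto
    ultimately show "i = j"
      by (metis dvd_imp_le_int eq_iff_diff_eq_0 abs_of_nat linorder_not_less of_nat_eq_iff)
  qed
  moreover have "residue_index q a y ` {..<q} \<subseteq> {..<q}"
    using assms(2) by (auto simp: residue_index_def nat_less_iff)
  ultimately show ?thesis
    by (simp add: bij_betw_def endo_inj_surj)
qed

text \<open>Substituting \<open>\<alpha> = (a + \<theta>) / q\<close> turns the orbit, measured in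
  cells, into a permuted grid with common offset \<open>frac (q * y)\<close> and a drift
  \<open>i * \<theta>\<close>.\<close>

lemma orbit_position:
  assumes "q > 0"
  shows "\<exists>k::int. y + real i * \<alpha> = (real (residue_index q a y i) + frac (real q * y)
    + real i * (real q * \<alpha> - of_int a)) / real q + of_int k"
proof
  let ?t = "\<lfloor>real q * y\<rfloor> + int i * a"
  have r: "real (residue_index q a y i) = of_int (?t mod int q)"
    using assms by (simp add: residue_index_def)
  have "real_of_int (?t mod int q) = of_int ?t - real q * of_int (?t div int q)"
    by (metis of_int_diff of_int_mult of_int_of_nat_eq minus_mult_div_eq_mod)
  then show "y + real i * \<alpha> = (real (residue_index q a y i) + frac (real q * y)
    + real i * (real q * \<alpha> - of_int a)) / real q + of_int (?t div int q)"
    unfolding r using assms by (simp add: frac_def field_simps)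
qed

section \<open>Sums over complete rounds of q crossings\<close>

lemma sum_lessThan_add: "sum f {..<m + n} = sum f {..<m} + (\<Sum>i<n. f (m + i))"
  for f :: "nat \<Rightarrow> 'a::comm_monoid_add"
  by (induction n) (auto simp: add.assoc)

lemma sum_lessThan_blocks: "sum f {..<k * q} = (\<Sum>s<k. \<Sum>i<q. f (s * q + i))"
  for f :: "nat \<Rightarrow> 'a::comm_monoid_add"
  by (induction k) (auto simp: sum_lessThan_add add.commute[of q])

lemma sum_inverse_shifted: "(\<Sum>j<q. 1 / (real j + 2)) = harm (q + 1) - 1"
proof (induction q)
  case (Suc q)
  have "harm (Suc q + 1) = harm (q + 1) + 1 / (real q + 2)"
    by (simp add: harm_Suc inverse_eq_divide add.commute)
  then show ?case using Suc by simp
qed (simp add: harm_def)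

lemma harm_le_ln: "n \<ge> 1 \<Longrightarrow> harm n \<le> 1 + ln (real n)"
proof -
  assume "n \<ge> 1"
  then obtain m where m: "n = Suc m" by (metis One_nat_def Suc_le_D)
  have "harm (Suc m) - ln (Suc m) \<le> harm (Suc 0) - ln (Suc 0)"
    using decseq_harm_diff_ln unfolding decseq_def by blast
  then show ?thesis by (simp add: m harm_def)
qed

text \<open>Within a round the drift is at most one cell, so the point of cell j is at most
  \<open>j + 2\<close> cells away from an integer. Each cell is visited once, hence the harmonic
  sum.\<close>

lemma sum_recip_nid_block_lower:
  assumes "coprime a (int q)" "q > 0" "real q * \<bar>real q * \<alpha> - of_int a\<bar> \<le> 1"
    and "\<And>i. i < q \<Longrightarrow> y + real i * \<alpha> \<notin> \<int>"
  shows "real q * (harm (q + 1) - 1) \<le> (\<Sum>i<q. 1 / nid (y + real i * \<alpha>))"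
proof -
  have *: "real q / (real (residue_index q a y i) + 2) \<le> 1 / nid (y + real i * \<alpha>)" if i: "i < q" for i
  proof -
    define j \<theta> f where "j = residue_index q a y i" "\<theta> = real q * \<alpha> - of_int a" "f = frac (real q * y)"
    obtain k :: int where k: "y + real i * \<alpha> = (real j + f + real i * \<theta>) / real q + of_int k"
      using orbit_position[OF assms(2)] unfolding j_\<theta>_f_def by blast
    have "real i * \<bar>\<theta>\<bar> \<le> real q * \<bar>\<theta>\<bar>" using i by (intro mult_right_mono) auto
    then have "\<bar>real i * \<theta>\<bar> \<le> 1" using assms(3) by (simp add: j_\<theta>_f_def abs_mult)
    moreover have "0 \<le> f" "f < 1" by (auto simp: j_\<theta>_f_def frac_lt_1)
    ultimately have "\<bar>real j + f + real i * \<theta>\<bar> \<le> real j + 2" by linarith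
    then have "nid (y + real i * \<alpha>) \<le> (real j + 2) / real q"
      using nid_le_abs[of "(real j + f + real i * \<theta>) / real q"] assms(2)
      by (simp add: k abs_mult) (smt (verit) divide_right_mono of_nat_0_le_iff)
    moreover have "nid (y + real i * \<alpha>) > 0" using assms(4)[OF i] nid_pos by blast
    ultimately have "1 / ((real j + 2) / real q) \<le> 1 / nid (y + real i * \<alpha>)"
      using assms(2) by (intro divide_left_mono mult_pos_pos divide_pos_pos) auto
    then show ?thesis by (simp add: j_\<theta>_f_def)
  qed
  have "(\<Sum>i<q. real q / (real (residue_index q a y i) + 2)) = (\<Sum>j<q. real q / (real j + 2))"
    by (rule sum.reindex_bij_betw[OF bij_betw_residue_index[OF assms(1,2)]])
  also have "\<dots> = real q * (harm (q + 1) - 1)"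
    by (subst sum_inverse_shifted[symmetric]) (simp add: sum_distrib_left)
  finally have "real q * (harm (q + 1) - 1) = (\<Sum>i<q. real q / (real (residue_index q a y i) + 2))" ..
  also have "\<dots> \<le> (\<Sum>i<q. 1 / nid (y + real i * \<alpha>))"
    by (rule sum_mono) (use * in auto)
  finally show ?thesis .
qed

text \<open>For a given L one fixed denominator suffices: each round contributes q times a harmonic
  number, and q is chosen so large that this number exceeds the required slope.\<close>

lemma sum_recip_nid_superlinear:
  assumes "liouville_approximable \<alpha>" "\<And>i::nat. y + real i * \<alpha> \<notin> \<int>"
  shows "eventually (\<lambda>n. L * real n \<le> (\<Sum>i<n. 1 / nid (y + real i * \<alpha>))) sequentially"
proof -
  have "eventually (\<lambda>n. harm n \<ge> 2 * \<bar>L\<bar> + 1) sequentially"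
    using harm_at_top by (simp add: filterlim_at_top)
  then obtain N0 where N0: "\<And>n. n \<ge> N0 \<Longrightarrow> harm n \<ge> 2 * \<bar>L\<bar> + 1"
    by (auto simp: eventually_sequentially)
  obtain q a where q: "q \<ge> Suc N0" "coprime a (int q)" "\<bar>real q * \<alpha> - of_int a\<bar> * real q ^ 1 \<le> 1"
    using assms(1) unfolding liouville_approximable_def by meson
  have q0: "q > 0" using q by simp
  have h: "harm (q + 1) - 1 \<ge> 2 * \<bar>L\<bar>" using N0[of "q + 1"] q by simp
  show ?thesis unfolding eventually_sequentially
  proof (intro exI allI impI)
    fix n assume n: "n \<ge> q"
    define k where "k = n div q"
    have k: "k * q \<le> n" "n < (k + 1) * q" "k \<ge> 1"
      using q0 n by (auto simp: k_def dividend_less_times_div Suc_leI div_greater_zero_iff)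
        (metis add.commute dividend_less_div_times mult.commute)
    \<comment> \<open>The unfinished last round is shorter than the finished ones together; the
      factor 2 in \<open>2 * \<bar>L\<bar>\<close> pays for it.\<close>
    have nk: "real n \<le> 2 * (real k * real q)"
    proof -
      have "n < k * q + q" using k(2) by simp
      moreover have "q \<le> k * q" using k(3) by simp
      ultimately have "n \<le> 2 * (k * q)" by linarith
      then show ?thesis by (metis of_nat_le_iff of_nat_mult of_nat_numeral)
    qed
    have blk: "real q * (harm (q + 1) - 1) \<le> (\<Sum>i<q. 1 / nid (y + real (s * q + i) * \<alpha>))" for s
    proof -
      have "y + real (s * q) * \<alpha> + real i * \<alpha> \<notin> \<int>" for i
        using assms(2)[of "s * q + i"] by (simp add: algebra_simps)
      then show ?thesis
        using sum_recip_nid_block_lower[OF q(2) q0, of \<alpha> "y + real (s * q) * \<alpha>"] q(3)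
        by (simp add: algebra_simps)
    qed
    have "L * real n \<le> \<bar>L\<bar> * (2 * (real k * real q))"
      using nk by (smt (verit) abs_ge_zero mult_left_mono mult_right_mono of_nat_0_le_iff)
    also have "\<dots> = real k * (real q * (2 * \<bar>L\<bar>))" by simp
    also have "\<dots> \<le> real k * (real q * (harm (q + 1) - 1))"
      using h by (intro mult_left_mono) auto
    also have "\<dots> \<le> (\<Sum>s<k. \<Sum>i<q. 1 / nid (y + real (s * q + i) * \<alpha>))"
      using sum_mono[OF blk, of "{..<k}"] by simp
    also have "\<dots> = (\<Sum>i<k * q. 1 / nid (y + real i * \<alpha>))"
      by (simp only: sum_lessThan_blocks)
    also have "\<dots> \<le> (\<Sum>i<n. 1 / nid (y + real i * \<alpha>))"
      using k(1) by (intro sum_mono2) auto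
    finally show "L * real n \<le> (\<Sum>i<n. 1 / nid (y + real i * \<alpha>))" .
  qed
qed

text \<open>There is one point per cell, so in the inner cells the distance is controlled by the
  cell number counted from the nearer end, which gives two harmonic sums. Only the points of the
  cells 0 and \<open>q - 1\<close> can come very close to an integer, and for these the assumed
  distance \<open>e / q\<close> is used.\<close>

lemma sum_recip_nid_block_upper:
  assumes "coprime a (int q)" "q \<ge> 1" "real q * \<bar>real q * \<alpha> - of_int a\<bar> \<le> 1/2" "0 < e" "e \<le> 1"
    and "\<And>i. i < q \<Longrightarrow> e / real q \<le> nid (y + real i * \<alpha>)"
  shows "(\<Sum>i<q. 1 / nid (y + real i * \<alpha>)) \<le> 8 * real q / e * harm q"
proof -
  let ?g = "\<lambda>j. 4 * real q / e * (1 / (real j + 1) + 1 / (real q - real j))"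
  have q0: "q > 0" using assms by simp
  have *: "1 / nid (y + real i * \<alpha>) \<le> ?g (residue_index q a y i)" if i: "i < q" for i
  proof -
    define j \<theta> f where "j = residue_index q a y i" "\<theta> = real q * \<alpha> - of_int a" "f = frac (real q * y)"
    have jq: "j < q" using bij_betw_residue_index[OF assms(1) q0, of y] i
      by (auto simp: j_\<theta>_f_def bij_betw_def)
    obtain k :: int where k: "y + real i * \<alpha> = (real j + f + real i * \<theta>) / real q + of_int k"
      using orbit_position[OF q0] unfolding j_\<theta>_f_def by blast
    have "real i * \<bar>\<theta>\<bar> \<le> real q * \<bar>\<theta>\<bar>" using i by (intro mult_right_mono) auto
    then have "\<bar>real i * \<theta>\<bar> \<le> 1/2" using assms(3) by (simp add: j_\<theta>_f_def abs_mult)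
    moreover have "0 \<le> f" "f < 1" by (auto simp: j_\<theta>_f_def frac_lt_1)
    ultimately have b: "real j - 1/2 \<le> real j + f + real i * \<theta>" "real j + f + real i * \<theta> \<le> real j + 3/2"
      by linarith+
    have np: "nid (y + real i * \<alpha>) > 0"
      using assms(6)[OF i] assms(4) q0 by (smt (verit) divide_pos_pos of_nat_0_less_iff)
    have g1: "4 * real q / e * (1 / (real j + 1)) \<le> ?g j" "4 * real q / e * (1 / (real q - real j)) \<le> ?g j"
      using jq assms(4) by (intro mult_left_mono; simp)+
    have coarse: "1 / nid (y + real i * \<alpha>) \<le> real q / e"
      using assms(4) q0 np assms(6)[OF i] by (simp add: field_simps)
    have "1 / nid (y + real i * \<alpha>) \<le> ?g j"
    proof (cases "j = 0 \<or> j = q - 1")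
      case True
      have "real q / e \<le> 4 * real q / e" using assms(4) by (simp add: divide_right_mono)
      then show ?thesis using coarse g1 True q0 by (auto simp: of_nat_diff)
    next
      case False
      then have j: "1 \<le> real j" "real j + 2 \<le> real q" using jq by linarith+
      define x where "x = (real j + f + real i * \<theta>) / real q"
      define M where "M = min (real j + 1) (real q - real j)"
      have M: "M > 0" using j by (simp add: M_def)
      \<comment> \<open>Offset and drift place a point between 1/2 cell below and 3/2 cells above
        the left end of its cell; in an inner cell this still leaves a quarter of M on both
        sides.\<close>
      have M4: "M / 4 \<le> real j - 1/2" "M / 4 \<le> real q - real j - 3/2" using j by (simp_all add: M_def)
      have "M / 4 / real q \<le> x"
        unfolding x_def using b M4 q0 by (intro divide_right_mono) linarith+
      moreover have "x \<le> (real q - M / 4) / real q"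
        unfolding x_def using b M4 q0 by (intro divide_right_mono) linarith+
      then have "x \<le> 1 - M / 4 / real q" using q0 by (simp add: diff_divide_distrib)
      ultimately have "M / 4 / real q \<le> nid x" by (rule nid_lower)
      then have "M / 4 / real q \<le> nid (y + real i * \<alpha>)" by (simp add: k x_def)
      then have "1 / nid (y + real i * \<alpha>) \<le> 4 * real q / M"
        using np M q0 by (simp add: field_simps)
      also have "\<dots> \<le> 4 * real q / e * (1 / M)"
        using M assms(4,5) mult_left_mono[of 1 "1 / e" "4 * real q / M"]
        by (simp add: mult.commute)
      also have "\<dots> \<le> ?g j" using g1 by (auto simp: M_def min_def)
      finally show ?thesis .
    qed
    then show ?thesis by (simp add: j_\<theta>_f_def)
  qed
  have "(\<Sum>i<q. 1 / nid (y + real i * \<alpha>)) \<le> (\<Sum>i<q. ?g (residue_index q a y i))"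
    by (rule sum_mono) (use * in auto)
  also have "\<dots> = (\<Sum>j<q. ?g j)"
    by (rule sum.reindex_bij_betw[OF bij_betw_residue_index[OF assms(1) q0]])
  also have "\<dots> = 4 * real q / e * ((\<Sum>j<q. 1 / (real j + 1)) + (\<Sum>j<q. 1 / (real q - real j)))"
    by (simp only: sum_distrib_left[symmetric] sum.distrib)
  also have "(\<Sum>j<q. 1 / (real q - real j)) = (\<Sum>j<q. 1 / (real (q - Suc j) + 1))"
    by (rule sum.cong) (auto simp: of_nat_diff)
  also have "\<dots> = (\<Sum>j<q. 1 / (real j + 1))"
    by (rule sum.nat_diff_reindex)
  also have "(\<Sum>j<q. 1 / (real j + 1)) = harm q"
    by (simp add: harm_altdef inverse_eq_divide add.commute)
  finally show ?thesis by simp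
qed

text \<open>In units of \<open>1 / q\<close> the grid has offset \<open>w + i * \<theta>\<close>.
  The window puts \<open>\<beta>\<close> between 2e and 3e, the condition on y starts the offset
  between 4e and 1 - 4e, and the count stops when the offset reaches 1 + e. By then the grid has
  moved past the first point by about e, and it is still at least e away from
  \<open>\<beta>\<close>, which it would next meet beyond 1 + 2e.\<close>

lemma liouville_ratio:
  fixes \<alpha> \<beta> y e :: real and a k :: int and q K :: nat
  defines "\<theta> \<equiv> real q * \<alpha> - of_int a"
  assumes cop: "coprime a (int q)" and \<theta>: "0 < \<theta>" "\<theta> * real q ^ K \<le> 1"
    and e: "0 < e" "e \<le> 1/8" and q: "3 \<le> q" "8 / e \<le> real q" and K: "48 / e^2 + 2 \<le> real K"
    and y: "4 * e < nid (real q * y)"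
    and k: "2 * e < real q * \<beta> - of_int k" "real q * \<beta> - of_int k < 3 * e"
    and nz: "\<And>i::nat. y + real i * \<alpha> \<notin> \<int>"
  shows "\<exists>n\<ge>q. (\<Sum>i<n. 1 / nid (y - \<beta> + real i * \<alpha>)) \<le> e * (\<Sum>i\<in>{1..<n}. 1 / nid (y + real i * \<alpha>))"
proof -
  define w where "w = frac (real q * y)"
  define m where "m = \<lfloor>real q * y\<rfloor>"
  have qy: "real q * y = of_int m + w" by (simp add: w_def m_def frac_def)
  have w: "4 * e < w" "w < 1 - 4 * e"
  proof -
    have "nid (real q * y) \<le> \<bar>real q * y - of_int m\<bar>" by (rule nid_le)
    moreover have "nid (real q * y) \<le> \<bar>real q * y - (of_int m + 1)\<bar>"
      using nid_le[of "real q * y" "m + 1"] by (simp only: of_int_add of_int_1)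
    moreover have "0 \<le> w" "w < 1" by (simp_all add: w_def frac_lt_1)
    ultimately show "4 * e < w" "w < 1 - 4 * e" using y qy by linarith+
  qed
  have q0: "real q \<ge> 3" using q by simp
  have "48 / e^2 \<ge> 0" by simp
  then have K2: "K \<ge> 2" using K by linarith
  \<comment> \<open>Two of the K powers of q are spent: one because a round drifts by
    \<open>q * \<theta>\<close> cells, one to absorb the constant \<open>8 / e\<close>.\<close>
  define L where "L = K - 2"
  have KL: "K = Suc (Suc L)" using K2 by (simp add: L_def)
  define \<delta> where "\<delta> = real q * \<theta>"
  have \<delta>0: "\<delta> > 0" using \<theta> q0 by (simp add: \<delta>_def)
  have qL: "real q ^ L \<ge> 1" using q0 by simp
  have \<delta>L: "8 * real q ^ L \<le> e / \<delta>"
  proof -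
    have "\<delta> * (8 * real q ^ L) \<le> \<delta> * (e * real q * real q ^ L)"
      using q e \<delta>0 q0 by (intro mult_left_mono mult_right_mono) (auto simp: field_simps)
    also have "\<dots> = e * (\<theta> * real q ^ K)" by (simp add: \<delta>_def KL)
    also have "\<dots> \<le> e" using \<theta> e by simp
    finally show ?thesis using \<delta>0 by (simp add: field_simps)
  qed
  have \<delta>e: "\<delta> \<le> e / 8"
  proof -
    have "8 * 1 \<le> e / \<delta>" using \<delta>L qL by linarith
    then show ?thesis using \<delta>0 by (simp add: field_simps)
  qed
  \<comment> \<open>The number of complete rounds during which the offset stays below
    \<open>1 + e\<close>.\<close>
  define M where "M = nat \<lfloor>(1 + e - w) / \<delta>\<rfloor>"
  have Mpos: "(1 + e - w) / \<delta> \<ge> 1" using w \<delta>e \<delta>0 e by (simp add: field_simps)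
  have M: "real M * \<delta> \<le> 1 + e - w" "(1 + e - w) / \<delta> < real M + 1" "M \<ge> 1"
  proof -
    have "real M = of_int \<lfloor>(1 + e - w) / \<delta>\<rfloor>" using Mpos by (simp add: M_def)
    then have "real M \<le> (1 + e - w) / \<delta>" "(1 + e - w) / \<delta> < real M + 1" by linarith+
    then show "real M * \<delta> \<le> 1 + e - w" "(1 + e - w) / \<delta> < real M + 1"
      using \<delta>0 by (simp_all add: field_simps)
    show "M \<ge> 1" using Mpos by (simp add: M_def le_nat_iff)
  qed
  have rot: "real q * (x + real i * \<alpha>) = real q * x + real i * \<theta> + of_int (int i * a)" for x i
    by (simp add: \<theta>_def algebra_simps)
  have far: "e / real q \<le> nid (y - \<beta> + real i * \<alpha>)" if i: "i < M * q" for i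
  proof -
    have "real i * \<theta> \<le> real (M * q) * \<theta>" using i \<theta> by (intro mult_right_mono) (simp_all del: of_nat_mult)
    also have "\<dots> = real M * \<delta>" by (simp add: \<delta>_def)
    finally have i\<theta>: "0 \<le> real i * \<theta>" "real i * \<theta> \<le> 1 + e - w" using M \<theta> by auto
    have "e \<le> nid (w + real i * \<theta> - (real q * \<beta> - of_int k))"
      by (rule nid_lower) (use i\<theta> w k in linarith)+
    also have "\<dots> = nid (w + real i * \<theta> - (real q * \<beta> - of_int k) + of_int (m + int i * a - k))"
      by (rule nid_add_of_int[symmetric])
    also have "w + real i * \<theta> - (real q * \<beta> - of_int k) + of_int (m + int i * a - k)
        = real q * (y - \<beta> + real i * \<alpha>)"
      unfolding rot using qy by (simp add: algebra_simps)
    also have "nid \<dots> \<le> real q * nid (y - \<beta> + real i * \<alpha>)" by (rule nid_mult_nat)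
    finally show ?thesis using q0 by (simp add: field_simps)
  qed
  have lnq: "ln (real q) \<ge> 1"
  proof -
    have "exp 1 \<le> real q" using exp_le q0 by linarith
    then show ?thesis using q0 by (simp add: ln_ge_iff)
  qed
  have upper: "(\<Sum>i<M * q. 1 / nid (y - \<beta> + real i * \<alpha>)) \<le> 16 * ln (real q) / (e * \<theta>)"
  proof -
    have blk: "(\<Sum>i<q. 1 / nid (y - \<beta> + real (s * q + i) * \<alpha>)) \<le> 8 * real q / e * harm q" if s: "s < M" for s
    proof -
      have "e / real q \<le> nid (y - \<beta> + real (s * q) * \<alpha> + real i * \<alpha>)" if i: "i < q" for i
      proof -
        have "s * q + i < (s + 1) * q" using i by simp
        also have "\<dots> \<le> M * q" using s by (intro mult_right_mono) auto
        finally show ?thesis using far[of "s * q + i"] by (simp add: algebra_simps)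
      qed
      moreover have "real q * \<bar>real q * \<alpha> - of_int a\<bar> \<le> 1/2"
        using \<theta> \<delta>e e by (simp add: \<delta>_def flip: \<theta>_def)
      ultimately have "(\<Sum>i<q. 1 / nid (y - \<beta> + real (s * q) * \<alpha> + real i * \<alpha>)) \<le> 8 * real q / e * harm q"
        using q e by (intro sum_recip_nid_block_upper[OF cop]) auto
      then show ?thesis by (simp add: algebra_simps)
    qed
    have h: "harm q \<le> 2 * ln (real q)" using harm_le_ln[of q] q lnq by simp
    have "(\<Sum>i<M * q. 1 / nid (y - \<beta> + real i * \<alpha>))
        = (\<Sum>s<M. \<Sum>i<q. 1 / nid (y - \<beta> + real (s * q + i) * \<alpha>))"
      by (rule sum_lessThan_blocks)
    also have "\<dots> \<le> real M * (8 * real q / e * harm q)"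
      using sum_mono[of "{..<M}", OF blk] by simp
    also have "\<dots> \<le> real M * (8 * real q / e * (2 * ln (real q)))"
      using h e by (intro mult_left_mono) auto
    also have "\<dots> = (real M * \<delta>) * (16 * ln (real q) / (e * \<theta>))"
      using \<theta> q0 by (simp add: \<delta>_def field_simps)
    also have "\<dots> \<le> 1 * (16 * ln (real q) / (e * \<theta>))"
      using M w e \<theta> lnq by (intro mult_right_mono) auto
    finally show ?thesis by simp
  qed
  \<comment> \<open>The point in the last cell is the one that the drift carries across an integer.
    \<open>X\<close> is the fractional number of rounds it needs for this and \<open>s\<close> the
    first whole number of rounds after the crossing.\<close>
  have "q - 1 \<in> residue_index q a y ` {..<q}"
    using bij_betw_residue_index[OF cop, of y] q by (auto simp: bij_betw_def)
  then obtain l where l: "l < q" "residue_index q a y l = q - 1" by auto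
  obtain t :: int where t: "y + real l * \<alpha> = (real (q - 1) + w + real l * \<theta>) / real q + of_int t"
    using orbit_position[of q y l \<alpha> a] q l unfolding w_def \<theta>_def by auto
  define X where "X = (1 - w - real l * \<theta>) / \<delta>"
  have l\<theta>: "0 \<le> real l * \<theta>" "real l * \<theta> \<le> \<delta>"
    using l \<theta> by (auto simp: \<delta>_def intro!: mult_right_mono)
  have X0: "X \<ge> 0" unfolding X_def using l\<theta> w \<delta>e \<delta>0 e by (intro divide_nonneg_pos) linarith+
  define s where "s = nat \<lfloor>X\<rfloor> + 1"
  have s: "X < real s" "real s \<le> X + 1" "s \<ge> 1"
    using X0 by (auto simp: s_def) linarith+
  \<comment> \<open>A round moves a point by \<open>\<theta>\<close> modulo 1, so in round
    \<open>s + r\<close> this one is at most \<open>(r + 1) * \<theta>\<close> beyond the integer.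
    The reciprocals add up to a harmonic number over \<open>\<theta>\<close>.\<close>
  have near: "1 / (real r + 1) / \<theta> \<le> 1 / nid (y + real (l + (s + r) * q) * \<alpha>)" for r
  proof -
    define u where "u = real (s + r) - X"
    have u: "0 < u" "u \<le> real r + 1" using s by (auto simp: u_def)
    have "u * \<delta> = real (s + r) * \<delta> - (1 - w - real l * \<theta>)" using \<delta>0 by (simp add: u_def X_def field_simps)
    then have "y + real (l + (s + r) * q) * \<alpha> = u * \<delta> / real q + of_int (t + 1 + (int s + int r) * a)"
      using t q0 by (simp add: of_nat_diff \<delta>_def \<theta>_def field_simps)
    then have "nid (y + real (l + (s + r) * q) * \<alpha>) \<le> \<bar>u * \<delta> / real q\<bar>"
      using nid_le_abs[of "u * \<delta> / real q"] by (simp only: nid_add_of_int)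
    also have "\<dots> = u * \<theta>" using u \<theta> q0 by (simp add: \<delta>_def)
    also have "\<dots> \<le> (real r + 1) * \<theta>" using u \<theta> by (intro mult_right_mono) auto
    finally have "1 / ((real r + 1) * \<theta>) \<le> 1 / nid (y + real (l + (s + r) * q) * \<alpha>)"
      using nid_pos[OF nz, of "l + (s + r) * q"] \<theta> by (intro divide_left_mono mult_pos_pos) simp_all
    then show ?thesis by simp
  qed
  define R where "R = M - s"
  have R: "real q ^ L \<le> real R + 1"
  proof -
    have "X \<le> (1 - w) / \<delta>" unfolding X_def using l\<theta> \<delta>0 by (intro divide_right_mono) auto
    moreover have "(1 + e - w) / \<delta> = (1 - w) / \<delta> + e / \<delta>"
      by (simp add: add_divide_distrib diff_divide_distrib)
    ultimately have "real M - real s \<ge> e / \<delta> - 2" using M s by linarith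
    then show ?thesis using \<delta>L qL unfolding R_def by linarith
  qed
  have "(real K - 2) * ln (real q) / \<theta> \<le> (\<Sum>i\<in>{1..<M * q}. 1 / nid (y + real i * \<alpha>))"
  proof -
    have "(real K - 2) * ln (real q) = ln (real q ^ L)" using q0 by (simp add: ln_realpow KL)
    also have "\<dots> \<le> ln (real R + 1)" using R qL q by (subst ln_le_cancel_iff) auto
    also have "\<dots> \<le> harm R" by (rule ln_le_harm)
    finally have "(real K - 2) * ln (real q) / \<theta> \<le> harm R / \<theta>"
      using \<theta> by (intro divide_right_mono) auto
    also have "\<dots> = (\<Sum>r<R. 1 / (real r + 1) / \<theta>)"
      by (simp add: harm_altdef inverse_eq_divide sum_divide_distrib add.commute)
    also have "\<dots> \<le> (\<Sum>r<R. 1 / nid (y + real (l + (s + r) * q) * \<alpha>))"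
      by (rule sum_mono) (rule near)
    also have "\<dots> = (\<Sum>i\<in>(\<lambda>r. l + (s + r) * q) ` {..<R}. 1 / nid (y + real i * \<alpha>))"
      using q by (subst sum.reindex) (auto simp: inj_on_def)
    also have "\<dots> \<le> (\<Sum>i\<in>{1..<M * q}. 1 / nid (y + real i * \<alpha>))"
    proof (rule sum_mono2)
      show "(\<lambda>r. l + (s + r) * q) ` {..<R} \<subseteq> {1..<M * q}"
      proof clarify
        fix r assume "r < R"
        then have "(s + r + 1) * q \<le> M * q" by (intro mult_right_mono) (auto simp: R_def)
        then have "(s + r) * q + q \<le> M * q" by simp
        moreover have "1 * 1 \<le> (s + r) * q" using s q by (intro mult_mono) simp_all
        ultimately show "l + (s + r) * q \<in> {1..<M * q}"
          using l(1) unfolding atLeastLessThan_iff by linarith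
      qed
    qed auto
    finally show ?thesis .
  qed
  \<comment> \<open>One factor \<open>1 / e\<close> stems from the distance \<open>e / q\<close>
    kept from \<open>\<beta>\<close>, the other from the ratio asked for; this is the origin of
    \<open>48 / e^2\<close>.\<close>
  moreover have "16 * ln (real q) / (e * \<theta>) \<le> e * ((real K - 2) * ln (real q) / \<theta>)"
  proof -
    have "16 \<le> e * (e * (48 / e^2))" using e by (simp add: power2_eq_square)
    also have "\<dots> \<le> e * (e * (real K - 2))" using K e by (intro mult_left_mono) auto
    finally have "16 / e \<le> e * (real K - 2)" using e by (simp add: field_simps)
    then have "16 / e * (ln (real q) / \<theta>) \<le> e * (real K - 2) * (ln (real q) / \<theta>)"
      using lnq \<theta> by (intro mult_right_mono) auto
    then show ?thesis by (simp add: mult.assoc)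
  qed
  ultimately have "(\<Sum>i<M * q. 1 / nid (y - \<beta> + real i * \<alpha>)) \<le> e * (\<Sum>i\<in>{1..<M * q}. 1 / nid (y + real i * \<alpha>))"
    using upper e by (meson less_imp_le mult_left_mono order_trans)
  moreover have "M * q \<ge> q" using M by simp
  ultimately show ?thesis by blast
qed

section \<open>Passage times along a line\<close>

text \<open>The reciprocal squared distance to the integer lattice from the point with abscissa t on
  the line of slope \<open>\<alpha>\<close> and height y. Up to bounded factors it is the slowing
  effect of one stopping point.\<close>

definition inv_sq_dist :: "real \<Rightarrow> real \<Rightarrow> real \<Rightarrow> real" where
  "inv_sq_dist \<alpha> y t = 1 / ((nid t)\<^sup>2 + (nid (y + t * \<alpha>))\<^sup>2)"

text \<open>Stated for all integers, so that the whole line misses the lattice and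
  \<open>inv_sq_dist\<close> is continuous on all reals.\<close>

definition avoids_lattice :: "real \<Rightarrow> real \<Rightarrow> bool" where
  "avoids_lattice \<alpha> y \<longleftrightarrow> (\<forall>i::int. y + of_int i * \<alpha> \<notin> \<int>)"

lemma avoids_lattice_nat: "avoids_lattice \<alpha> y \<Longrightarrow> y + real i * \<alpha> \<notin> \<int>"
  unfolding avoids_lattice_def by (metis of_int_of_nat_eq)

lemma inv_sq_dist_denom_pos:
  assumes "avoids_lattice \<alpha> y"
  shows "0 < (nid t)\<^sup>2 + (nid (y + t * \<alpha>))\<^sup>2"
proof (cases "t \<in> \<int>")
  case True
  then obtain i where "t = of_int i" by (auto elim: Ints_cases)
  then have "nid (y + t * \<alpha>) > 0" using assms by (auto simp: avoids_lattice_def intro: nid_pos)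
  then show ?thesis by (simp add: add_nonneg_pos)
next
  case False
  then show ?thesis using nid_pos[of t] by (intro add_pos_nonneg) auto
qed

lemma inv_sq_dist_pos: "avoids_lattice \<alpha> y \<Longrightarrow> 0 < inv_sq_dist \<alpha> y t"
  by (simp add: inv_sq_dist_def inv_sq_dist_denom_pos)

lemma continuous_on_inv_sq_dist:
  assumes "avoids_lattice \<alpha> y"
  shows "continuous_on A (inv_sq_dist \<alpha> y)"
  unfolding inv_sq_dist_def
  by (intro continuous_intros) (use inv_sq_dist_denom_pos[OF assms] in \<open>auto simp: less_le\<close>)

lemma integrable_inv_sq_dist:
  "avoids_lattice \<alpha> y \<Longrightarrow> inv_sq_dist \<alpha> y integrable_on {a..b}"
  by (intro integrable_continuous_interval continuous_on_inv_sq_dist)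

lemma integral_inv_sq_dist_mono:
  assumes "avoids_lattice \<alpha> y" "a \<le> a'" "b' \<le> b"
  shows "integral {a'..b'} (inv_sq_dist \<alpha> y) \<le> integral {a..b} (inv_sq_dist \<alpha> y)"
  by (rule integral_subset_le)
    (use assms inv_sq_dist_pos[OF assms(1)] in \<open>auto simp: integrable_inv_sq_dist less_imp_le\<close>)

text \<open>If the line crosses at distance d from the lattice point, it stays within a multiple of
  d for a length d, where the integrand is at least of order \<open>1 / d^2\<close>. Since d is at
  most 1/2, the half interval to the right of the crossing contains this stretch.\<close>

lemma integral_inv_sq_dist_ge:
  fixes i :: int
  assumes "avoids_lattice \<alpha> y"
  shows "1 / (1 + (1 + \<bar>\<alpha>\<bar>)\<^sup>2) / nid (y + of_int i * \<alpha>) \<le> integral {of_int i..of_int i + 1/2} (inv_sq_dist \<alpha> y)"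
proof -
  define d where "d = nid (y + of_int i * \<alpha>)"
  define c where "c = 1 + (1 + \<bar>\<alpha>\<bar>)\<^sup>2"
  have d: "0 < d" "d \<le> 1/2"
    using assms nid_le_half by (auto simp: d_def avoids_lattice_def intro: nid_pos)
  have c: "c > 0" by (simp add: c_def add_pos_nonneg)
  have *: "1 / (c * d\<^sup>2) \<le> inv_sq_dist \<alpha> y t" if t: "t \<in> {of_int i..of_int i + d}" for t
  proof -
    have "nid t \<le> d" using nid_le[of t i] t by auto
    then have 1: "(nid t)\<^sup>2 \<le> d\<^sup>2" by (intro power_mono) auto
    have "nid (y + t * \<alpha>) \<le> nid (y + of_int i * \<alpha>) + nid ((t - of_int i) * \<alpha>)"
      using nid_triangle[of "y + of_int i * \<alpha>" "(t - of_int i) * \<alpha>"] by (simp add: algebra_simps)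
    also have "\<dots> \<le> d + \<bar>t - of_int i\<bar> * \<bar>\<alpha>\<bar>"
      using nid_le_abs[of "(t - of_int i) * \<alpha>"] by (simp add: d_def abs_mult)
    also have "\<dots> \<le> d + d * \<bar>\<alpha>\<bar>"
      using t by (intro add_left_mono mult_right_mono) auto
    also have "\<dots> = (1 + \<bar>\<alpha>\<bar>) * d" by (simp add: algebra_simps)
    finally have "(nid (y + t * \<alpha>))\<^sup>2 \<le> ((1 + \<bar>\<alpha>\<bar>) * d)\<^sup>2" by (intro power_mono) auto
    then have "(nid t)\<^sup>2 + (nid (y + t * \<alpha>))\<^sup>2 \<le> c * d\<^sup>2"
      using 1 unfolding c_def power_mult_distrib by (subst distrib_right) linarith
    then show ?thesis
      unfolding inv_sq_dist_def using inv_sq_dist_denom_pos[OF assms, of t] c d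
      by (intro divide_left_mono mult_pos_pos) auto
  qed
  have "1 / c / d = integral {of_int i..of_int i + d} (\<lambda>_. 1 / (c * d\<^sup>2))"
    using d by (simp add: power2_eq_square)
  also have "\<dots> \<le> integral {of_int i..of_int i + d} (inv_sq_dist \<alpha> y)"
    by (rule integral_le) (use * in \<open>auto simp: integrable_inv_sq_dist[OF assms]\<close>)
  also have "\<dots> \<le> integral {of_int i..of_int i + 1/2} (inv_sq_dist \<alpha> y)"
    using d by (intro integral_inv_sq_dist_mono[OF assms]) auto
  finally show ?thesis by (simp add: c_def d_def)
qed

text \<open>With s the horizontal distance to the crossing and d the distance at the crossing, the
  integrand is at most a multiple of \<open>1 / (s^2 + d^2)\<close>, whose integral over the whole
  line is \<open>pi / d\<close>.\<close>

lemma integral_inv_sq_dist_le: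
  fixes i :: int
  assumes "avoids_lattice \<alpha> y"
  shows "integral {of_int i - 1/2..of_int i + 1/2} (inv_sq_dist \<alpha> y)
    \<le> (2 + 2 * \<alpha>\<^sup>2) * pi / nid (y + of_int i * \<alpha>)"
proof -
  define d where "d = nid (y + of_int i * \<alpha>)"
  have d: "0 < d"
    using assms by (auto simp: d_def avoids_lattice_def intro: nid_pos)
  let ?g = "\<lambda>t. (2 + 2 * \<alpha>\<^sup>2) * (1 / ((t - of_int i)\<^sup>2 + d\<^sup>2))"
  have *: "inv_sq_dist \<alpha> y t \<le> ?g t" if t: "t \<in> {of_int i - 1/2..of_int i + 1/2}" for t
  proof -
    define s where "s = t - of_int i"
    have "nid t = nid (s + of_int i)" by (simp add: s_def)
    also have "\<dots> = nid s" by (rule nid_add_of_int)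
    also have "\<dots> = \<bar>s\<bar>" using t by (intro nid_eq_abs) (auto simp: s_def abs_if)
    finally have nt: "nid t = \<bar>s\<bar>" .
    define n where "n = nid (y + t * \<alpha>)"
    have "d \<le> nid (y + t * \<alpha>) + nid (- (s * \<alpha>))"
      using nid_triangle[of "y + t * \<alpha>" "- (s * \<alpha>)"] by (simp add: d_def s_def algebra_simps del: nid_minus)
    also have "\<dots> \<le> n + \<bar>s * \<alpha>\<bar>" using nid_le_abs[of "s * \<alpha>"] by (simp add: n_def)
    finally have "d\<^sup>2 \<le> (n + \<bar>s * \<alpha>\<bar>)\<^sup>2" using d by (intro power_mono) auto
    also have "\<dots> \<le> 2 * n\<^sup>2 + 2 * \<bar>s * \<alpha>\<bar>\<^sup>2"
      using sum_squares_bound[of n "\<bar>s * \<alpha>\<bar>"] by (simp add: power2_sum)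
    finally have d2: "d\<^sup>2 \<le> 2 * n\<^sup>2 + 2 * \<alpha>\<^sup>2 * s\<^sup>2" by (simp add: power_mult_distrib mult.commute mult.left_commute)
    have "s\<^sup>2 + d\<^sup>2 \<le> (2 + 2 * \<alpha>\<^sup>2) * (s\<^sup>2 + n\<^sup>2)"
    proof -
      have "0 \<le> s\<^sup>2" "0 \<le> \<alpha>\<^sup>2 * n\<^sup>2" by simp_all
      then show ?thesis using d2 unfolding distrib_left distrib_right by linarith
    qed
    moreover have "0 < s\<^sup>2 + n\<^sup>2" using inv_sq_dist_denom_pos[OF assms, of t] by (simp add: nt n_def)
    moreover have "0 < s\<^sup>2 + d\<^sup>2" using d by (simp add: add_nonneg_pos)
    ultimately have "1 / (s\<^sup>2 + n\<^sup>2) \<le> (2 + 2 * \<alpha>\<^sup>2) * (1 / (s\<^sup>2 + d\<^sup>2))"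
      by (simp add: field_simps)
    then show ?thesis by (simp add: inv_sq_dist_def nt flip: s_def n_def)
  qed
  have der: "((\<lambda>t. arctan ((t - of_int i) / d) / d) has_vector_derivative 1 / ((t - of_int i)\<^sup>2 + d\<^sup>2)) (at t within A)" for t A
  proof -
    have eq: "inverse (1 + ((t - of_int i) / d)\<^sup>2) * (1 / d) / d = 1 / ((t - of_int i)\<^sup>2 + d\<^sup>2)"
    proof -
      have "1 + ((t - of_int i) / d)\<^sup>2 = ((t - of_int i)\<^sup>2 + d\<^sup>2) / d\<^sup>2"
        using d by (simp add: power_divide add_divide_distrib)
      then show ?thesis using d by (simp add: power2_eq_square)
    qed
    show ?thesis
      unfolding has_real_derivative_iff_has_vector_derivative[symmetric]
      by (rule derivative_eq_intros refl | use d eq in simp)+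
  qed
  have "((\<lambda>t. 1 / ((t - of_int i)\<^sup>2 + d\<^sup>2)) has_integral
     arctan ((of_int i + 1/2 - of_int i) / d) / d - arctan ((of_int i - 1/2 - of_int i) / d) / d)
     {of_int i - 1/2..of_int i + 1/2}"
    by (rule fundamental_theorem_of_calculus[OF _ der]) auto
  then have "((\<lambda>t. 1 / ((t - of_int i)\<^sup>2 + d\<^sup>2)) has_integral 2 * arctan (1 / (2 * d)) / d)
     {of_int i - 1/2..of_int i + 1/2}"
    by (simp add: arctan_minus)
  then have g: "(?g has_integral (2 + 2 * \<alpha>\<^sup>2) * (2 * arctan (1 / (2 * d)) / d)) {of_int i - 1/2..of_int i + 1/2}"
    by (rule has_integral_mult_right)
  have "integral {of_int i - 1/2..of_int i + 1/2} (inv_sq_dist \<alpha> y) \<le> (2 + 2 * \<alpha>\<^sup>2) * (2 * arctan (1 / (2 * d)) / d)"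
    by (rule has_integral_le[OF integrable_integral[OF integrable_inv_sq_dist[OF assms]] g *])
  also have "\<dots> \<le> (2 + 2 * \<alpha>\<^sup>2) * (pi / d)"
    using arctan_ubound[of "1 / (2 * d)"] d by (intro mult_left_mono divide_right_mono) auto
  finally show ?thesis by (simp add: d_def)
qed

lemma integral_inv_sq_dist_le_sum:
  assumes "avoids_lattice \<alpha> y" "0 \<le> z"
  shows "integral {z..real n - 1/2} (inv_sq_dist \<alpha> y)
    \<le> (2 + 2 * \<alpha>\<^sup>2) * pi * (\<Sum>i<n. 1 / nid (y + real i * \<alpha>))"
proof -
  have "integral {-1/2..real n - 1/2} (inv_sq_dist \<alpha> y)
    \<le> (2 + 2 * \<alpha>\<^sup>2) * pi * (\<Sum>i<n. 1 / nid (y + real i * \<alpha>))"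
  proof (induction n)
    case (Suc n)
    have "integral {-1/2..real (Suc n) - 1/2} (inv_sq_dist \<alpha> y)
      = integral {-1/2..real n - 1/2} (inv_sq_dist \<alpha> y) + integral {real n - 1/2..real (Suc n) - 1/2} (inv_sq_dist \<alpha> y)"
      by (rule Henstock_Kurzweil_Integration.integral_combine[symmetric])
        (auto simp: integrable_inv_sq_dist[OF assms(1)])
    moreover have "real (Suc n) - 1/2 = real n + 1/2" by simp
    ultimately show ?case
      using Suc integral_inv_sq_dist_le[OF assms(1), of "int n"] by (simp add: distrib_left add.commute)
  qed simp
  moreover have "integral {z..real n - 1/2} (inv_sq_dist \<alpha> y) \<le> integral {-1/2..real n - 1/2} (inv_sq_dist \<alpha> y)"
    using assms by (intro integral_inv_sq_dist_mono) auto
  ultimately show ?thesis by linarith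
qed

text \<open>Crossing 0 is left out because the interval may begin anywhere up to 1, when that
  passage is already over. Crossing i is paid for by \<open>{i..i + 1/2}\<close>, so the interval
  has to extend only halfway from \<open>n - 1\<close> to n.\<close>

lemma integral_inv_sq_dist_ge_sum:
  assumes "avoids_lattice \<alpha> y" "z \<le> 1" "real n - 1/2 \<le> b"
  shows "1 / (1 + (1 + \<bar>\<alpha>\<bar>)\<^sup>2) * (\<Sum>i\<in>{1..<n}. 1 / nid (y + real i * \<alpha>)) \<le> integral {z..b} (inv_sq_dist \<alpha> y)"
proof -
  let ?c = "1 / (1 + (1 + \<bar>\<alpha>\<bar>)\<^sup>2)"
  let ?J = "\<lambda>a b. integral {a..b} (inv_sq_dist \<alpha> y)"
  have J0: "0 \<le> ?J a b" for a b
    by (rule Henstock_Kurzweil_Integration.integral_nonneg)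
      (auto simp: integrable_inv_sq_dist[OF assms(1)] less_imp_le[OF inv_sq_dist_pos[OF assms(1)]])
  have "?c * (\<Sum>i\<in>{1..<n}. 1 / nid (y + real i * \<alpha>)) \<le> ?J 1 (real n - 1/2)"
  proof (induction n)
    case (Suc n)
    show ?case
    proof (cases "n = 0")
      case False
      have "?J 1 (real (Suc n) - 1/2) = ?J 1 (real n) + ?J (real n) (real (Suc n) - 1/2)"
        using False by (intro Henstock_Kurzweil_Integration.integral_combine[symmetric])
          (auto simp: integrable_inv_sq_dist[OF assms(1)])
      moreover have "?J 1 (real n - 1/2) \<le> ?J 1 (real n)"
        by (rule integral_inv_sq_dist_mono[OF assms(1)]) auto
      moreover have "?c / nid (y + real n * \<alpha>) \<le> ?J (real n) (real (Suc n) - 1/2)"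
        using integral_inv_sq_dist_ge[OF assms(1), of "int n"] by (simp add: add.commute)
      ultimately show ?thesis using Suc False by (simp add: distrib_left)
    qed (use J0 in simp)
  qed (use J0 in simp)
  also have "\<dots> \<le> ?J z b"
    using assms by (intro integral_inv_sq_dist_mono) auto
  finally show ?thesis .
qed

lemma integral_inv_sq_dist_superlinear:
  assumes "liouville_approximable \<alpha>" "avoids_lattice \<alpha> y" "z \<le> 1"
  shows "eventually (\<lambda>b. L * b \<le> integral {z..b} (inv_sq_dist \<alpha> y)) at_top"
proof -
  define c where "c = 1 / (1 + (1 + \<bar>\<alpha>\<bar>)\<^sup>2)"
  have c: "c > 0" by (simp add: c_def add_pos_nonneg)
  \<comment> \<open>Starting the rotation orbit at \<open>y + \<alpha>\<close> compensates for the
    crossing 0 missing from the lower bound of the integral.\<close>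
  have "\<And>i::nat. y + \<alpha> + real i * \<alpha> \<notin> \<int>"
    using avoids_lattice_nat[OF assms(2), of "Suc i" for i] by (simp add: algebra_simps)
  from sum_recip_nid_superlinear[OF assms(1) this, of "2 * \<bar>L\<bar> / c"]
  obtain N where N: "\<And>n. n \<ge> N \<Longrightarrow> 2 * \<bar>L\<bar> / c * real n \<le> (\<Sum>i<n. 1 / nid (y + \<alpha> + real i * \<alpha>))"
    by (auto simp: eventually_sequentially)
  show ?thesis
    using eventually_ge_at_top[of "real N + 4"]
  proof eventually_elim
    case (elim b)
    define n where "n = nat \<lfloor>b - 1/2\<rfloor>"
    have n: "real n \<le> b - 1/2" "b - 1/2 < real n + 1"
      using elim unfolding n_def by linarith+
    have nN: "n \<ge> N" "b \<le> 2 * real n" using elim n by linarith+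
    have "L * b \<le> \<bar>L\<bar> * (2 * real n)" using nN elim by (intro mult_mono) auto
    also have "\<dots> = c * (2 * \<bar>L\<bar> / c * real n)" using c by simp
    also have "\<dots> \<le> c * (\<Sum>i<n. 1 / nid (y + \<alpha> + real i * \<alpha>))"
      using N[OF nN(1)] c by (intro mult_left_mono) auto
    also have "(\<Sum>i<n. 1 / nid (y + \<alpha> + real i * \<alpha>)) = (\<Sum>i\<in>{1..<Suc n}. 1 / nid (y + real i * \<alpha>))"
      by (rule sum.reindex_bij_witness[of _ "\<lambda>i. i - 1" Suc]) (auto simp: algebra_simps)
    also have "c * \<dots> \<le> integral {z..b} (inv_sq_dist \<alpha> y)"
      unfolding c_def using n by (intro integral_inv_sq_dist_ge_sum assms) auto
    finally show ?case .
  qed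
qed

section \<open>The slowed motion along a line\<close>

text \<open>Basing the antiderivative strictly to the left of the range of interest yields two-sided
  derivatives there, as the chain rule and the continuity arguments require.\<close>

lemma integral_eq_diff_antiderivative:
  fixes f :: "real \<Rightarrow> real"
  assumes "continuous_on UNIV f"
  obtains H where "\<And>s. a < s \<Longrightarrow> (H has_real_derivative f s) (at s)"
    "\<And>s t. a \<le> s \<Longrightarrow> s \<le> t \<Longrightarrow> integral {s..t} f = H t - H s"
proof
  define H where "H = (\<lambda>s. integral {a..s} f)"
  have int: "f integrable_on {s..t}" for s t
    by (intro integrable_continuous_interval continuous_on_subset[OF assms]) auto
  show "(H has_real_derivative f s) (at s)" if "a < s" for s
  proof -
    have "(H has_real_derivative f s) (at s within {a..s+1})"
      unfolding H_def using that
      by (intro integral_has_real_derivative continuous_on_subset[OF assms]) auto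
    then show ?thesis using that by (simp add: at_within_Icc_at)
  qed
  show "integral {s..t} f = H t - H s" if "a \<le> s" "s \<le> t" for s t
    using Henstock_Kurzweil_Integration.integral_combine[OF that int] by (simp add: H_def)
qed

text \<open>The point moves along the line of slope \<open>\<alpha>\<close> with speed \<open>G\<close>; \<open>\<tau>\<close> is its abscissa, and
  \<open>y1\<close>, \<open>y2\<close> are the heights of the line relative to the two stopping points.\<close>

locale slowed_motion =
  fixes \<alpha> y1 y2 c C :: real and \<tau> G :: "real \<Rightarrow> real"
  assumes avoids: "avoids_lattice \<alpha> y1" "avoids_lattice \<alpha> y2"
    and cC: "0 < c" "0 < C"
    and deriv: "\<And>t. (\<tau> has_real_derivative G (\<tau> t)) (at t)"
    and G_lower: "\<And>s. c \<le> G s * inv_sq_dist \<alpha> y1 s * inv_sq_dist \<alpha> y2 s"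
    and G_upper: "\<And>s. G s * inv_sq_dist \<alpha> y1 s \<le> C" "\<And>s. G s * inv_sq_dist \<alpha> y2 s \<le> C"
    and start: "0 \<le> \<tau> 0" "\<tau> 0 < 1"
begin

lemma swapped: "slowed_motion \<alpha> y2 y1 c C \<tau> G"
  by unfold_locales (use avoids cC deriv G_lower G_upper start in \<open>auto simp: mult_ac\<close>)

lemma G_pos: "0 < G s"
proof -
  have "0 < G s * (inv_sq_dist \<alpha> y1 s * inv_sq_dist \<alpha> y2 s)"
    using G_lower[of s] cC by (simp only: mult.assoc)
  moreover have "0 < inv_sq_dist \<alpha> y1 s * inv_sq_dist \<alpha> y2 s"
    by (intro mult_pos_pos inv_sq_dist_pos avoids)
  ultimately show ?thesis by (rule zero_less_mult_pos2)
qed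

lemma tau_mono: "s \<le> t \<Longrightarrow> \<tau> s \<le> \<tau> t"
proof (rule DERIV_nonneg_imp_nondecreasing[where f = \<tau>])
  fix x show "\<exists>y. (\<tau> has_real_derivative y) (at x) \<and> 0 \<le> y"
    by (intro exI[of _ "G (\<tau> x)"] conjI deriv less_imp_le[OF G_pos])
qed

lemma continuous_on_tau: "continuous_on A \<tau>"
  by (meson DERIV_isCont continuous_at_imp_continuous_on deriv)

text \<open>Substitution of the abscissa for the time, as \<open>\<tau>\<close> has derivative
  \<open>G (\<tau> s)\<close>.\<close>

lemma integral_along:
  assumes "avoids_lattice \<alpha> y" "0 \<le> t"
  shows "((\<lambda>s. G (\<tau> s) * inv_sq_dist \<alpha> y (\<tau> s)) has_integral integral {\<tau> 0..\<tau> t} (inv_sq_dist \<alpha> y)) {0..t}"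
proof -
  obtain H where H: "\<And>s. \<tau> 0 - 1 < s \<Longrightarrow> (H has_real_derivative inv_sq_dist \<alpha> y s) (at s)"
    "\<And>s t. \<tau> 0 - 1 \<le> s \<Longrightarrow> s \<le> t \<Longrightarrow> integral {s..t} (inv_sq_dist \<alpha> y) = H t - H s"
    by (rule integral_eq_diff_antiderivative[OF continuous_on_inv_sq_dist[OF assms(1)], of "\<tau> 0 - 1"]) blast
  have "((\<lambda>s. H (\<tau> s)) has_vector_derivative G (\<tau> s) * inv_sq_dist \<alpha> y (\<tau> s)) (at s within {0..t})"
    if "s \<in> {0..t}" for s
  proof -
    have "\<tau> 0 - 1 < \<tau> s" using tau_mono[of 0 s] that by simp
    from DERIV_chain2[OF H(1)[OF this] deriv]
    show ?thesis
      by (simp add: has_real_derivative_iff_has_vector_derivative mult.commute has_vector_derivative_at_within)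
  qed
  from fundamental_theorem_of_calculus[OF assms(2) this] show ?thesis
    using H(2)[of "\<tau> 0" "\<tau> t"] tau_mono[OF assms(2)] by simp
qed

text \<open>Converts passages at the first point into elapsed time: the rate at which the passage
  integral grows is at most C.\<close>

lemma integral_inv_sq_dist_le_time:
  assumes "0 \<le> t"
  shows "integral {\<tau> 0..\<tau> t} (inv_sq_dist \<alpha> y1) \<le> C * t"
proof (rule has_integral_le[OF integral_along[OF avoids(1) assms]])
  show "((\<lambda>_. C) has_integral C * t) {0..t}"
    using has_integral_const_real[of C 0 t] assms by (simp add: mult.commute)
qed (rule G_upper(1))

text \<open>The line misses both stopping points, so the speed is bounded below on a compact stretch
  of it, and the motion cannot remain there for ever.\<close>

lemma tau_at_top: "filterlim \<tau> at_top at_top"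
  unfolding filterlim_at_top_ge[of \<tau> at_top "\<tau> 0"]
proof (intro allI impI)
  fix R assume R: "\<tau> 0 \<le> R"
  let ?g = "\<lambda>s. inv_sq_dist \<alpha> y1 s * inv_sq_dist \<alpha> y2 s"
  have "continuous_on {\<tau> 0..R} ?g"
    by (intro continuous_intros continuous_on_inv_sq_dist avoids)
  then obtain s0 where s0: "\<And>s. s \<in> {\<tau> 0..R} \<Longrightarrow> ?g s \<le> ?g s0"
    using continuous_attains_sup[of "{\<tau> 0..R}" ?g] R compact_Icc by (metis atLeastAtMost_iff empty_iff order_refl)
  have gpos: "0 < ?g s" for s
    by (intro mult_pos_pos inv_sq_dist_pos avoids)
  define g where "g = c / ?g s0"
  have g0: "g > 0" using gpos[of s0] cC by (simp add: g_def)
  have G: "g \<le> G s" if "s \<in> {\<tau> 0..R}" for s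
  proof -
    have "c \<le> G s * ?g s" using G_lower[of s] by (simp add: mult.assoc)
    also have "\<dots> \<le> G s * ?g s0" using s0[OF that] G_pos[of s] by (intro mult_left_mono) auto
    finally show ?thesis using gpos[of s0] by (simp only: g_def pos_divide_le_eq)
  qed
  show "eventually (\<lambda>t. R \<le> \<tau> t) at_top"
  proof (rule ccontr)
    assume "\<not> eventually (\<lambda>t. R \<le> \<tau> t) at_top"
    then have below: "\<tau> t < R" for t
      using tau_mono unfolding eventually_at_top_linorder by (meson linorder_not_le order_trans)
    define t where "t = (R - \<tau> 0) / g"
    have t: "t \<ge> 0" using R g0 by (simp add: t_def)
    have "\<tau> 0 - g * 0 \<le> \<tau> t - g * t"
    proof (rule DERIV_nonneg_imp_nondecreasing[OF t, where f = "\<lambda>s. \<tau> s - g * s"])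
      fix s assume "0 \<le> s" "s \<le> t"
      then have "g \<le> G (\<tau> s)" using G tau_mono[of 0 s] below[of s] by simp
      then show "\<exists>y. ((\<lambda>s. \<tau> s - g * s) has_real_derivative y) (at s) \<and> 0 \<le> y"
        by (intro exI[of _ "G (\<tau> s) - g"]) (auto intro!: derivative_eq_intros deriv)
    qed
    then show False using below[of t] g0 by (simp add: t_def)
  qed
qed

text \<open>The passage integral is superlinear in the abscissa but at most linear in the time,
  hence the mean speed tends to 0.\<close>

lemma tau_sublinear:
  assumes "liouville_approximable \<alpha>" "0 < e"
  shows "eventually (\<lambda>t. \<tau> t \<le> e * t) at_top"
proof -
  have "eventually (\<lambda>b. C / e * b \<le> integral {\<tau> 0..b} (inv_sq_dist \<alpha> y1)) at_top"
    using start by (intro integral_inv_sq_dist_superlinear assms avoids) auto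
  from eventually_compose_filterlim[OF this tau_at_top] show ?thesis
    using eventually_ge_at_top[of 0]
  proof eventually_elim
    case (elim t)
    then have "C / e * \<tau> t \<le> C * t" using integral_inv_sq_dist_le_time[of t] by linarith
    then show ?case using cC assms(2) by (simp add: field_simps)
  qed
qed

text \<open>In the application \<open>G * inv_sq_dist \<alpha> y2\<close> is of order one near the
  second point and small near the first, so u measures the time spent near the second. Its integral
  is bounded by the passages there, these by a small multiple of the passages at the first point,
  and the latter by the elapsed time.\<close>

lemma small_average:
  assumes ratio: "\<And>e N. 0 < e \<Longrightarrow> \<exists>n\<ge>N. (\<Sum>i<n. 1 / nid (y2 + real i * \<alpha>)) \<le> e * (\<Sum>i\<in>{1..<n}. 1 / nid (y1 + real i * \<alpha>))"
    and u: "continuous_on UNIV u" "\<And>s. u s \<le> D * (G (\<tau> s) * inv_sq_dist \<alpha> y2 (\<tau> s))"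
    and D: "0 < D" and e: "0 < e"
  shows "\<exists>t\<ge>T. 0 < t \<and> integral {0..t} u \<le> e * t"
proof -
  define c1 where "c1 = 1 / (1 + (1 + \<bar>\<alpha>\<bar>)\<^sup>2)"
  define c2 where "c2 = (2 + 2 * \<alpha>\<^sup>2) * pi"
  have c1: "c1 > 0" by (simp add: c1_def add_pos_nonneg)
  have c2: "c2 > 0" by (simp add: c2_def add_pos_nonneg)
  define T' where "T' = max T 1"
  \<comment> \<open>Chosen so that all constants lost in the chain of estimates below cancel and
    \<open>e * t\<close> remains.\<close>
  define e' where "e' = e * c1 / (D * c2 * C)"
  have e': "e' > 0" using e c1 c2 D cC by (simp add: e'_def)
  obtain n where n: "n \<ge> nat \<lceil>\<tau> T'\<rceil> + 1"
    "(\<Sum>i<n. 1 / nid (y2 + real i * \<alpha>)) \<le> e' * (\<Sum>i\<in>{1..<n}. 1 / nid (y1 + real i * \<alpha>))"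
    using ratio[OF e'] by blast
  have nT: "\<tau> T' \<le> real n - 1/2" using n(1) by linarith
  obtain t1 where t1: "t1 \<ge> T'" "real n - 1/2 \<le> \<tau> t1"
    using tau_at_top unfolding filterlim_at_top eventually_at_top_linorder by (meson le_cases)
  \<comment> \<open>The time is taken halfway between two crossings, so that the upper and the lower
    bound of the passage integrals apply with the same n.\<close>
  obtain t where t: "T' \<le> t" "\<tau> t = real n - 1/2"
    using IVT'[of \<tau> T' "real n - 1/2" t1, OF nT t1(2,1) continuous_on_tau] by blast
  have t0: "0 \<le> t" using t by (simp add: T'_def)
  have "integral {0..t} u \<le> D * integral {\<tau> 0..\<tau> t} (inv_sq_dist \<alpha> y2)"
  proof (rule has_integral_le[OF integrable_integral])
    show "u integrable_on {0..t}"
      by (intro integrable_continuous_interval continuous_on_subset[OF u(1)]) auto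
    show "((\<lambda>s. D * (G (\<tau> s) * inv_sq_dist \<alpha> y2 (\<tau> s))) has_integral
        D * integral {\<tau> 0..\<tau> t} (inv_sq_dist \<alpha> y2)) {0..t}"
      by (intro has_integral_mult_right integral_along avoids t0)
  qed (rule u(2))
  also have "\<dots> \<le> D * (c2 * (\<Sum>i<n. 1 / nid (y2 + real i * \<alpha>)))"
    unfolding t(2) c2_def using D start
    by (intro mult_left_mono integral_inv_sq_dist_le_sum avoids) auto
  also have "\<dots> \<le> D * (c2 * (e' * (\<Sum>i\<in>{1..<n}. 1 / nid (y1 + real i * \<alpha>))))"
    using D c2 n(2) by (intro mult_left_mono) auto
  also have "\<dots> = D * c2 * e' / c1 * (c1 * (\<Sum>i\<in>{1..<n}. 1 / nid (y1 + real i * \<alpha>)))"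
    using c1 by simp
  also have "\<dots> \<le> D * c2 * e' / c1 * integral {\<tau> 0..\<tau> t} (inv_sq_dist \<alpha> y1)"
    unfolding t(2) c1_def[symmetric]
    by (intro mult_left_mono, unfold c1_def, intro integral_inv_sq_dist_ge_sum avoids)
      (use start D c2 e' in auto)
  also have "\<dots> \<le> D * c2 * e' / c1 * (C * t)"
    using integral_inv_sq_dist_le_time[OF t0] D c1 c2 e' by (intro mult_left_mono) auto
  also have "\<dots> = e * t" using D c1 c2 cC by (simp add: e'_def)
  finally show ?thesis using t by (intro exI[of _ t]) (auto simp: T'_def)
qed

end

section \<open>Nondegenerate zeros of the speed\<close>

lemma continuous_at_tendsto_nhds: "continuous (at z) f \<Longrightarrow> (f \<longlongrightarrow> f z) (nhds z)"
  by (simp add: continuous_at tendsto_at_iff_tendsto_nhds)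

lemma C_k_3_continuous_hessian:
  fixes F :: "'a::euclidean_space \<Rightarrow> real"
  assumes "C_k 3 F"
  shows "F differentiable (at z)" "(\<lambda>z. frechet_derivative F (at z) v) differentiable (at z)"
    "continuous_on UNIV (\<lambda>z. hessian F z u v)"
proof -
  have *: "C_k (Suc (Suc (Suc 0))) F" using assms by (simp only: numeral_3_eq_3)
  then show "F differentiable (at z)" "(\<lambda>z. frechet_derivative F (at z) v) differentiable (at z)"
    by simp_all
  have "\<forall>z. (\<lambda>z. hessian F z u v) differentiable (at z)"
    using * unfolding hessian_def by simp
  then show "continuous_on UNIV (\<lambda>z. hessian F z u v)"
    by (simp add: continuous_at_imp_continuous_on differentiable_imp_continuous_within)
qed

lemma has_real_derivative_along_line:
  fixes f :: "'a::euclidean_space \<Rightarrow> real"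
  assumes "\<And>z. f differentiable (at z)"
  shows "((\<lambda>s. f (z + s *\<^sub>R w)) has_real_derivative frechet_derivative f (at (z + s *\<^sub>R w)) w) (at s)"
proof -
  let ?D = "frechet_derivative f (at (z + s *\<^sub>R w))"
  have f: "(f has_derivative ?D) (at (z + s *\<^sub>R w))"
    using assms by (simp add: frechet_derivative_works)
  have "((\<lambda>s. z + s *\<^sub>R w) has_derivative (\<lambda>h. h *\<^sub>R w)) (at s)"
    by (auto intro!: derivative_eq_intros)
  from has_derivative_compose[OF this f]
  have "((\<lambda>s. f (z + s *\<^sub>R w)) has_derivative (\<lambda>h. ?D (h *\<^sub>R w))) (at s)" .
  moreover have "?D (h *\<^sub>R w) = ?D w * h" for h
    using linear_scale[OF has_derivative_linear[OF f]] by simp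
  ultimately show ?thesis by (simp add: has_field_derivative_def)
qed

text \<open>Continuity of the Hessian is available for fixed directions. The expansion into four
  entries reduces a bound that is uniform in the direction to four continuous functions.\<close>

lemma hessian_bilinear:
  fixes F :: "real \<times> real \<Rightarrow> real"
  assumes "C_k 3 F"
  shows "hessian F z (x, y) (x, y) = x\<^sup>2 * hessian F z (1,0) (1,0) + x * y * (hessian F z (1,0) (0,1)
    + hessian F z (0,1) (1,0)) + y\<^sup>2 * hessian F z (0,1) (0,1)"
proof -
  note d = C_k_3_continuous_hessian(1,2)[OF assms]
  have xy: "(x, y) = x *\<^sub>R (1,0) + y *\<^sub>R (0,1)" by simp
  have 1: "frechet_derivative f (at z) (x, y) = x * frechet_derivative f (at z) (1,0) + y * frechet_derivative f (at z) (0,1)"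
    if "f differentiable (at z)" for f :: "real \<times> real \<Rightarrow> real" and z
  proof -
    have "linear (frechet_derivative f (at z))" using that by (rule linear_frechet_derivative)
    then show ?thesis unfolding xy by (simp only: linear_add linear_scale real_scaleR_def)
  qed
  have 2: "hessian F z u (x, y) = x * hessian F z u (1,0) + y * hessian F z u (0,1)" for u
  proof -
    let ?g = "\<lambda>v w. frechet_derivative F (at w) v"
    have "((\<lambda>w. x * ?g (1,0) w + y * ?g (0,1) w) has_derivative
        (\<lambda>u. x * hessian F z u (1,0) + y * hessian F z u (0,1))) (at z)"
      unfolding hessian_def
      by (intro has_derivative_add has_derivative_mult_right d(2)[unfolded frechet_derivative_works])
    moreover have "(\<lambda>w. x * ?g (1,0) w + y * ?g (0,1) w) = ?g (x, y)"
      by (rule ext) (rule 1[OF d(1), symmetric])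
    ultimately have "((\<lambda>w. ?g (x, y) w) has_derivative
        (\<lambda>u. x * hessian F z u (1,0) + y * hessian F z u (0,1))) (at z)" by simp
    from frechet_derivative_at[OF this] show ?thesis unfolding hessian_def by (rule fun_cong[OF sym])
  qed
  have 3: "hessian F z (x, y) v = x * hessian F z (1,0) v + y * hessian F z (0,1) v" for v
    unfolding hessian_def by (rule 1[OF d(2)])
  have "hessian F z (x, y) (x, y) = x * (x * hessian F z (1,0) (1,0) + y * hessian F z (1,0) (0,1))
      + y * (x * hessian F z (0,1) (1,0) + y * hessian F z (0,1) (0,1))"
    by (subst 3) (simp only: 2)
  then show ?thesis by (simp add: algebra_simps power2_eq_square)
qed

text \<open>A zero of a nonnegative function is a minimum, so the linear term of the expansion along
  the segment vanishes.\<close>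

lemma taylor_at_zero_of_nonneg:
  fixes F :: "'a::euclidean_space \<Rightarrow> real"
  assumes F: "C_k 3 F" and "\<And>z. 0 \<le> F z" "F z = 0"
  shows "\<exists>\<xi>. 0 \<le> \<xi> \<and> \<xi> \<le> 1 \<and> F (z + w) = hessian F (z + \<xi> *\<^sub>R w) w w / 2"
proof -
  note d = C_k_3_continuous_hessian(1,2)[OF F]
  define D where "D = (\<lambda>m s. if m = (0::nat) then F (z + s *\<^sub>R w)
    else if m = 1 then frechet_derivative F (at (z + s *\<^sub>R w)) w else hessian F (z + s *\<^sub>R w) w w)"
  have D: "(D m has_real_derivative D (Suc m) s) (at s)" if "m < 2" for m s
  proof -
    have "m = 0 \<or> m = 1" using that by auto
    then show ?thesis
      using has_real_derivative_along_line[of F z w s, OF d(1)]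
        has_real_derivative_along_line[of "\<lambda>z. frechet_derivative F (at z) w" z w s, OF d(2)]
      unfolding D_def hessian_def by auto
  qed
  have "\<exists>t>0. t \<le> 1 \<and> D 0 1 = (\<Sum>m<2. D m 0 / fact m * 1 ^ m) + D 2 t / fact 2 * 1 ^ 2"
    using D by (intro Maclaurin2) auto
  then obtain t where t: "0 < t" "t \<le> 1" "D 0 1 = D 0 0 + D 1 0 + D 2 t / 2"
    by (auto simp: numeral_2_eq_2)
  have "D 1 0 = 0"
  proof (rule DERIV_local_min[of "D 0" _ 0 1])
    show "(D 0 has_real_derivative D 1 0) (at 0)" using D[of 0 0] by simp
    show "\<forall>s. \<bar>0 - s\<bar> < 1 \<longrightarrow> D 0 0 \<le> D 0 s" using assms(2,3) by (simp add: D_def)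
  qed simp
  then show ?thesis using t assms(3) by (intro exI[of _ t]) (simp add: D_def)
qed

lemma nondegenerate_zero_bounds:
  fixes F :: "real \<times> real \<Rightarrow> real"
  assumes F: "C_k 3 F" and nonneg: "\<And>z. 0 \<le> F z" and zero: "F z = 0"
    and pos: "\<And>v. v \<noteq> 0 \<Longrightarrow> 0 < hessian F z v v"
  shows "\<exists>c C. 0 < c \<and> 0 < C \<and> (\<forall>\<^sub>F w in nhds z. c * (dist w z)\<^sup>2 \<le> F w \<and> F w \<le> C * (dist w z)\<^sup>2)"
proof -
  define h11 h12 h21 h22 where "h11 = (\<lambda>z. hessian F z (1,0) (1,0))" "h12 = (\<lambda>z. hessian F z (1,0) (0,1))"
    "h21 = (\<lambda>z. hessian F z (0,1) (1,0))" "h22 = (\<lambda>z. hessian F z (0,1) (0,1))"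
  note h_def = h11_h12_h21_h22_def
  have hess: "hessian F z w w = (fst w)\<^sup>2 * h11 z + fst w * snd w * (h12 z + h21 z) + (snd w)\<^sup>2 * h22 z" for z w
    using hessian_bilinear[OF F, of z "fst w" "snd w"] by (simp add: h_def)
  have norm2: "(norm w)\<^sup>2 = (fst w)\<^sup>2 + (snd w)\<^sup>2" for w :: "real \<times> real"
    by (simp add: norm_prod_def)
  let ?Q = "\<lambda>w. hessian F z w w"
  have cont_Q: "continuous_on (sphere 0 1) ?Q" unfolding hess
    by (intro continuous_on_add continuous_on_mult continuous_on_power continuous_on_fst continuous_on_snd
        continuous_on_id continuous_on_const)
  have "(1, 0) \<in> sphere (0 :: real \<times> real) 1" by (simp add: norm_Pair)
  then have "sphere (0 :: real \<times> real) 1 \<noteq> {}" by (metis empty_iff)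
  from continuous_attains_inf[OF compact_sphere this cont_Q]
  obtain w0 where w0: "w0 \<in> sphere (0 :: real \<times> real) 1" "\<forall>w\<in>sphere 0 1. ?Q w0 \<le> ?Q w"
    by (elim bexE)
  \<comment> \<open>By homogeneity the form is at least m times the squared norm. If each of the
    four entries changes by less than \<open>m / 8\<close>, the form changes by at most
    \<open>m / 2\<close> times the squared norm; what remains is \<open>m / 2\<close>, and the
    factor 1/2 of the Taylor formula makes it \<open>m / 4\<close>.\<close>
  define m where "m = ?Q w0"
  have "w0 \<noteq> 0" using w0(1) by auto
  then have m: "m > 0" unfolding m_def by (rule pos)
  have Qm: "m * (norm w)\<^sup>2 \<le> ?Q w" for w
  proof (cases "w = 0")
    case False
    have "m \<le> ?Q (w /\<^sub>R norm w)" unfolding m_def using False by (intro bspec[OF w0(2)]) simp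
    also have "\<dots> = ?Q w / (norm w)\<^sup>2"
      by (simp add: hess power2_eq_square divide_inverse algebra_simps)
    finally show ?thesis using False by (simp add: field_simps)
  qed (simp add: hess)
  define S where "S = \<bar>h11 z\<bar> + \<bar>h12 z\<bar> + \<bar>h21 z\<bar> + \<bar>h22 z\<bar>"
  have quad: "\<bar>x\<^sup>2 * a + x * y * (b + c) + y\<^sup>2 * d\<bar> \<le> (\<bar>a\<bar> + \<bar>b\<bar> + \<bar>c\<bar> + \<bar>d\<bar>) * (x\<^sup>2 + y\<^sup>2)" for x y a b c d :: real
  proof -
    have "\<bar>x * y\<bar> \<le> x\<^sup>2 + y\<^sup>2"
    proof -
      have "2 * (\<bar>x\<bar> * \<bar>y\<bar>) \<le> x\<^sup>2 + y\<^sup>2"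
        using sum_squares_bound[of "\<bar>x\<bar>" "\<bar>y\<bar>"] by (simp add: mult.assoc)
      moreover have "0 \<le> \<bar>x\<bar> * \<bar>y\<bar>" by simp
      ultimately show ?thesis unfolding abs_mult by linarith
    qed
    have scale: "\<bar>p * k\<bar> \<le> q * \<bar>k\<bar>" if "\<bar>p\<bar> \<le> q" for p q k :: real
      unfolding abs_mult using that by (rule mult_right_mono) (rule abs_ge_zero)
    have "\<bar>x\<^sup>2\<bar> \<le> x\<^sup>2 + y\<^sup>2" "\<bar>y\<^sup>2\<bar> \<le> x\<^sup>2 + y\<^sup>2" by simp_all
    note scale[OF this(1), of a] scale[OF \<open>\<bar>x * y\<bar> \<le> x\<^sup>2 + y\<^sup>2\<close>, of b]
      scale[OF \<open>\<bar>x * y\<bar> \<le> x\<^sup>2 + y\<^sup>2\<close>, of c] scale[OF this(2), of d]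
    then have "\<bar>x\<^sup>2 * a\<bar> + \<bar>x * y * b\<bar> + \<bar>x * y * c\<bar> + \<bar>y\<^sup>2 * d\<bar> \<le>
      (x\<^sup>2 + y\<^sup>2) * \<bar>a\<bar> + (x\<^sup>2 + y\<^sup>2) * \<bar>b\<bar> + (x\<^sup>2 + y\<^sup>2) * \<bar>c\<bar> + (x\<^sup>2 + y\<^sup>2) * \<bar>d\<bar>"
      by (intro add_mono)
    moreover have "\<bar>p + (q + r) + s\<bar> \<le> \<bar>p\<bar> + \<bar>q\<bar> + \<bar>r\<bar> + \<bar>s\<bar>" for p q r s :: real by linarith
    ultimately have "\<bar>x\<^sup>2 * a + (x * y * b + x * y * c) + y\<^sup>2 * d\<bar> \<le>
      (x\<^sup>2 + y\<^sup>2) * \<bar>a\<bar> + (x\<^sup>2 + y\<^sup>2) * \<bar>b\<bar> + (x\<^sup>2 + y\<^sup>2) * \<bar>c\<bar> + (x\<^sup>2 + y\<^sup>2) * \<bar>d\<bar>"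
      by (rule order_trans[rotated])
    then show ?thesis by (simp only: distrib_left distrib_right mult.commute add.assoc)
  qed
  have cont: "continuous (at z) h11" "continuous (at z) h12" "continuous (at z) h21" "continuous (at z) h22"
    using C_k_3_continuous_hessian(3)[OF F] continuous_on_eq_continuous_at[OF open_UNIV]
    unfolding h_def by blast+
  have near: "\<exists>r>0. \<forall>w. dist w z < r \<longrightarrow> \<bar>h w - h z\<bar> < m / 8" if "continuous (at z) h" for h
    using that[unfolded continuous_at_eps_delta, rule_format, of "m / 8"] m
    by (simp add: dist_real_def dist_commute)
  obtain r1 r2 r3 r4 where r: "r1 > 0" "r2 > 0" "r3 > 0" "r4 > 0"
    and h: "\<And>w. dist w z < r1 \<Longrightarrow> \<bar>h11 w - h11 z\<bar> < m / 8" "\<And>w. dist w z < r2 \<Longrightarrow> \<bar>h12 w - h12 z\<bar> < m / 8"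
      "\<And>w. dist w z < r3 \<Longrightarrow> \<bar>h21 w - h21 z\<bar> < m / 8" "\<And>w. dist w z < r4 \<Longrightarrow> \<bar>h22 w - h22 z\<bar> < m / 8"
    using near[OF cont(1)] near[OF cont(2)] near[OF cont(3)] near[OF cont(4)] by blast
  define r where "r = min (min r1 r2) (min r3 r4)"
  have r0: "r > 0" using r by (simp add: r_def)
  have "m / 4 * (dist w z)\<^sup>2 \<le> F w \<and> F w \<le> (S + m) * (dist w z)\<^sup>2" if w: "dist w z < r" for w
  proof -
    define v where "v = w - z"
    obtain \<xi> where \<xi>: "0 \<le> \<xi>" "\<xi> \<le> 1" "F (z + v) = hessian F (z + \<xi> *\<^sub>R v) v v / 2"
      using taylor_at_zero_of_nonneg[OF F nonneg zero] by blast
    let ?z = "z + \<xi> *\<^sub>R v"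
    have "dist ?z z = \<xi> * norm v" using \<xi> by (simp add: dist_norm)
    also have "\<dots> \<le> norm v" using \<xi> by (simp add: mult_left_le_one_le)
    also have "\<dots> < r" using w by (simp add: v_def dist_norm)
    finally have zr: "dist ?z z < r1" "dist ?z z < r2" "dist ?z z < r3" "dist ?z z < r4" by (simp_all add: r_def)
    have "hessian F ?z v v - ?Q v = (fst v)\<^sup>2 * (h11 ?z - h11 z)
        + fst v * snd v * ((h12 ?z - h12 z) + (h21 ?z - h21 z)) + (snd v)\<^sup>2 * (h22 ?z - h22 z)"
      unfolding hess by (simp add: algebra_simps)
    then have "\<bar>hessian F ?z v v - ?Q v\<bar> \<le> (\<bar>h11 ?z - h11 z\<bar> + \<bar>h12 ?z - h12 z\<bar> + \<bar>h21 ?z - h21 z\<bar>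
        + \<bar>h22 ?z - h22 z\<bar>) * ((fst v)\<^sup>2 + (snd v)\<^sup>2)"
      by (simp only: quad)
    also have "\<dots> \<le> m / 2 * ((fst v)\<^sup>2 + (snd v)\<^sup>2)"
      using h(1)[OF zr(1)] h(2)[OF zr(2)] h(3)[OF zr(3)] h(4)[OF zr(4)]
      by (intro mult_right_mono) (linarith, simp)
    finally have diff: "\<bar>hessian F ?z v v - ?Q v\<bar> \<le> m / 2 * (norm v)\<^sup>2" by (simp add: norm2)
    have "\<bar>?Q v\<bar> \<le> S * (norm v)\<^sup>2" unfolding hess norm2 S_def by (rule quad)
    then have "m / 2 * (norm v)\<^sup>2 \<le> hessian F ?z v v" "hessian F ?z v v \<le> S * (norm v)\<^sup>2 + m / 2 * (norm v)\<^sup>2"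
      using diff Qm[of v] by linarith+
    moreover have "0 \<le> S * (norm v)\<^sup>2" "0 \<le> m * (norm v)\<^sup>2" using m by (simp_all add: S_def)
    ultimately show ?thesis using \<xi>(3) unfolding v_def dist_norm distrib_right by simp
  qed
  moreover have "\<forall>\<^sub>F w in nhds z. dist w z < r"
    unfolding eventually_nhds_metric by (rule exI[of _ r]) (simp add: r0)
  ultimately have "\<forall>\<^sub>F w in nhds z. m / 4 * (dist w z)\<^sup>2 \<le> F w \<and> F w \<le> (S + m) * (dist w z)\<^sup>2"
    by (auto elim: eventually_mono)
  moreover have "0 < m / 4" "0 < S + m" using m by (simp_all add: S_def)
  ultimately show ?thesis by blast
qed

section \<open>From local to uniform bounds on the torus\<close>

lemma compact_uniform_constant:
  fixes P :: "real \<Rightarrow> 'a::topological_space \<Rightarrow> bool"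
  assumes "compact K" and mono: "\<And>C C' z. C \<le> C' \<Longrightarrow> P C z \<Longrightarrow> P C' z"
    and loc: "\<And>z. z \<in> K \<Longrightarrow> \<exists>C. \<forall>\<^sub>F w in nhds z. P C w"
  shows "\<exists>C. \<forall>z\<in>K. P C z"
proof -
  have "\<exists>C U. open U \<and> z \<in> U \<and> (\<forall>w\<in>U. P C w)" if "z \<in> K" for z
    using loc[OF that] unfolding eventually_nhds by blast
  then obtain C U where CU: "\<And>z. z \<in> K \<Longrightarrow> open (U z) \<and> z \<in> U z \<and> (\<forall>w\<in>U z. P (C z) w)"
    by metis
  obtain T where T: "T \<subseteq> K" "finite T" "K \<subseteq> (\<Union>z\<in>T. U z)"
    by (rule compactE_image[OF assms(1), of K U]) (use CU in auto)
  \<comment> \<open>Inserting 0 keeps the maximum defined when the finite subcover is empty.\<close>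
  have "P (Max (insert 0 (C ` T))) w" if "w \<in> K" for w
  proof -
    obtain z where z: "z \<in> T" "w \<in> U z" using T(3) \<open>w \<in> K\<close> by blast
    have "C z \<le> Max (insert 0 (C ` T))" using T z by (intro Max_ge) auto
    then show ?thesis using mono CU z T by blast
  qed
  then show ?thesis by blast
qed

text \<open>The squared distance in the plane to the set of all lifts of the point
  \<open>(0, b)\<close> of the torus.\<close>

definition lattice_sq_dist :: "real \<Rightarrow> real \<times> real \<Rightarrow> real" where
  "lattice_sq_dist b z = (nid (fst z))\<^sup>2 + (nid (snd z - b))\<^sup>2"

lemma lattice_sq_dist_nonneg [simp]: "0 \<le> lattice_sq_dist b z"
  by (simp add: lattice_sq_dist_def)

lemma lattice_sq_dist_le: "lattice_sq_dist b z \<le> 1"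
proof -
  have "(nid x)\<^sup>2 \<le> (1/2)\<^sup>2" for x by (intro power_mono nid_le_half) auto
  from this[of "fst z"] this[of "snd z - b"] show ?thesis
    by (simp add: lattice_sq_dist_def power2_eq_square)
qed

lemma lattice_sq_dist_zero_iff:
  "lattice_sq_dist b z = 0 \<longleftrightarrow> to_torus z = (to_circle 0, to_circle b)"
  by (simp add: lattice_sq_dist_def to_torus_def to_circle_eq_iff nid_eq_0_iff sum_power2_eq_zero_iff)

lemma continuous_on_lattice_sq_dist: "continuous_on UNIV (lattice_sq_dist b)"
  unfolding lattice_sq_dist_def by (intro continuous_intros)

lemma lattice_sq_dist_cong:
  assumes "to_torus z = to_torus z'"
  shows "lattice_sq_dist b z = lattice_sq_dist b z'"
proof -
  have shift: "nid (x - c) = nid (y - c)" if "x - y \<in> \<int>" for x y c :: real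
  proof -
    from that obtain k where "x - y = of_int k" by (rule Ints_cases)
    then have "x - c = (y - c) + of_int k" by simp
    then show ?thesis by (simp only: nid_add_of_int)
  qed
  have "fst z - fst z' \<in> \<int>" "snd z - snd z' \<in> \<int>"
    using assms by (auto simp only: to_torus_def to_circle_eq_iff prod.inject)
  from shift[OF this(1), of 0] shift[OF this(2), of b] show ?thesis by (simp add: lattice_sq_dist_def)
qed

lemma lattice_sq_dist_near_zero:
  assumes "lattice_sq_dist b z = 0"
  shows "\<forall>\<^sub>F w in nhds z. lattice_sq_dist b w = (dist w z)\<^sup>2"
proof -
  have "fst z \<in> \<int>" "snd z - b \<in> \<int>"
    using assms by (simp_all add: lattice_sq_dist_def nid_eq_0_iff sum_power2_eq_zero_iff)
  then obtain k l :: int where kl: "fst z = of_int k" "snd z - b = of_int l" by (elim Ints_cases)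
  have "lattice_sq_dist b w = (dist w z)\<^sup>2" if w: "dist w z < 1/2" for w
  proof -
    have "\<bar>fst w - fst z\<bar> \<le> 1/2" "\<bar>snd w - snd z\<bar> \<le> 1/2"
      using w dist_fst_le[of w z] dist_snd_le[of w z] by (simp_all add: dist_real_def)
    then have "nid (fst w - fst z + of_int k) = \<bar>fst w - fst z\<bar>" "nid (snd w - snd z + of_int l) = \<bar>snd w - snd z\<bar>"
      by (simp_all add: nid_eq_abs)
    moreover have "fst w - fst z + of_int k = fst w" "snd w - snd z + of_int l = snd w - b"
      using kl by linarith+
    ultimately have "nid (fst w) = \<bar>fst w - fst z\<bar>" "nid (snd w - b) = \<bar>snd w - snd z\<bar>"
      by simp_all
    then show ?thesis by (simp add: lattice_sq_dist_def dist_prod_def dist_real_def)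
  qed
  then show ?thesis unfolding eventually_nhds_metric by (intro exI[of _ "1/2"]) auto
qed

lemma to_torus_fundamental: "\<exists>z'\<in>{0..1} \<times> {0..1}. to_torus z' = to_torus z"
proof
  show "(frac (fst z), frac (snd z)) \<in> {0..1} \<times> {0..1}" by (simp add: frac_lt_1 less_imp_le)
  show "to_torus (frac (fst z), frac (snd z)) = to_torus z"
    by (simp add: to_torus_def to_circle_eq_iff frac_def)
qed

lemma periodic_uniform_constant:
  assumes mono: "\<And>C C' z. C \<le> C' \<Longrightarrow> P C z \<Longrightarrow> P C' z"
    and per: "\<And>C z z'. to_torus z = to_torus z' \<Longrightarrow> P C z \<Longrightarrow> P C z'"
    and loc: "\<And>z. \<exists>C. \<forall>\<^sub>F w in nhds z. P C w"
  shows "\<exists>C::real. \<forall>z. P C z"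
proof -
  have "compact ({0..1} \<times> {0..1} :: (real \<times> real) set)" by (intro compact_Times compact_Icc)
  then have "\<exists>C. \<forall>z\<in>{0..1} \<times> {0..1}. P C z"
    by (rule compact_uniform_constant) (rule mono, assumption+, rule loc)
  then obtain C where C: "\<forall>z\<in>{0..1} \<times> {0..1}. P C z" by (elim exE)
  have "P C z" for z
  proof -
    obtain z' where "z' \<in> {0..1} \<times> {0..1}" "to_torus z' = to_torus z"
      using to_torus_fundamental[of z] by (elim bexE)
    then show ?thesis using C by (blast intro: per)
  qed
  then show ?thesis by blast
qed

lemma speed_bounds_at_zero:
  fixes F :: "real \<times> real \<Rightarrow> real"
  assumes F: "C_k 3 F" "\<And>z. 0 \<le> F z"
    and "F z = 0" "\<And>v. v \<noteq> 0 \<Longrightarrow> 0 < hessian F z v v"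
    and E: "lattice_sq_dist b z = 0" "lattice_sq_dist b' z > 0"
  shows "\<exists>C\<ge>0. \<forall>\<^sub>F w in nhds z. lattice_sq_dist b w * lattice_sq_dist b' w \<le> C * F w \<and>
    F w \<le> C * lattice_sq_dist b w \<and> F w \<le> C * lattice_sq_dist b' w"
proof -
  obtain c C where c: "0 < c" "0 < C" "\<forall>\<^sub>F w in nhds z. c * (dist w z)\<^sup>2 \<le> F w \<and> F w \<le> C * (dist w z)\<^sup>2"
    using nondegenerate_zero_bounds[OF F assms(3,4)] by blast
  define e where "e = lattice_sq_dist b' z / 2"
  have e: "0 < e" "e < lattice_sq_dist b' z" using E by (simp_all add: e_def)
  have "continuous (at z) (lattice_sq_dist b')"
    using continuous_on_lattice_sq_dist[of b'] continuous_on_eq_continuous_at[OF open_UNIV] by blast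
  then have "(lattice_sq_dist b' \<longlongrightarrow> lattice_sq_dist b' z) (nhds z)"
    by (rule continuous_at_tendsto_nhds)
  \<comment> \<open>Each summand of the constant serves one of the three inequalities; the last uses
    that the squared distance to the other stopping point stays above e near z.\<close>
  from order_tendstoD(1)[OF this e(2)] c(3) lattice_sq_dist_near_zero[OF E(1)]
  have "\<forall>\<^sub>F w in nhds z. lattice_sq_dist b w * lattice_sq_dist b' w \<le> (1 / c + C + C / e) * F w \<and>
    F w \<le> (1 / c + C + C / e) * lattice_sq_dist b w \<and> F w \<le> (1 / c + C + C / e) * lattice_sq_dist b' w"
  proof eventually_elim
    case (elim w)
    let ?E = "lattice_sq_dist b w" and ?E' = "lattice_sq_dist b' w"
    have nn: "0 \<le> 1 / c" "0 \<le> C / e" using c e by auto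
    have "?E * ?E' \<le> ?E * 1" by (intro mult_left_mono lattice_sq_dist_le) auto
    also have "\<dots> \<le> 1 / c * F w" using elim c by (simp add: field_simps)
    also have "\<dots> \<le> (1 / c + C + C / e) * F w" using nn c F(2) by (intro mult_right_mono) auto
    finally have 1: "?E * ?E' \<le> (1 / c + C + C / e) * F w" .
    have FC: "F w \<le> C * ?E" using elim by simp
    also have "\<dots> \<le> (1 / c + C + C / e) * ?E" using nn c by (intro mult_right_mono) auto
    finally have 2: "F w \<le> (1 / c + C + C / e) * ?E" .
    have "F w \<le> C * 1" using FC c lattice_sq_dist_le[of b w] by (meson mult_left_mono less_imp_le order_trans)
    also have "\<dots> \<le> C / e * ?E'" using elim e c by (simp add: field_simps)
    also have "\<dots> \<le> (1 / c + C + C / e) * ?E'" using nn c by (intro mult_right_mono) auto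
    finally show ?case using 1 2 by simp
  qed
  moreover have "0 \<le> 1 / c + C + C / e" using c e by (intro add_nonneg_nonneg divide_nonneg_nonneg) auto
  ultimately show ?thesis by blast
qed

section \<open>Empirical measures and the weak-star topology\<close>

lemma topspace_weak_star_topology: "topspace weak_star_topology = borel_probabilities"
proof -
  have "borel_probabilities \<in> {{\<mu> \<in> borel_probabilities. (LINT x|\<mu>. f x) \<in> U} | (f :: 'a \<Rightarrow> real) U.
        continuous_on UNIV f \<and> open U}"
    by (intro CollectI exI[of _ "\<lambda>_. 0"] exI[of _ UNIV]) auto
  then show ?thesis
    unfolding weak_star_topology_def topology_generated_by_topspace by blast
qed

text \<open>Convergence of integrals puts the sequence eventually into every generating set that
  contains the limit, and this property survives finite intersections and arbitrary unions, hence
  holds for every open set.\<close>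

lemma in_closure_weak_star_I:
  fixes \<mu> :: "'a::topological_space measure" and \<nu> :: "nat \<Rightarrow> 'a measure"
  assumes "\<mu> \<in> borel_probabilities" "\<And>n. \<nu> n \<in> borel_probabilities" "\<And>n. \<nu> n \<in> S"
    and "\<And>f::'a \<Rightarrow> real. continuous_on UNIV f \<Longrightarrow> (\<lambda>n. LINT x|\<nu> n. f x) \<longlonglongrightarrow> (LINT x|\<mu>. f x)"
  shows "\<mu> \<in> weak_star_topology closure_of S"
proof -
  have "\<mu> \<in> T \<longrightarrow> eventually (\<lambda>n. \<nu> n \<in> T) sequentially"
    if "generate_topology_on {{\<mu> \<in> borel_probabilities. (LINT x|\<mu>. f x) \<in> U} | (f :: 'a \<Rightarrow> real) U.
        continuous_on UNIV f \<and> open U} T" for T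
    using that
  proof induction
    case (Int a b)
    then show ?case by (auto elim: eventually_elim2)
  next
    case (UN K)
    show ?case
    proof
      assume "\<mu> \<in> \<Union>K"
      then obtain k where k: "k \<in> K" "\<mu> \<in> k" by blast
      then have "eventually (\<lambda>n. \<nu> n \<in> k) sequentially" using UN by blast
      then show "eventually (\<lambda>n. \<nu> n \<in> \<Union>K) sequentially"
        by (rule eventually_mono) (use k in blast)
    qed
  next
    case (Basis s)
    then obtain f :: "'a \<Rightarrow> real" and U where s: "s = {\<mu> \<in> borel_probabilities. (LINT x|\<mu>. f x) \<in> U}"
      "continuous_on UNIV f" "open U" by blast
    show ?case
    proof
      assume "\<mu> \<in> s"
      then have "eventually (\<lambda>n. (LINT x|\<nu> n. f x) \<in> U) sequentially"
        using topological_tendstoD[OF assms(4)[OF s(2)] s(3)] s(1) by simp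
      then show "eventually (\<lambda>n. \<nu> n \<in> s) sequentially"
        by (rule eventually_mono) (use assms(2) s(1) in auto)
    qed
  qed simp
  then have ev: "eventually (\<lambda>n. \<nu> n \<in> T) sequentially" if "\<mu> \<in> T" "openin weak_star_topology T" for T
    using that unfolding weak_star_topology_def openin_topology_generated_by_iff by blast
  have "\<exists>\<nu>'\<in>S. \<nu>' \<in> T" if "\<mu> \<in> T" "openin weak_star_topology T" for T
    using eventually_happens[OF ev[OF that]] assms(3) by auto
  then show ?thesis
    using assms(1) by (auto simp: in_closure_of topspace_weak_star_topology)
qed

text \<open>The half-line above e is open, so a violated bound would yield a generating
  neighbourhood that misses S.\<close>

lemma in_closure_weak_star_bound:
  fixes f :: "'a::topological_space \<Rightarrow> real"
  assumes "\<mu> \<in> weak_star_topology closure_of S" "continuous_on UNIV f" "\<And>\<nu>. \<nu> \<in> S \<Longrightarrow> (LINT x|\<nu>. f x) \<le> e"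
  shows "(LINT x|\<mu>. f x) \<le> e"
proof (rule ccontr)
  assume a: "\<not> (LINT x|\<mu>. f x) \<le> e"
  let ?T = "{\<mu> \<in> borel_probabilities. (LINT x|\<mu>. f x) \<in> {e<..}}"
  have "openin weak_star_topology ?T"
    unfolding weak_star_topology_def
    by (rule topology_generated_by_Basis, rule CollectI, rule exI[of _ f], rule exI[of _ "{e<..}"])
      (simp add: assms(2))
  moreover have "\<mu> \<in> borel_probabilities"
    using subsetD[OF closure_of_subset_topspace assms(1)] by (simp only: topspace_weak_star_topology)
  then have "\<mu> \<in> ?T" using a by simp
  ultimately have "\<exists>\<nu>. \<nu> \<in> S \<and> \<nu> \<in> ?T"
    using conjunct2[OF assms(1)[unfolded in_closure_of], rule_format, of ?T] by simp
  then show False using assms(3) by fastforce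
qed

lemma convex_combination_in_borel_probabilities:
  fixes \<mu> \<nu> :: "'a::topological_space measure"
  assumes "\<mu> \<in> borel_probabilities" "\<nu> \<in> borel_probabilities" "0 \<le> s" "s \<le> 1"
  shows "convex_combination s \<mu> \<nu> \<in> borel_probabilities"
proof -
  have sets: "sets \<mu> = sets borel" "sets \<nu> = sets borel" and p: "prob_space \<mu>" "prob_space \<nu>"
    using assms by (auto simp: borel_probabilities_def)
  then have sp: "space \<mu> = UNIV" "space \<nu> = UNIV"
    using sets_eq_imp_space_eq[OF sets(1)] sets_eq_imp_space_eq[OF sets(2)] by (simp_all only: space_borel)
  have "sigma_algebra UNIV (sets (borel :: 'a measure))"
    using sets.sigma_algebra_axioms[of "borel :: 'a measure"] by (simp only: space_borel)
  then have sc: "sets (convex_combination s \<mu> \<nu>) = sets borel" "space (convex_combination s \<mu> \<nu>) = UNIV"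
    unfolding convex_combination_def
    by (rule sigma_algebra.sets_measure_of_eq, rule sigma_algebra.space_measure_of_eq)
  have "emeasure (convex_combination s \<mu> \<nu>) UNIV = ennreal s * 1 + ennreal (1 - s) * 1"
    using emeasure_convex_combination[OF sets, of UNIV s] prob_space.emeasure_space_1[OF p(1)]
      prob_space.emeasure_space_1[OF p(2)] sp by simp
  also have "\<dots> = 1" using assms(3,4) by (simp flip: ennreal_plus)
  finally have "prob_space (convex_combination s \<mu> \<nu>)"
    by (intro prob_spaceI) (simp only: sc(2))
  then show ?thesis using sc(1) by (simp only: borel_probabilities_def mem_Collect_eq)
qed

lemma return_in_borel_probabilities: "return borel p \<in> borel_probabilities"
  by (simp add: borel_probabilities_def prob_space_return)

lemma emeasure_dirac_combination:
  fixes p q :: "'a::topological_space"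
  assumes "A \<in> sets borel"
  shows "emeasure (convex_combination s (return borel p) (return borel q)) A =
    ennreal s * indicator A p + ennreal (1 - s) * indicator A q"
  by (subst emeasure_convex_combination) (use assms in \<open>simp_all\<close>)

lemma dirac_combination_unique:
  fixes p q :: "'a::topological_space"
  assumes "\<mu> \<in> borel_probabilities" "{p} \<in> sets borel" "{q} \<in> sets borel" "p \<noteq> q"
    and "AE x in \<mu>. x = p \<or> x = q"
  shows "\<mu> = convex_combination (measure \<mu> {p}) (return borel p) (return borel q)"
proof -
  interpret prob_space \<mu> using assms(1) by (simp add: borel_probabilities_def)
  have sets: "sets \<mu> = sets borel" using assms(1) by (simp add: borel_probabilities_def)
  have pq: "{p} \<in> events" "{q} \<in> events" using assms sets by auto
  define s where "s = measure \<mu> {p}"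
  have "1 = prob {p, q}"
  proof -
    have "AE x in \<mu>. x \<in> {p, q}" using assms(5) by auto
    moreover have "{p, q} \<in> events"
      using sets.Un[OF pq] by (simp only: insert_is_Un[of p "{q}"])
    ultimately show ?thesis using prob_eq_1[of "{p, q}"] by metis
  qed
  also have "\<dots> = prob {p} + prob {q}"
    using finite_measure_Union[OF pq] assms(4) by (simp add: insert_is_Un[of p "{q}"])
  finally have q: "prob {q} = 1 - s" by (simp add: s_def)
  have s: "0 \<le> s" "s \<le> 1" by (simp_all add: s_def)
  have cc: "sets (convex_combination s (return borel p) (return borel q)) = sets borel"
    using convex_combination_in_borel_probabilities[OF return_in_borel_probabilities[of p] return_in_borel_probabilities[of q] s]
    by (simp add: borel_probabilities_def)
  have "\<mu> = convex_combination s (return borel p) (return borel q)"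
  proof (rule measure_eqI)
    show "sets \<mu> = sets (convex_combination s (return borel p) (return borel q))" using sets cc by simp
    fix A assume A: "A \<in> events"
    have Aset: "A \<inter> {p} \<in> events" "A \<inter> {q} \<in> events" using A pq by auto
    have "prob A = prob ((A \<inter> {p}) \<union> (A \<inter> {q}))"
      by (rule finite_measure_eq_AE) (use assms(5) A Aset in auto)
    also have "\<dots> = prob (A \<inter> {p}) + prob (A \<inter> {q})"
      by (rule finite_measure_Union) (use Aset assms(4) in auto)
    also have "prob (A \<inter> {p}) = s * indicator A p" by (cases "p \<in> A") (simp_all add: s_def)
    also have "prob (A \<inter> {q}) = (1 - s) * indicator A q" by (cases "q \<in> A") (simp_all add: q)
    finally have "emeasure \<mu> A = ennreal (s * indicator A p + (1 - s) * indicator A q)"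
      by (simp add: emeasure_eq_measure)
    also have "\<dots> = ennreal s * indicator A p + ennreal (1 - s) * indicator A q"
      using s by (auto simp: indicator_def simp flip: ennreal_plus)
    finally show "emeasure \<mu> A = emeasure (convex_combination s (return borel p) (return borel q)) A"
      using A sets by (simp add: emeasure_dirac_combination)
  qed
  then show ?thesis by (simp add: s_def)
qed

lemma integral_dirac_combination:
  fixes p q :: "'a::topological_space" and f :: "'a \<Rightarrow> real"
  assumes "{p} \<in> sets borel" "{q} \<in> sets borel" "p \<noteq> q" "0 \<le> s" "s \<le> 1"
    and f: "f \<in> borel_measurable borel"
  shows "(LINT x|convex_combination s (return borel p) (return borel q). f x) = s * f p + (1 - s) * f q"
proof -
  let ?\<mu> = "convex_combination s (return borel p) (return borel q)"
  have bp: "?\<mu> \<in> borel_probabilities"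
    by (intro convex_combination_in_borel_probabilities return_in_borel_probabilities assms)
  then interpret prob_space ?\<mu> by (simp add: borel_probabilities_def)
  have sets [simp]: "sets ?\<mu> = sets borel" using bp by (simp add: borel_probabilities_def)
  then have sp [simp]: "space ?\<mu> = UNIV" using sets_eq_imp_space_eq[OF sets] by (simp only: space_borel)
  have p: "prob {p} = s" "prob {q} = 1 - s"
    using assms by (simp_all add: measure_def emeasure_dirac_combination)
  have "{p} \<union> {q} \<in> sets borel" using assms(1,2) by (rule sets.Un)
  then have N: "- {p, q} \<in> sets borel" by (intro borel_comp) (simp only: insert_is_Un[of p "{q}"])
  then have "emeasure ?\<mu> (- {p, q}) = 0"
    by (subst emeasure_dirac_combination) simp_all
  then have ae: "AE x in ?\<mu>. x \<in> {p, q}"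
    using N by (intro AE_I[of _ _ "- {p, q}"]) auto
  have "(LINT x|?\<mu>. f x) = (LINT x|?\<mu>. f p * indicator {p} x + f q * indicator {q} x)"
  proof (rule integral_cong_AE)
    show "f \<in> borel_measurable ?\<mu>" using f by (simp add: measurable_cong_sets[OF sets refl])
    show "(\<lambda>x. f p * indicator {p} x + f q * indicator {q} x) \<in> borel_measurable ?\<mu>"
      using assms(1,2) by (intro borel_measurable_add borel_measurable_times borel_measurable_indicator) simp_all
    show "AE x in ?\<mu>. f x = f p * indicator {p} x + f q * indicator {q} x"
      using ae by (rule AE_mp) (use assms(3) in auto)
  qed
  also have "\<dots> = f p * prob {p} + f q * prob {q}"
  proof -
    have "integrable ?\<mu> (indicat_real {p})" "integrable ?\<mu> (indicat_real {q})"
      using assms(1,2) by (simp_all add: integrable_indicator_iff emeasure_eq_measure)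
    then show ?thesis by simp
  qed
  finally show ?thesis by (simp add: p mult.commute)
qed

section \<open>Squared distances as continuous functions on the torus\<close>

definition circle_dist :: "real \<Rightarrow> circle \<Rightarrow> real" where
  "circle_dist b x = nid (rep_circle x - b)"

definition torus_sq_dist :: "real \<Rightarrow> torus \<Rightarrow> real" where
  "torus_sq_dist b x = (circle_dist 0 (fst x))\<^sup>2 + (circle_dist b (snd x))\<^sup>2"

lemma to_circle_rep_circle: "to_circle (rep_circle x) = x"
  by (rule Quotient3_abs_rep[OF Quotient3_circle])

lemma circle_dist_to_circle: "circle_dist b (to_circle x) = nid (x - b)"
proof -
  have "rep_circle (to_circle x) - x \<in> \<int>"
    using to_circle_rep_circle[of "to_circle x"] by (simp only: to_circle_eq_iff)
  then obtain k where "rep_circle (to_circle x) - x = of_int k" by (rule Ints_cases)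
  then have "rep_circle (to_circle x) - b = (x - b) + of_int k" by simp
  then show ?thesis by (simp only: circle_dist_def nid_add_of_int)
qed

lemma continuous_on_circleI:
  assumes "continuous_on UNIV (\<lambda>x. f (to_circle x))"
  shows "continuous_on UNIV f"
proof -
  have "open (f -` U)" if "open U" for U
    using assms that by (simp add: open_circle_def continuous_on_open_vimage vimage_comp[symmetric] o_def vimage_def)
  then show ?thesis by (simp add: continuous_on_open_vimage)
qed

lemma continuous_on_circle_dist: "continuous_on UNIV (circle_dist b)"
  by (rule continuous_on_circleI) (simp only: circle_dist_to_circle, intro continuous_intros)

lemma continuous_on_torus_sq_dist: "continuous_on UNIV (torus_sq_dist b)"
  unfolding torus_sq_dist_def
  by (intro continuous_on_add continuous_on_power continuous_on_compose2[OF continuous_on_circle_dist]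
      continuous_on_fst continuous_on_snd continuous_on_id subset_UNIV)

lemma torus_sq_dist_to_torus: "torus_sq_dist b (to_torus z) = lattice_sq_dist b z"
  by (simp add: torus_sq_dist_def to_torus_def circle_dist_to_circle lattice_sq_dist_def)

lemma to_torus_surj: "\<exists>z. x = to_torus z"
  by (rule exI[of _ "(rep_circle (fst x), rep_circle (snd x))"]) (simp add: to_torus_def to_circle_rep_circle)

lemma torus_sq_dist_zero_iff: "torus_sq_dist b x = 0 \<longleftrightarrow> x = (to_circle 0, to_circle b)"
proof -
  obtain z where z: "x = to_torus z" using to_torus_surj by blast
  show ?thesis unfolding z torus_sq_dist_to_torus by (rule lattice_sq_dist_zero_iff)
qed

lemma torus_sq_dist_nonneg [simp]: "0 \<le> torus_sq_dist b x"
  by (simp add: torus_sq_dist_def)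

lemma torus_sq_dist_le: "torus_sq_dist b x \<le> 1"
  using to_torus_surj[of x] lattice_sq_dist_le by (auto simp: torus_sq_dist_to_torus)

section \<open>Time averages and a criterion for the limit set\<close>

definition time_average :: "(real \<Rightarrow> torus \<Rightarrow> torus) \<Rightarrow> torus \<Rightarrow> (torus \<Rightarrow> real) \<Rightarrow> real \<Rightarrow> real" where
  "time_average \<Psi> x f t = 1 / t * integral {0..t} (\<lambda>s. f (\<Psi> s x))"

context
  fixes \<Psi> :: "real \<Rightarrow> torus \<Rightarrow> torus" and x :: torus
  assumes orbit: "continuous_on UNIV (\<lambda>s. \<Psi> s x)"
begin

lemma continuous_on_along_orbit:
  fixes f :: "torus \<Rightarrow> real"
  assumes "continuous_on UNIV f"
  shows "continuous_on A (\<lambda>s. f (\<Psi> s x))"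
  using continuous_on_compose2[OF assms orbit subset_UNIV] continuous_on_subset by blast

lemma integrable_along_orbit:
  fixes f :: "torus \<Rightarrow> real"
  shows "continuous_on UNIV f \<Longrightarrow> (\<lambda>s. f (\<Psi> s x)) integrable_on {a..b}"
  by (intro integrable_continuous_interval continuous_on_along_orbit)

lemma time_average_add:
  assumes "continuous_on UNIV f" "continuous_on UNIV g"
  shows "time_average \<Psi> x (\<lambda>y. f y + g y) t = time_average \<Psi> x f t + time_average \<Psi> x g t"
  unfolding time_average_def
  by (subst Henstock_Kurzweil_Integration.integral_add)
    (use assms in \<open>auto intro: integrable_along_orbit simp: distrib_left\<close>)

lemma time_average_cmult: "time_average \<Psi> x (\<lambda>y. c * f y) t = c * time_average \<Psi> x f t"
  unfolding time_average_def by simp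

lemma time_average_const: "0 < t \<Longrightarrow> time_average \<Psi> x (\<lambda>_. c) t = c"
  unfolding time_average_def by simp

lemma continuous_on_time_average:
  assumes f: "continuous_on UNIV f" and "0 < T"
  shows "continuous_on {T..} (time_average \<Psi> x f)"
proof -
  obtain H where H: "\<And>s. - 1 < s \<Longrightarrow> (H has_real_derivative f (\<Psi> s x)) (at s)"
    "\<And>s t. - 1 \<le> s \<Longrightarrow> s \<le> t \<Longrightarrow> integral {s..t} (\<lambda>s. f (\<Psi> s x)) = H t - H s"
    by (rule integral_eq_diff_antiderivative[OF continuous_on_along_orbit[OF f], of "-1"]) blast
  have "continuous_on {T..} H"
    by (intro continuous_at_imp_continuous_on ballI DERIV_isCont[OF H(1)]) (use assms(2) in auto)
  then have "continuous_on {T..} (\<lambda>t. 1 / t * (H t - H 0))"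
    using assms(2) by (intro continuous_intros) auto
  then show ?thesis
    by (rule continuous_on_eq) (use H(2)[of 0] assms(2) in \<open>auto simp: time_average_def\<close>)
qed

lemma ex_empirical_measure:
  assumes "0 < t"
  obtains \<mu> where "is_empirical_measure \<Psi> x t \<mu>"
  using is_empirical_measure_distr[of \<Psi> x t, OF orbit assms] by blast

text \<open>Every limit measure integrates \<open>\<eta>\<close> to 0 and so lives on the two
  points. Conversely, the averages of h come near 0 and near 1 arbitrarily late and depend
  continuously on t, so they approach any s along times tending to infinity. A continuous f differs
  from an affine function of h by a function that vanishes at p and q, whose averages tend to 0;
  thus the averages of h determine the limits of all others.\<close>

lemma p_omega_eq_dirac_segment:
  fixes h \<eta> :: "torus \<Rightarrow> real" and K :: real
  assumes pq: "p \<noteq> q"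
    and h: "continuous_on UNIV h" "\<And>y. 0 \<le> h y" "\<And>y. h y \<le> 1" "h p = 1" "h q = 0"
    and \<eta>: "continuous_on UNIV \<eta>" "\<And>y. 0 \<le> \<eta> y" "\<And>y. \<eta> y \<le> K" "\<And>y. \<eta> y = 0 \<longleftrightarrow> y = p \<or> y = q"
    and vanish: "\<And>g. continuous_on UNIV g \<Longrightarrow> g p = 0 \<Longrightarrow> g q = 0 \<Longrightarrow> (time_average \<Psi> x g \<longlongrightarrow> 0) at_top"
    and near_p: "\<And>e T. 0 < e \<Longrightarrow> \<exists>t\<ge>T. 0 < t \<and> 1 - e \<le> time_average \<Psi> x h t"
    and near_q: "\<And>e T. 0 < e \<Longrightarrow> \<exists>t\<ge>T. 0 < t \<and> time_average \<Psi> x h t \<le> e"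
  shows "p_omega \<Psi> x = dirac_segment p q"
proof -
  \<comment> \<open>That points are closed, and hence Borel, is read off from the level sets of
    \<open>\<eta>\<close> and h.\<close>
  have closed: "closed {p}" "closed {q}"
  proof -
    have *: "closed {y. f y = c}" if "continuous_on UNIV f" for f :: "torus \<Rightarrow> real" and c
      using that by (rule closed_Collect_eq) (rule continuous_on_const)
    have "closed {y. \<eta> y = 0}" "closed {y. h y = 1}" "closed {y. h y = 0}"
      by (rule *[OF \<eta>(1)], rule *[OF h(1)], rule *[OF h(1)])
    moreover have "{p} = {y. \<eta> y = 0} \<inter> {y. h y = 1}" "{q} = {y. \<eta> y = 0} \<inter> {y. h y = 0}"
      using \<eta>(4) h(4,5) by auto
    ultimately show "closed {p}" "closed {q}" by (simp_all only: closed_Int)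
  qed
  then have borel: "{p} \<in> sets borel" "{q} \<in> sets borel" by (auto intro: borel_closed)
  show ?thesis
  proof (intro equalityI subsetI)
    fix \<mu> assume "\<mu> \<in> p_omega \<Psi> x"
    then have \<mu>: "\<mu> \<in> weak_star_topology closure_of {\<mu>. \<exists>t\<ge>T. is_empirical_measure \<Psi> x t \<mu>}" if "0 < T" for T
      using that by (auto simp: p_omega_def)
    have bp: "\<mu> \<in> borel_probabilities"
      using \<mu>[of 1] by (simp add: in_closure_of topspace_weak_star_topology)
    then interpret prob_space \<mu> by (simp add: borel_probabilities_def)
    have sets: "sets \<mu> = sets borel" using bp by (simp add: borel_probabilities_def)
    have meas: "\<eta> \<in> borel_measurable \<mu>"
      using borel_measurable_continuous_onI[OF \<eta>(1)] by (simp add: measurable_cong_sets[OF sets refl])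
    have int: "integrable \<mu> \<eta>"
      by (rule integrable_const_bound[of _ K]) (use \<eta>(2,3) meas in auto)
    have "(LINT y|\<mu>. \<eta> y) \<le> 0 + e" if "0 < e" for e
    proof -
      have "eventually (\<lambda>t. time_average \<Psi> x \<eta> t < e) at_top"
        using order_tendstoD(2)[OF vanish[OF \<eta>(1)] that] \<eta>(4) by simp
      then obtain T where T: "\<And>t. T \<le> t \<Longrightarrow> time_average \<Psi> x \<eta> t < e"
        by (auto simp: eventually_at_top_linorder)
      have "(LINT y|\<mu>. \<eta> y) \<le> e"
      proof (rule in_closure_weak_star_bound[OF \<mu>[of "max T 1"] \<eta>(1)])
        fix \<nu> assume "\<nu> \<in> {\<mu>. \<exists>t\<ge>max T 1. is_empirical_measure \<Psi> x t \<mu>}"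
        then obtain t where t: "max T 1 \<le> t" "is_empirical_measure \<Psi> x t \<nu>" by blast
        then have "(LINT y|\<nu>. \<eta> y) = time_average \<Psi> x \<eta> t"
          using \<eta>(1) by (simp add: is_empirical_measure_def time_average_def)
        then show "(LINT y|\<nu>. \<eta> y) \<le> e" using T[of t] t(1) by simp
      qed simp
      then show ?thesis by simp
    qed
    then have "(LINT y|\<mu>. \<eta> y) \<le> 0" by (rule field_le_epsilon)
    moreover have "0 \<le> (LINT y|\<mu>. \<eta> y)" using \<eta>(2) by simp
    ultimately have "(LINT y|\<mu>. \<eta> y) = 0" by (rule antisym)
    then have "AE y in \<mu>. \<eta> y = 0"
      using integral_nonneg_eq_0_iff_AE[OF int] \<eta>(2) by simp
    then have "AE y in \<mu>. y = p \<or> y = q" by (simp only: \<eta>(4))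
    from dirac_combination_unique[OF bp borel pq this]
    show "\<mu> \<in> dirac_segment p q"
      unfolding dirac_segment_def by (intro CollectI exI[of _ "prob {p}"]) simp
  next
    fix \<mu> assume "\<mu> \<in> dirac_segment p q"
    then obtain s where s: "0 \<le> s" "s \<le> 1" "\<mu> = convex_combination s (return borel p) (return borel q)"
      unfolding dirac_segment_def by blast
    have bp: "\<mu> \<in> borel_probabilities" unfolding s(3)
      by (intro convex_combination_in_borel_probabilities return_in_borel_probabilities s)
    let ?A = "time_average \<Psi> x h"
    have approx: "\<exists>t\<ge>T. 0 < t \<and> \<bar>?A t - s\<bar> \<le> e" if e: "0 < e" for e T
    proof -
      obtain t1 where t1: "max T 1 \<le> t1" "1 - e \<le> ?A t1" using near_p[OF e] by blast
      obtain t2 where t2: "max T 1 \<le> t2" "?A t2 \<le> e" using near_q[OF e] by blast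
      \<comment> \<open>If s is not enclosed by the two averages, the one on its side is squeezed
        between s and the end of \<open>{0..1}\<close> and is itself within e of s.\<close>
      consider "?A t1 \<le> s" | "s \<le> ?A t2" | "?A t2 \<le> s" "s \<le> ?A t1" by linarith
      then show ?thesis
      proof cases
        case 1
        then show ?thesis using t1 s by (intro exI[of _ t1]) auto
      next
        case 2
        then show ?thesis using t2 s by (intro exI[of _ t2]) auto
      next
        case 3
        have "connected (?A ` {max T 1..})"
          by (intro connected_continuous_image continuous_on_time_average h(1)) simp_all
        moreover have "?A t2 \<in> ?A ` {max T 1..}" "?A t1 \<in> ?A ` {max T 1..}" using t1 t2 by auto
        ultimately have "{?A t2..?A t1} \<subseteq> ?A ` {max T 1..}" by (rule connected_contains_Icc)
        then obtain t where "max T 1 \<le> t" "?A t = s" using 3 by (auto simp: subset_iff image_iff)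
        then show ?thesis using e by (intro exI[of _ t]) auto
      qed
    qed
    have "\<mu> \<in> weak_star_topology closure_of {\<mu>. \<exists>t\<ge>T. is_empirical_measure \<Psi> x t \<mu>}" if T: "0 < T" for T
    proof -
      have "\<exists>t \<nu>. T + real n \<le> t \<and> 0 < t \<and> \<bar>?A t - s\<bar> \<le> 1 / (real n + 1) \<and> is_empirical_measure \<Psi> x t \<nu>" for n
      proof -
        obtain t where t: "T + real n \<le> t" "0 < t" "\<bar>?A t - s\<bar> \<le> 1 / (real n + 1)"
          using approx[of "1 / (real n + 1)" "T + real n"] by auto
        obtain \<nu> where "is_empirical_measure \<Psi> x t \<nu>" using t(2) by (rule ex_empirical_measure)
        with t show ?thesis by blast
      qed
      then obtain t \<nu> where t: "\<And>n. T + real n \<le> t n" "\<And>n. 0 < t n" "\<And>n. \<bar>?A (t n) - s\<bar> \<le> 1 / (real n + 1)"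
        "\<And>n. is_empirical_measure \<Psi> x (t n) (\<nu> n)" by metis
      have t_lim: "filterlim t at_top sequentially"
      proof (rule filterlim_at_top_mono[OF filterlim_real_sequentially])
        show "\<forall>\<^sub>F n in sequentially. real n \<le> t n"
          using t(1) T by (intro always_eventually allI) (smt (verit))
      qed
      have A_lim: "(\<lambda>n. ?A (t n)) \<longlonglongrightarrow> s"
      proof (rule LIMSEQ_I)
        show "\<exists>no. \<forall>n\<ge>no. norm (?A (t n) - s) < r" if r: "0 < r" for r
        proof -
          obtain N where N: "1 / real (Suc N) < r" using r nat_approx_posE by blast
          have "norm (?A (t n) - s) < r" if "N \<le> n" for n
          proof -
            have "1 / (real n + 1) \<le> 1 / real (Suc N)" using that by (intro divide_left_mono) auto
            then show ?thesis using t(3)[of n] N by simp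
          qed
          then show ?thesis by blast
        qed
      qed
      show ?thesis
      proof (rule in_closure_weak_star_I[of _ \<nu>])
        show "\<nu> n \<in> borel_probabilities" for n using t(4) by (simp add: is_empirical_measure_def)
        show "\<nu> n \<in> {\<mu>. \<exists>t\<ge>T. is_empirical_measure \<Psi> x t \<mu>}" for n
          using t(4)[of n] t(1)[of n] by (intro CollectI exI[of _ "t n"]) auto
        fix f :: "torus \<Rightarrow> real" assume f: "continuous_on UNIV f"
        define g where "g = (\<lambda>y. f y + (- f p + f q) * h y + - f q)"
        have g: "continuous_on UNIV g" unfolding g_def by (intro continuous_intros f h)
        have "(time_average \<Psi> x g \<longlongrightarrow> 0) at_top"
          by (rule vanish[OF g]) (simp_all add: g_def h)
        then have "(\<lambda>n. time_average \<Psi> x g (t n)) \<longlonglongrightarrow> 0" using t_lim by (rule filterlim_compose)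
        then have "(\<lambda>n. time_average \<Psi> x g (t n) + ((f p - f q) * ?A (t n) + f q)) \<longlonglongrightarrow> 0 + ((f p - f q) * s + f q)"
          by (intro tendsto_intros A_lim)
        moreover have "time_average \<Psi> x g (t n) + ((f p - f q) * ?A (t n) + f q) = (LINT y|\<nu> n. f y)" for n
        proof -
          have "time_average \<Psi> x g (t n) = time_average \<Psi> x f (t n) + (- f p + f q) * ?A (t n) + - f q"
            unfolding g_def
            by (subst time_average_add time_average_cmult time_average_const;
                (intro continuous_intros f h t(2))?)+ simp
          moreover have "(LINT y|\<nu> n. f y) = time_average \<Psi> x f (t n)"
            using t(4)[of n] f by (simp add: is_empirical_measure_def time_average_def)
          ultimately show ?thesis by (simp add: algebra_simps)
        qed
        moreover have "0 + ((f p - f q) * s + f q) = (LINT y|\<mu>. f y)"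
          unfolding s(3) by (subst integral_dirac_combination[OF borel pq s(1,2)])
            (simp_all add: borel_measurable_continuous_onI f algebra_simps)
        ultimately show "(\<lambda>n. LINT y|\<nu> n. f y) \<longlonglongrightarrow> (LINT y|\<mu>. f y)" by simp
      qed (rule bp)
    qed
    then show "\<mu> \<in> p_omega \<Psi> x" by (auto simp: p_omega_def)
  qed
qed

end

section \<open>Almost every starting point\<close>

text \<open>A cover by intervals of length \<open>2 * e / q\<close>, spaced \<open>1 / q\<close>
  apart, needs a number of intervals proportional to q. The bound is therefore uniform in q, and
  summability of the widths is all that Borel-Cantelli asks for later.\<close>

lemma measure_nid_small:
  assumes "q \<ge> 1" "0 \<le> e"
  shows "measure lborel {y \<in> {- real M..real M}. nid (real q * y + c) \<le> e} \<le> (2 * real M + 4) * (2 * e)"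
proof -
  define K where "K = {\<lfloor>c\<rfloor> - int (q * M) - 1..\<lfloor>c\<rfloor> + int (q * M) + 2}"
  define I where "I = (\<lambda>k::int. {(of_int k - c - e) / real q..(of_int k - c + e) / real q})"
  have q: "real q \<ge> 1" using assms by simp
  have sub: "{y \<in> {- real M..real M}. nid (real q * y + c) \<le> e} \<subseteq> (\<Union>k\<in>K. I k)"
  proof clarify
    fix y assume y: "y \<in> {- real M..real M}" "nid (real q * y + c) \<le> e"
    obtain k :: int where k: "nid (real q * y + c) = \<bar>real q * y + c - of_int k\<bar>"
      using nid_attained by blast
    have "real q * (- real M) \<le> real q * y" "real q * y \<le> real q * real M"
      using y q by (intro mult_left_mono; simp)+
    then have qy: "- real (q * M) \<le> real q * y" "real q * y \<le> real (q * M)" by simp_all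
    have "\<bar>real q * y + c - of_int k\<bar> \<le> 1/2" using k nid_le_half[of "real q * y + c"] by simp
    then have "of_int k \<le> c + real (q * M) + 1/2" "c - real (q * M) - 1/2 \<le> of_int k"
      using qy by (simp_all only: abs_le_iff) linarith+
    then have "k \<in> K" unfolding K_def atLeastAtMost_iff by linarith
    moreover have "\<bar>real q * y + c - of_int k\<bar> \<le> e" using y k by simp
    then have "y \<in> I k" using q by (simp add: I_def field_simps abs_le_iff)
    ultimately show "y \<in> (\<Union>k\<in>K. I k)" by blast
  qed
  have closed: "closed {y. nid (real q * y + c) \<le> e}"
    by (intro closed_Collect_le continuous_intros)
  have "measure lborel {y \<in> {- real M..real M}. nid (real q * y + c) \<le> e} \<le> measure lborel (\<Union>k\<in>K. I k)"
  proof (rule measure_mono_fmeasurable[OF sub])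
    have "{y \<in> {- real M..real M}. nid (real q * y + c) \<le> e} = {- real M..real M} \<inter> {y. nid (real q * y + c) \<le> e}"
      by auto
    then show "{y \<in> {- real M..real M}. nid (real q * y + c) \<le> e} \<in> sets lborel"
      using closed by simp
    show "(\<Union>k\<in>K. I k) \<in> fmeasurable lborel"
    proof (rule fmeasurable.finite_UN)
      show "I k \<in> fmeasurable lborel" for k
        unfolding I_def by (rule fmeasurableI) (simp_all add: emeasure_lborel_Icc_eq)
    qed (simp add: K_def)
  qed
  also have "\<dots> \<le> (\<Sum>k\<in>K. measure lborel (I k))"
    by (rule measure_UNION_le) (simp_all add: K_def I_def)
  also have "\<dots> = (\<Sum>k\<in>K. 2 * e / real q)"
    using assms q by (intro sum.cong) (auto simp: I_def diff_divide_distrib add_divide_distrib divide_right_mono)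
  also have "\<dots> = real (2 * (q * M) + 4) * (2 * e / real q)"
    by (simp add: K_def nat_add_distrib nat_mult_distrib)
  also have "\<dots> = (2 * real M + 4 / real q) * (2 * e)"
    using q by (simp add: field_simps)
  also have "\<dots> \<le> (2 * real M + 4) * (2 * e)"
    using q assms by (intro mult_right_mono add_left_mono) (auto simp: field_simps)
  finally show ?thesis .
qed

lemma AE_eventually_nid_gt:
  fixes q :: "nat \<Rightarrow> nat" and c e :: "nat \<Rightarrow> real"
  assumes "\<And>j. q j \<ge> 1" "\<And>j. 0 \<le> e j" "summable e"
  shows "AE y in lborel. eventually (\<lambda>j. e j < nid (real (q j) * y + c j)) sequentially"
proof -
  \<comment> \<open>The bad sets recur periodically along the line; they are cut to bounded
    intervals to have finite measure.\<close>
  define A where "A = (\<lambda>M j. {y \<in> {- real M..real M}. nid (real (q j) * y + c j) \<le> e j})"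
  have A_sets: "A M j \<in> sets lborel" for M j
  proof -
    have "closed {y. nid (real (q j) * y + c j) \<le> e j}" by (intro closed_Collect_le continuous_intros)
    then have "{- real M..real M} \<inter> {y. nid (real (q j) * y + c j) \<le> e j} \<in> sets lborel" by simp
    moreover have "A M j = {- real M..real M} \<inter> {y. nid (real (q j) * y + c j) \<le> e j}" by (auto simp: A_def)
    ultimately show ?thesis by simp
  qed
  have "AE y in lborel. eventually (\<lambda>j. y \<in> space lborel - A M j) sequentially" for M
  proof (rule borel_cantelli_AE1)
    show "A M j \<in> sets lborel" for j by (rule A_sets)
    have "emeasure lborel (A M j) \<le> emeasure lborel {- real M..real M}" for j
      by (rule emeasure_mono) (auto simp: A_def)
    then show "emeasure lborel (A M j) < \<infinity>" for j
      by (rule le_less_trans) simp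
    show "summable (\<lambda>j. measure lborel (A M j))"
    proof (rule summable_comparison_test')
      show "summable (\<lambda>j. (2 * real M + 4) * (2 * e j))" using assms(3) by (intro summable_mult)
      show "norm (measure lborel (A M j)) \<le> (2 * real M + 4) * (2 * e j)" for j
        using measure_nid_small[OF assms(1)[of j] assms(2)[of j]] by (simp add: A_def)
    qed
  qed
  then have "AE y in lborel. \<forall>M. eventually (\<lambda>j. y \<in> space lborel - A M j) sequentially"
    by (simp only: AE_all_countable) simp
  then show ?thesis
  proof (rule AE_mp, intro AE_I2 impI)
    fix y :: real assume *: "\<forall>M. eventually (\<lambda>j. y \<in> space lborel - A M j) sequentially"
    obtain M :: nat where "\<bar>y\<bar> \<le> real M" using real_arch_simple by blast
    then have M: "y \<in> {- real M..real M}" by auto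
    have "eventually (\<lambda>j. y \<in> space lborel - A M j) sequentially" using * ..
    then show "eventually (\<lambda>j. e j < nid (real (q j) * y + c j)) sequentially"
      by (rule eventually_mono) (use M in \<open>auto simp: A_def\<close>)
  qed
qed

lemma AE_avoids_lattice: "AE y in lborel. avoids_lattice \<alpha> (y - b)"
proof (rule AE_I')
  define N where "N = range (\<lambda>(i::int, k::int). of_int k - of_int i * \<alpha> + b)"
  have "countable N" unfolding N_def by (intro countable_image) simp
  then show "N \<in> null_sets lborel" by (rule countable_imp_null_set_lborel)
  show "{y \<in> space lborel. \<not> avoids_lattice \<alpha> (y - b)} \<subseteq> N"
  proof clarify
    fix y assume "\<not> avoids_lattice \<alpha> (y - b)"
    then obtain i :: int where "y - b + of_int i * \<alpha> \<in> \<int>" by (auto simp: avoids_lattice_def)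
    then obtain k where "y - b + of_int i * \<alpha> = of_int k" by (rule Ints_cases)
    then have "y = (\<lambda>(i::int, k::int). of_int k - of_int i * \<alpha> + b) (i, k)" by simp
    then show "y \<in> N" unfolding N_def by (rule image_eqI) simp
  qed
qed

text \<open>On every vertical line the map is a translation and preserves null sets, and Fubini
  combines the lines. The Borel null set N stands in for P, which is not assumed measurable.\<close>

lemma AE_shear:
  assumes "AE y in lborel. P y"
  shows "AE z in lborel. P (snd z - \<alpha> * fst z :: real)"
proof -
  obtain N where N: "{y \<in> space lborel. \<not> P y} \<subseteq> N" "N \<in> null_sets lborel"
    using assms by (auto elim!: AE_E simp: null_sets_def)
  then have Nb: "N \<in> sets borel" by auto
  have meas: "(\<lambda>z::real \<times> real. snd z - \<alpha> * fst z) \<in> borel_measurable borel"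
    by (intro borel_measurable_continuous_onI continuous_intros)
  have "AE y in lborel. y \<notin> N" using N(2) by (rule AE_not_in)
  then have "AE y in distr lborel borel ((+) (- (\<alpha> * x))). y \<notin> N" for x
    unfolding lborel_distr_plus .
  then have shift: "AE y in lborel. y - \<alpha> * x \<notin> N" for x
    using Nb by (subst (asm) AE_distr_iff) (auto simp: pred_def intro: borel_comp)
  have "AE z in lborel \<Otimes>\<^sub>M lborel. snd z - \<alpha> * fst z \<notin> N"
  proof (rule lborel_pair.AE_pair_measure)
    have "(\<lambda>z::real \<times> real. snd z - \<alpha> * fst z) -` (- N) \<inter> space borel \<in> sets borel"
      by (rule measurable_sets[OF meas]) (use Nb in \<open>auto intro: borel_comp\<close>)
    moreover have "(\<lambda>z::real \<times> real. snd z - \<alpha> * fst z) -` (- N) \<inter> space borel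
      = {z \<in> space (lborel \<Otimes>\<^sub>M lborel). snd z - \<alpha> * fst z \<notin> N}"
      by (auto simp: space_pair_measure)
    ultimately show "{z \<in> space (lborel \<Otimes>\<^sub>M lborel). snd z - \<alpha> * fst z \<notin> N} \<in> sets (lborel \<Otimes>\<^sub>M lborel)"
      by (simp only: lborel_prod sets_lborel)
    show "AE x in lborel. AE y in lborel. snd (x, y) - \<alpha> * fst (x, y) \<notin> N"
      using shift by simp
  qed
  then have "AE z in lborel. snd z - \<alpha> * fst z \<notin> N" by (simp only: lborel_prod)
  then show ?thesis by (rule AE_mp) (use N(1) in auto)
qed

section \<open>A measurable section of the circle\<close>

definition circle_section :: "circle \<Rightarrow> real" where
  "circle_section c = frac (rep_circle c)"

lemma to_circle_circle_section: "to_circle (circle_section c) = c"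
proof -
  have "to_circle (circle_section c) = to_circle (rep_circle c)"
    by (simp add: to_circle_eq_iff circle_section_def frac_def)
  then show ?thesis by (simp add: Quotient3_abs_rep[OF Quotient3_circle])
qed

lemma circle_section_range: "0 \<le> circle_section c" "circle_section c < 1"
  by (simp_all add: circle_section_def frac_lt_1)

lemma circle_section_to_circle:
  assumes "0 \<le> t" "t < 1" shows "circle_section (to_circle t) = t"
proof -
  have "circle_section (to_circle t) - t \<in> \<int>"
    using to_circle_circle_section[of "to_circle t"] by (simp only: to_circle_eq_iff)
  then obtain k where k: "circle_section (to_circle t) - t = of_int k" by (rule Ints_cases)
  then have "\<bar>real_of_int k\<bar> < 1" using circle_section_range[of "to_circle t"] assms by linarith
  then have "k = 0" by linarith
  then show ?thesis using k by simp
qed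

lemma open_to_circle_image:
  assumes "open S" shows "open (to_circle ` S)"
proof -
  have "to_circle -` to_circle ` S = (\<Union>k::int. (\<lambda>x. of_int k + x) ` S)"
  proof (intro equalityI subsetI)
    fix x assume "x \<in> to_circle -` to_circle ` S"
    then obtain s where s: "s \<in> S" "to_circle x = to_circle s" by blast
    from s(2) obtain k where "x - s = of_int k" unfolding to_circle_eq_iff by (rule Ints_cases)
    then have "x = of_int k + s" by simp
    then show "x \<in> (\<Union>k::int. (\<lambda>x. of_int k + x) ` S)" using s(1) by blast
  next
    fix x assume "x \<in> (\<Union>k::int. (\<lambda>x. of_int k + x) ` S)"
    then obtain k :: int and s where s: "s \<in> S" "x = of_int k + s" by blast
    then have "to_circle x = to_circle s" by (simp add: to_circle_eq_iff)
    then show "x \<in> to_circle -` to_circle ` S" using s(1) by blast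
  qed
  moreover have "open (\<Union>k::int. (\<lambda>x. of_int k + x) ` S)"
    by (intro open_UN ballI open_translation assms)
  ultimately show ?thesis by (simp add: open_circle_def)
qed

text \<open>The section jumps at the class of 0. A sublevel set between 0 and 1 is therefore an open
  arc together with this class, which is the complement of an open arc.\<close>

lemma borel_measurable_circle_section: "circle_section \<in> borel_measurable borel"
proof (rule borel_measurableI_less)
  fix a :: real
  have "{c. circle_section c < a} \<in> sets borel"
  proof (cases "a \<le> 0 \<or> 1 \<le> a")
    case True
    then show ?thesis
    proof
      assume "a \<le> 0"
      then have "{c. circle_section c < a} = {}"
        using circle_section_range(1) by (auto simp: not_less intro: order_trans)
      then show ?thesis by simp
    next
      assume "1 \<le> a"
      then have "{c. circle_section c < a} = UNIV"
        using circle_section_range(2) by (auto intro: less_le_trans)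
      then show ?thesis by simp
    qed
  next
    case False
    have "{c. circle_section c < a} = to_circle ` {0<..<a} \<union> - to_circle ` {0<..<1}"
    proof (intro equalityI subsetI)
      fix c assume c: "c \<in> {c. circle_section c < a}"
      show "c \<in> to_circle ` {0<..<a} \<union> - to_circle ` {0<..<1}"
      proof (cases "circle_section c = 0")
        case True
        have "c \<notin> to_circle ` {0<..<1}"
        proof
          assume "c \<in> to_circle ` {0<..<1}"
          then obtain t where t: "0 < t" "t < 1" "c = to_circle t" by auto
          then show False using circle_section_to_circle[of t] True by simp
        qed
        then show ?thesis by simp
      next
        case False
        then have "circle_section c \<in> {0<..<a}" using c circle_section_range(1)[of c] by simp
        then have "to_circle (circle_section c) \<in> to_circle ` {0<..<a}" by (rule imageI)
        then show ?thesis by (simp add: to_circle_circle_section)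
      qed
    next
      fix c assume "c \<in> to_circle ` {0<..<a} \<union> - to_circle ` {0<..<1}"
      then consider t where "0 < t" "t < a" "c = to_circle t" | "c \<notin> to_circle ` {0<..<1}" by auto
      then show "c \<in> {c. circle_section c < a}"
      proof cases
        case (1 t)
        then show ?thesis using circle_section_to_circle[of t] False by simp
      next
        case 2
        have "circle_section c = 0"
        proof (rule ccontr)
          assume "circle_section c \<noteq> 0"
          then have "circle_section c \<in> {0<..<1}" using circle_section_range[of c] by simp
          then have "to_circle (circle_section c) \<in> to_circle ` {0<..<1}" by (rule imageI)
          then show False using 2 by (simp add: to_circle_circle_section)
        qed
        then show ?thesis using False by simp
      qed
    qed
    moreover have "to_circle ` {0<..<a} \<in> sets borel" "- to_circle ` {0<..<1} \<in> sets borel"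
      by (intro borel_comp borel_open open_to_circle_image open_greaterThanLessThan)+
    ultimately show ?thesis by (simp only: sets.Un)
  qed
  then show "{c \<in> space borel. circle_section c < a} \<in> sets borel" by simp
qed

text \<open>The existential statement is not known to define a measurable set, so the transfer is
  carried out for the preimage of a Borel null set under the measurable section g.\<close>

lemma AE_torus_lebesgueI:
  assumes "AE z in lborel. Q z"
  shows "AE x in torus_lebesgue. \<exists>z\<in>{0..<1} \<times> {0..<1}. to_torus z = x \<and> Q z"
proof -
  obtain N where N: "{z \<in> space lborel. \<not> Q z} \<subseteq> N" "N \<in> null_sets lborel"
    using assms by (auto elim!: AE_E simp: null_sets_def)
  then have Nb: "N \<in> sets borel" by auto
  define g where "g = (\<lambda>x::torus. (circle_section (fst x), circle_section (snd x)))"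
  have "fst \<in> borel \<rightarrow>\<^sub>M (borel :: circle measure)" "snd \<in> borel \<rightarrow>\<^sub>M (borel :: circle measure)"
    by (intro borel_measurable_continuous_onI continuous_intros)+
  from measurable_compose[OF this(1) borel_measurable_circle_section]
    measurable_compose[OF this(2) borel_measurable_circle_section]
  have g: "g \<in> borel \<rightarrow>\<^sub>M borel" unfolding g_def by (rule borel_measurable_Pair)
  have "g -` (- N) \<inter> space borel \<in> sets borel"
    by (rule measurable_sets[OF g]) (use Nb in \<open>rule borel_comp\<close>)
  then have gN: "{x \<in> space borel. g x \<notin> N} \<in> sets borel" by (simp add: vimage_def)
  have sq: "({0..<1} \<times> {0..<1} :: (real \<times> real) set) \<in> sets lborel"
    by (simp add: borel_Times)
  have m: "to_torus \<in> restrict_space lborel ({0..<1} \<times> {0..<1}) \<rightarrow>\<^sub>M borel"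
    using borel_measurable_continuous_onI [OF continuous_on_to_torus]
    by (intro measurable_restrict_space1) simp
  have g_to_torus: "g (to_torus z) = z" if "z \<in> {0..<1} \<times> {0..<1}" for z
    using that by (auto simp: g_def to_torus_def circle_section_to_circle)
  have "AE z in lborel. z \<notin> N" using N(2) by (rule AE_not_in)
  then have "AE z in lborel. z \<in> {0..<1} \<times> {0..<1} \<longrightarrow> g (to_torus z) \<notin> N"
    by (rule AE_mp) (use g_to_torus in auto)
  then have "AE z in restrict_space lborel ({0..<1} \<times> {0..<1}). g (to_torus z) \<notin> N"
    using sq by (subst AE_restrict_space_iff) auto
  then have "AE x in torus_lebesgue. g x \<notin> N"
    unfolding torus_lebesgue_def by (subst AE_distr_iff[OF m gN])
  then show ?thesis
  proof (rule AE_mp, intro AE_I2 impI)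
    fix x assume "g x \<notin> N"
    then have "Q (g x)" using N(1) by auto
    moreover have "g x \<in> {0..<1} \<times> {0..<1}" "to_torus (g x) = x"
      by (simp_all add: g_def circle_section_range to_torus_def to_circle_circle_section)
    ultimately show "\<exists>z\<in>{0..<1} \<times> {0..<1}. to_torus z = x \<and> Q z"
      by (intro bexI[of _ "g x"] conjI)
  qed
qed

section \<open>The generic set of second stopping points\<close>

definition good_denominator :: "real \<Rightarrow> real \<Rightarrow> nat \<Rightarrow> nat \<Rightarrow> int \<Rightarrow> bool" where
  "good_denominator \<alpha> e N q a \<longleftrightarrow> coprime a (int q) \<and> 0 < \<bar>real q * \<alpha> - of_int a\<bar> \<and>
     \<bar>real q * \<alpha> - of_int a\<bar> * real q ^ nat \<lceil>48 / e\<^sup>2 + 2\<rceil> \<le> 1 \<and> 3 \<le> q \<and> 8 / e \<le> real q \<and> N \<le> q"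

text \<open>For \<open>s = 1\<close> the orbit of most points passes the first stopping point before it comes near the
  second one, for \<open>s = -1\<close> it is the other way round.\<close>

definition swamping_set :: "real \<Rightarrow> real \<Rightarrow> real \<Rightarrow> nat \<Rightarrow> real set" where
  "swamping_set \<alpha> s e N = {b. \<exists>q a. good_denominator \<alpha> e N q a \<and>
     (\<exists>k::int. 2 * e < s * sgn (real q * \<alpha> - of_int a) * (real q * b) - of_int k \<and>
               s * sgn (real q * \<alpha> - of_int a) * (real q * b) - of_int k < 3 * e)}"

lemma ex_good_denominator:
  assumes "liouville_approximable \<alpha>"
  shows "\<exists>q a. good_denominator \<alpha> e N q a \<and> M \<le> q"
proof -
  obtain q a where q: "q \<ge> N + M + 3 + nat \<lceil>8 / e\<rceil>" "coprime a (int q)" "0 < \<bar>real q * \<alpha> - of_int a\<bar>"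
    "\<bar>real q * \<alpha> - of_int a\<bar> * real q ^ nat \<lceil>48 / e\<^sup>2 + 2\<rceil> \<le> 1"
    using assms unfolding liouville_approximable_def by meson
  have "8 / e \<le> real (nat \<lceil>8 / e\<rceil>)" by (rule real_nat_ceiling_ge)
  also have "\<dots> \<le> real q" using q(1) by (simp only: of_nat_le_iff)
  finally show ?thesis using q unfolding good_denominator_def by (intro exI[of _ q] exI[of _ a]) auto
qed

text \<open>A negative drift is reduced to a positive one by the reflection that changes the signs
  of y, \<open>\<alpha>\<close>, \<open>\<beta>\<close> and a, under which \<open>nid\<close> is
  invariant.\<close>

lemma liouville_ratio_signed:
  assumes good: "good_denominator \<alpha> e N q a" and e: "0 < e" "e \<le> 1/8"
    and y: "4 * e < nid (real q * y)" and av: "avoids_lattice \<alpha> y"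
    and k: "2 * e < sgn (real q * \<alpha> - of_int a) * (real q * \<beta>) - of_int k"
      "sgn (real q * \<alpha> - of_int a) * (real q * \<beta>) - of_int k < 3 * e"
  shows "\<exists>n\<ge>q. (\<Sum>i<n. 1 / nid (y - \<beta> + real i * \<alpha>)) \<le> e * (\<Sum>i\<in>{1..<n}. 1 / nid (y + real i * \<alpha>))"
proof -
  let ?\<theta> = "real q * \<alpha> - of_int a"
  have g: "coprime a (int q)" "0 < \<bar>?\<theta>\<bar>" "\<bar>?\<theta>\<bar> * real q ^ nat \<lceil>48 / e\<^sup>2 + 2\<rceil> \<le> 1" "3 \<le> q" "8 / e \<le> real q"
    using good by (auto simp: good_denominator_def)
  have K: "48 / e\<^sup>2 + 2 \<le> real (nat \<lceil>48 / e\<^sup>2 + 2\<rceil>)" by linarith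
  show ?thesis
  proof (cases "?\<theta> > 0")
    case True
    then have "sgn ?\<theta> = 1" "\<bar>?\<theta>\<bar> = ?\<theta>" by simp_all
    then show ?thesis
      using g e y k K True avoids_lattice_nat[OF av]
      by (intro liouville_ratio[where k = k and K = "nat \<lceil>48 / e\<^sup>2 + 2\<rceil>" and a = a]) simp_all
  next
    case False
    then have neg: "sgn ?\<theta> = -1" "\<bar>?\<theta>\<bar> = - ?\<theta>" "?\<theta> < 0" using g(2) by (simp_all add: sgn_if)
    have \<theta>': "real q * (- \<alpha>) - of_int (- a) = - ?\<theta>" by simp
    have "\<exists>n\<ge>q. (\<Sum>i<n. 1 / nid (- y - (- \<beta>) + real i * (- \<alpha>)))
        \<le> e * (\<Sum>i\<in>{1..<n}. 1 / nid (- y + real i * (- \<alpha>)))"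
    proof (rule liouville_ratio[where k = k and K = "nat \<lceil>48 / e\<^sup>2 + 2\<rceil>" and a = "- a"])
      show "coprime (- a) (int q)" using g(1) by simp
      show "0 < real q * (- \<alpha>) - of_int (- a)" unfolding \<theta>' using neg by simp
      show "(real q * (- \<alpha>) - of_int (- a)) * real q ^ nat \<lceil>48 / e\<^sup>2 + 2\<rceil> \<le> 1"
        unfolding \<theta>' using g(3) neg(2) by simp
      show "4 * e < nid (real q * (- y))" using y by simp
      show "2 * e < real q * (- \<beta>) - of_int k" "real q * (- \<beta>) - of_int k < 3 * e"
        using k unfolding neg(1) by simp_all
      show "- y + real i * (- \<alpha>) \<notin> \<int>" for i
      proof
        assume "- y + real i * (- \<alpha>) \<in> \<int>"
        then have "- (- y + real i * (- \<alpha>)) \<in> \<int>" by (rule Ints_minus)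
        then show False using avoids_lattice_nat[OF av, of i] by (simp add: add.commute)
      qed
    qed (use g K e in simp_all)
    moreover have "nid (- y - (- \<beta>) + real i * (- \<alpha>)) = nid (y - \<beta> + real i * \<alpha>)" for i
      using nid_minus[of "y - \<beta> + real i * \<alpha>"] by (simp add: algebra_simps del: nid_minus)
    moreover have "nid (- y + real i * (- \<alpha>)) = nid (y + real i * \<alpha>)" for i
      using nid_minus[of "y + real i * \<alpha>"] by (simp add: algebra_simps del: nid_minus)
    ultimately show ?thesis by simp
  qed
qed

lemma open_swamping_set: "open (swamping_set \<alpha> s e N)"
proof -
  have "swamping_set \<alpha> s e N = (\<Union>(q, a, k)\<in>{(q, a, k::int). good_denominator \<alpha> e N q a}.
     {b. 2 * e < s * sgn (real q * \<alpha> - of_int a) * (real q * b) - of_int k} \<inter>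
     {b. s * sgn (real q * \<alpha> - of_int a) * (real q * b) - of_int k < 3 * e})"
    unfolding swamping_set_def by auto
  moreover have "open ({b. 2 * e < c * (d * b) - k} \<inter> {b. c * (d * b) - k < 3 * e})" for c d k :: real
    by (intro open_Int open_Collect_less continuous_intros)
  ultimately show ?thesis by (auto intro!: open_UN)
qed

text \<open>For a fixed denominator the windows repeat with period \<open>1 / q\<close>, so one of
  them meets every interval of larger length; q can be taken arbitrarily large.\<close>

lemma swamping_set_dense:
  assumes "liouville_approximable \<alpha>" "s = 1 \<or> s = -1" "0 < e" "e \<le> 1/8"
  shows "closure (swamping_set \<alpha> s e N) = UNIV"
proof -
  have "\<exists>b\<in>swamping_set \<alpha> s e N. dist b x < r" if r: "0 < r" for x r
  proof -
    obtain q a where q: "good_denominator \<alpha> e N q a" "nat \<lceil>1 / r\<rceil> + 1 \<le> q"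
      using ex_good_denominator[OF assms(1)] by blast
    have q0: "real q > 0" using q(2) by simp
    have qr: "1 / real q < r"
    proof -
      have "1 / r < real q" using q(2) by linarith
      then show ?thesis using r q0 by (simp add: field_simps)
    qed
    define \<sigma> where "\<sigma> = s * sgn (real q * \<alpha> - of_int a)"
    have "real q * \<alpha> - of_int a \<noteq> 0" using q(1) by (auto simp: good_denominator_def)
    then have \<sigma>: "\<sigma> * \<sigma> = 1" "\<bar>\<sigma>\<bar> = 1" using assms(2) by (auto simp: \<sigma>_def sgn_if)
    define k where "k = \<lfloor>\<sigma> * (real q * x)\<rfloor>"
    \<comment> \<open>The value \<open>5 / 2 * e\<close> is the middle of the window, and
      \<open>\<sigma>\<close>, being 1 or -1, is its own inverse.\<close>
    define b where "b = \<sigma> * (of_int k + 5 / 2 * e) / real q"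
    have "\<sigma> * (real q * b) = (\<sigma> * \<sigma>) * (of_int k + 5 / 2 * e)" using q0 by (simp add: b_def)
    then have b: "\<sigma> * (real q * b) - of_int k = 5 / 2 * e" by (simp add: \<sigma>)
    then have "b \<in> swamping_set \<alpha> s e N"
      unfolding swamping_set_def using q(1) assms(3)
      by (intro CollectI exI[of _ q] exI[of _ a] exI[of _ k] conjI) (simp_all flip: \<sigma>_def)
    moreover have "dist b x < r"
    proof -
      have "real q * \<bar>b - x\<bar> = \<bar>\<sigma>\<bar> * (real q * \<bar>b - x\<bar>)" by (simp add: \<sigma>)
      also have "\<dots> = \<bar>\<sigma> * (real q * b) - \<sigma> * (real q * x)\<bar>"
        using q0 by (simp add: abs_mult flip: right_diff_distrib)
      also have "\<dots> \<le> 1" using b assms(3,4) unfolding k_def by linarith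
      finally have "\<bar>b - x\<bar> \<le> 1 / real q" using q0 by (simp add: field_simps)
      then show ?thesis using qr by (simp add: dist_real_def)
    qed
    ultimately show ?thesis by blast
  qed
  then have "x \<in> closure (swamping_set \<alpha> s e N)" for x by (simp add: closure_approachable)
  then show ?thesis by blast
qed

text \<open>An integer translation of b changes \<open>q * b\<close> by an integer, which is
  absorbed into k; thus the condition depends only on the point of the circle.\<close>

lemma swamping_set_periodic:
  assumes "b \<in> swamping_set \<alpha> s e N" "to_circle b = to_circle b'" "s = 1 \<or> s = -1"
  shows "b' \<in> swamping_set \<alpha> s e N"
proof -
  obtain q a k where qa: "good_denominator \<alpha> e N q a"
    and k: "2 * e < s * sgn (real q * \<alpha> - of_int a) * (real q * b) - of_int k"
      "s * sgn (real q * \<alpha> - of_int a) * (real q * b) - of_int k < 3 * e"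
    using assms(1) unfolding swamping_set_def by blast
  define \<sigma> where "\<sigma> = s * sgn (real q * \<alpha> - of_int a)"
  have "real q * \<alpha> - of_int a \<noteq> 0" using qa by (auto simp: good_denominator_def)
  then have "\<sigma> = of_int 1 \<or> \<sigma> = of_int (-1)" using assms(3) by (auto simp: \<sigma>_def sgn_if)
  then obtain t :: int where t: "\<sigma> = of_int t" by blast
  obtain m where m: "b - b' = of_int m" using assms(2) unfolding to_circle_eq_iff by (rule Ints_cases)
  then have b: "b = b' + of_int m" by simp
  have "\<sigma> * (real q * b) - of_int k = \<sigma> * (real q * b') - of_int (k - t * int q * m)"
    unfolding b by (simp add: t algebra_simps)
  then show ?thesis
    unfolding swamping_set_def using qa k unfolding \<sigma>_def[symmetric]
    by (intro CollectI exI[of _ q] exI[of _ a] exI[of _ "k - t * int q * m"] conjI) (simp_all flip: \<sigma>_def)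
qed

text \<open>Baire's theorem is used on the line, a complete metric space, and density is carried
  over to the circle. Membership in all \<open>F j\<close> first gives a representative that depends
  on j; by periodicity the value of the section works for every j.\<close>

lemma ex_dense_gdelta_swamping:
  assumes "liouville_approximable \<alpha>" and e: "\<And>j. 0 < e j" "\<And>j. e j \<le> 1/8"
  shows "\<exists>B :: circle set. gdelta B \<and> closure B = UNIV \<and>
    (\<forall>\<beta>\<in>B. \<exists>b. \<beta> = to_circle b \<and> (\<forall>j::nat. b \<in> swamping_set \<alpha> 1 (e j) j \<and> b \<in> swamping_set \<alpha> (-1) (e j) j))"
proof -
  define V where "V = (\<lambda>(s, j). swamping_set \<alpha> s (e j) j)"
  define I :: "(real \<times> nat) set" where "I = {1, -1} \<times> UNIV"
  define F where "F = (\<lambda>j. to_circle ` (V (1, j) \<inter> V (-1, j)))"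
  define B where "B = (\<Inter>j. F j)"
  have "gdelta (\<Inter>(F ` UNIV))"
    by (rule gdelta.intros) (simp add: F_def V_def open_to_circle_image open_Int open_swamping_set)
  then have "gdelta B" by (simp add: B_def)
  moreover have rep: "\<exists>b. \<beta> = to_circle b \<and> (\<forall>j. b \<in> V (1, j) \<and> b \<in> V (-1, j))" if "\<beta> \<in> B" for \<beta>
  proof (intro exI conjI allI)
    show \<beta>: "\<beta> = to_circle (circle_section \<beta>)" by (simp add: to_circle_circle_section)
    fix j
    have "\<beta> \<in> F j" using that by (simp add: B_def)
    then obtain w where w: "w \<in> V (1, j)" "w \<in> V (-1, j)" "\<beta> = to_circle w" by (auto simp: F_def)
    have "to_circle w = to_circle (circle_section \<beta>)" using \<beta> w(3) by simp
    then show "circle_section \<beta> \<in> V (1, j)" "circle_section \<beta> \<in> V (-1, j)"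
      using w swamping_set_periodic unfolding V_def prod.case by blast+
  qed
  moreover have "closure B = UNIV"
  proof (rule ccontr)
    assume "closure B \<noteq> UNIV"
    define U where "U = to_circle -` (- closure B)"
    have "open U" unfolding U_def using continuous_on_to_circle
      by (simp add: continuous_on_open_vimage open_Compl)
    have "UNIV \<subseteq> closure (\<Inter>(V ` I))"
    proof (rule Baire)
      show "countable (V ` I)" unfolding I_def by (intro countable_image countable_SIGMA) simp_all
      fix T assume "T \<in> V ` I"
      then obtain s j where "s = 1 \<or> s = -1" "T = swamping_set \<alpha> s (e j) j" by (auto simp: V_def I_def)
      then show "openin (top_of_set UNIV) T \<and> UNIV \<subseteq> closure T"
        using open_swamping_set swamping_set_dense[OF assms(1) _ e] by simp
    qed simp
    moreover obtain x where "x \<in> U"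
    proof -
      obtain \<beta> where "\<beta> \<notin> closure B" using \<open>closure B \<noteq> UNIV\<close> by blast
      then have "circle_section \<beta> \<in> U" by (simp add: U_def to_circle_circle_section)
      then show ?thesis by (rule that)
    qed
    ultimately have "U \<inter> closure (\<Inter>(V ` I)) \<noteq> {}" by blast
    then have "U \<inter> \<Inter>(V ` I) \<noteq> {}" using open_Int_closure_eq_empty[OF \<open>open U\<close>] by blast
    then obtain b where b: "b \<in> U" "b \<in> \<Inter>(V ` I)" by blast
    have "to_circle b \<in> F j" for j
      unfolding F_def using b(2) by (intro imageI) (auto simp: I_def)
    then have "to_circle b \<in> B" by (simp add: B_def)
    then have "to_circle b \<in> closure B" using closure_subset by blast
    then show False using b(1) by (simp add: U_def)
  qed
  ultimately show ?thesis unfolding V_def prod.case by blast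
qed

text \<open>The sum for y1 starts at crossing 1 to match the lower bound for the passage integrals,
  which discards crossing 0.\<close>

definition swamps :: "real \<Rightarrow> real \<Rightarrow> real \<Rightarrow> bool" where
  "swamps \<alpha> y1 y2 \<longleftrightarrow> (\<forall>e>0. \<forall>N. \<exists>n\<ge>N.
     (\<Sum>i<n. 1 / nid (y2 + real i * \<alpha>)) \<le> e * (\<Sum>i\<in>{1..<n}. 1 / nid (y1 + real i * \<alpha>)))"

text \<open>On a bounded interval the heights excluded by the j-th denominator have measure of order
  \<open>e j\<close>, so almost every height is excluded only finitely often. The shift c serves
  both orders of the stopping points: with \<open>c = b\<close> and \<open>- b\<close> in place of
  \<open>\<beta>\<close>, the heights compared are \<open>y - b\<close> and y.\<close>

lemma AE_swamps:
  assumes sw: "\<And>j::nat. \<beta> \<in> swamping_set \<alpha> 1 (e j) j"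
    and e: "\<And>j. 0 < e j" "\<And>j. e j \<le> 1/8" "summable e"
  shows "AE y in lborel. swamps \<alpha> (y - c) (y - c - \<beta>)"
proof -
  have "\<exists>q a. good_denominator \<alpha> (e j) j q a \<and>
     (\<exists>k::int. 2 * e j < sgn (real q * \<alpha> - of_int a) * (real q * \<beta>) - of_int k \<and>
               sgn (real q * \<alpha> - of_int a) * (real q * \<beta>) - of_int k < 3 * e j)" for j
    using sw[of j] unfolding swamping_set_def by simp
  then obtain q a k where good: "\<And>j. good_denominator \<alpha> (e j) j (q j) (a j)"
    and k: "\<And>j. 2 * e j < sgn (real (q j) * \<alpha> - of_int (a j)) * (real (q j) * \<beta>) - of_int (k j :: int)"
      "\<And>j. sgn (real (q j) * \<alpha> - of_int (a j)) * (real (q j) * \<beta>) - of_int (k j) < 3 * e j"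
    by metis
  have "AE y in lborel. eventually (\<lambda>j. 4 * e j < nid (real (q j) * y + - (real (q j) * c))) sequentially"
  proof (rule AE_eventually_nid_gt)
    show "1 \<le> q j" for j using good[of j] by (simp add: good_denominator_def)
    show "0 \<le> 4 * e j" for j using e(1)[of j] by simp
    show "summable (\<lambda>j. 4 * e j)" using e(3) by (rule summable_mult)
  qed
  with AE_avoids_lattice[of \<alpha> c] show ?thesis
  proof eventually_elim
    case (elim y)
    show ?case unfolding swamps_def
    proof (intro allI impI)
      fix \<delta> :: real and N :: nat assume \<delta>: "0 < \<delta>"
      have "eventually (\<lambda>j. e j < \<delta>) sequentially"
        using summable_LIMSEQ_zero[OF e(3)] \<delta> by (rule order_tendstoD(2))
      with elim(2) eventually_ge_at_top[of N]
      have "eventually (\<lambda>j. e j < \<delta> \<and> N \<le> j \<and> 4 * e j < nid (real (q j) * y + - (real (q j) * c))) sequentially"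
        by eventually_elim simp
      then obtain j where j: "e j < \<delta>" "N \<le> j" "4 * e j < nid (real (q j) * y + - (real (q j) * c))"
        by (auto dest: eventually_happens)
      have "4 * e j < nid (real (q j) * (y - c))" using j(3) by (simp add: right_diff_distrib)
      from liouville_ratio_signed[OF good e(1,2) this elim(1) k]
      obtain n where n: "n \<ge> q j" "(\<Sum>i<n. 1 / nid (y - c - \<beta> + real i * \<alpha>))
          \<le> e j * (\<Sum>i\<in>{1..<n}. 1 / nid (y - c + real i * \<alpha>))" by blast
      note n(2)
      also have "e j * (\<Sum>i\<in>{1..<n}. 1 / nid (y - c + real i * \<alpha>)) \<le> \<delta> * (\<Sum>i\<in>{1..<n}. 1 / nid (y - c + real i * \<alpha>))"
        using j(1) by (intro mult_right_mono sum_nonneg) auto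
      finally have "(\<Sum>i<n. 1 / nid (y - c - \<beta> + real i * \<alpha>)) \<le> \<delta> * (\<Sum>i\<in>{1..<n}. 1 / nid (y - c + real i * \<alpha>))" .
      moreover have "j \<le> q j" using good[of j] by (simp add: good_denominator_def)
      ultimately show "\<exists>n\<ge>N. (\<Sum>i<n. 1 / nid (y - c - \<beta> + real i * \<alpha>))
          \<le> \<delta> * (\<Sum>i\<in>{1..<n}. 1 / nid (y - c + real i * \<alpha>))"
        using n(1) j(2) by (intro exI[of _ n]) auto
    qed
  qed
qed

lemma swamping_set_minus: "b \<in> swamping_set \<alpha> (-1) e N \<Longrightarrow> - b \<in> swamping_set \<alpha> 1 e N"
  unfolding swamping_set_def by simp

section \<open>Conclusion\<close>

text \<open>At the two zeros the Hessian provides the comparison, elsewhere all functions involved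
  are positive and continuous; periodicity and compactness make the constant uniform.\<close>

lemma speed_bounds:
  fixes \<phi> :: "torus \<Rightarrow> real" and b :: real
  defines "p \<equiv> (to_circle 0, to_circle 0)" and "q \<equiv> (to_circle 0, to_circle b)"
    and "F \<equiv> \<lambda>z. \<phi> (to_torus z)"
  assumes C3: "torus_C_k 3 \<phi>" and pq: "p \<noteq> q" "\<phi> p = 0" "\<phi> q = 0"
    and pos: "\<And>x. x \<noteq> p \<Longrightarrow> x \<noteq> q \<Longrightarrow> 0 < \<phi> x"
    and hess: "torus_hessian_pos_def \<phi> p" "torus_hessian_pos_def \<phi> q"
  shows "\<exists>C>0. \<forall>z. lattice_sq_dist 0 z * lattice_sq_dist b z \<le> C * F z \<and>
    F z \<le> C * lattice_sq_dist 0 z \<and> F z \<le> C * lattice_sq_dist b z"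
proof -
  define P where "P = (\<lambda>C z. lattice_sq_dist 0 z * lattice_sq_dist b z \<le> C * F z \<and>
    F z \<le> C * lattice_sq_dist 0 z \<and> F z \<le> C * lattice_sq_dist b z)"
  have F3: "C_k 3 F" using C3 by (simp add: torus_C_k_def F_def)
  have F0: "0 \<le> F z" for z
    using pos[of "to_torus z"] pq by (cases "to_torus z = p \<or> to_torus z = q") (auto simp: F_def)
  have mono: "P C' z" if "C \<le> C'" "P C z" for C C' z
  proof -
    have "C * F z \<le> C' * F z" "C * lattice_sq_dist 0 z \<le> C' * lattice_sq_dist 0 z"
      "C * lattice_sq_dist b z \<le> C' * lattice_sq_dist b z"
      using that(1) F0 by (intro mult_right_mono; simp)+
    then show ?thesis using that(2) unfolding P_def by linarith
  qed
  have zero0: "lattice_sq_dist 0 z = 0 \<longleftrightarrow> to_torus z = p" for z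
    by (simp add: lattice_sq_dist_zero_iff p_def)
  have zerob: "lattice_sq_dist b z = 0 \<longleftrightarrow> to_torus z = q" for z
    by (simp add: lattice_sq_dist_zero_iff q_def)
  have loc: "\<exists>C. \<forall>\<^sub>F w in nhds z. P C w" for z
  proof -
    consider "to_torus z = p" | "to_torus z = q" | "to_torus z \<noteq> p" "to_torus z \<noteq> q" by blast
    then show ?thesis
    proof cases
      case 1
      have "\<exists>C\<ge>0. \<forall>\<^sub>F w in nhds z. lattice_sq_dist 0 w * lattice_sq_dist b w \<le> C * F w \<and>
        F w \<le> C * lattice_sq_dist 0 w \<and> F w \<le> C * lattice_sq_dist b w"
      proof (rule speed_bounds_at_zero[OF F3 F0])
        show "F z = 0" using 1 pq by (simp add: F_def)
        show "0 < hessian F z v v" if "v \<noteq> 0" for v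
          using hess(1) 1 that unfolding torus_hessian_pos_def_def F_def by blast
        show "lattice_sq_dist 0 z = 0" using 1 zero0 by simp
        show "0 < lattice_sq_dist b z" using 1 zerob[of z] pq(1) by (simp add: less_le)
      qed
      then show ?thesis unfolding P_def by blast
    next
      case 2
      have "\<exists>C\<ge>0. \<forall>\<^sub>F w in nhds z. lattice_sq_dist b w * lattice_sq_dist 0 w \<le> C * F w \<and>
        F w \<le> C * lattice_sq_dist b w \<and> F w \<le> C * lattice_sq_dist 0 w"
      proof (rule speed_bounds_at_zero[OF F3 F0])
        show "F z = 0" using 2 pq by (simp add: F_def)
        show "0 < hessian F z v v" if "v \<noteq> 0" for v
          using hess(2) 2 that unfolding torus_hessian_pos_def_def F_def by blast
        show "lattice_sq_dist b z = 0" using 2 zerob by simp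
        show "0 < lattice_sq_dist 0 z" using 2 zero0[of z] pq(1) by (simp add: less_le)
      qed
      then obtain C where "\<forall>\<^sub>F w in nhds z. lattice_sq_dist b w * lattice_sq_dist 0 w \<le> C * F w \<and>
        F w \<le> C * lattice_sq_dist b w \<and> F w \<le> C * lattice_sq_dist 0 w" by blast
      then have "\<forall>\<^sub>F w in nhds z. P C w"
        by (rule eventually_mono) (simp add: P_def mult.commute)
      then show ?thesis by blast
    next
      case 3
      have pz: "0 < F z" "0 < lattice_sq_dist 0 z" "0 < lattice_sq_dist b z"
        using 3 pos zero0[of z] zerob[of z] by (simp_all add: F_def less_le)
      have cont: "continuous (at z) F"
        using C_k_3_continuous_hessian(1)[OF F3] by (rule differentiable_imp_continuous_within)
      have contE: "continuous (at z) (lattice_sq_dist c)" for c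
        using continuous_on_lattice_sq_dist[of c] continuous_on_eq_continuous_at[OF open_UNIV] by blast
      \<comment> \<open>The three required ratios as nonnegative summands, so that one bound for the
        sum bounds each of them.\<close>
      define C where "C = (\<lambda>w. lattice_sq_dist 0 w * lattice_sq_dist b w / F w + F w / lattice_sq_dist 0 w
        + F w / lattice_sq_dist b w)"
      have contC: "continuous (at z) C" unfolding C_def
        using pz by (intro continuous_intros cont contE) auto
      note lim = contC[THEN continuous_at_tendsto_nhds] cont[THEN continuous_at_tendsto_nhds]
        contE[of 0, THEN continuous_at_tendsto_nhds] contE[of b, THEN continuous_at_tendsto_nhds]
      have "\<forall>\<^sub>F w in nhds z. P (C z + 1) w"
        using order_tendstoD(2)[OF lim(1) less_add_one] order_tendstoD(1)[OF lim(2) pz(1)]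
          order_tendstoD(1)[OF lim(3) pz(2)] order_tendstoD(1)[OF lim(4) pz(3)]
      proof eventually_elim
        case (elim w)
        let ?a = "lattice_sq_dist 0 w" and ?b = "lattice_sq_dist b w"
        have "0 \<le> ?a * ?b / F w" "0 \<le> F w / ?a" "0 \<le> F w / ?b" using elim by simp_all
        then have "?a * ?b / F w \<le> C z + 1" "F w / ?a \<le> C z + 1" "F w / ?b \<le> C z + 1"
          using elim(1) unfolding C_def by linarith+
        then show ?case using elim unfolding P_def by (simp add: pos_divide_le_eq)
      qed
      then show ?thesis by blast
    qed
  qed
  have "\<exists>C. \<forall>z. P C z"
  proof (rule periodic_uniform_constant[OF mono _ loc])
    show "P C z'" if "to_torus z = to_torus z'" "P C z" for C z z'
      using that lattice_sq_dist_cong[OF that(1)] by (simp add: P_def F_def)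
  qed
  then obtain C where C: "\<forall>z. P C z" by blast
  have "0 < max C 1" by simp
  moreover have "P (max C 1) z" for z using mono[of C "max C 1"] C by simp
  ultimately show ?thesis unfolding P_def by blast
qed

text \<open>Near a zero of \<open>\<phi>\<close> the function g is below e, and away from the zeros
  \<open>\<phi>\<close> is bounded below. Along an orbit \<open>\<phi>\<close> integrates to the
  horizontal displacement, which is sublinear in time, so that the averages of g tend to 0.\<close>

lemma vanishing_bounded_by_speed:
  fixes \<phi> g :: "torus \<Rightarrow> real"
  assumes C3: "torus_C_k 3 \<phi>" and \<phi>0: "\<And>x. 0 \<le> \<phi> x" and zero: "\<And>x. \<phi> x = 0 \<Longrightarrow> g x = 0"
    and g: "continuous_on UNIV g" and e: "0 < e"
  shows "\<exists>C>0. \<forall>x. \<bar>g x\<bar> \<le> e + C * \<phi> x"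
proof -
  define P where "P = (\<lambda>C z. \<bar>g (to_torus z)\<bar> \<le> e + C * \<phi> (to_torus z))"
  have mono: "P C' z" if "C \<le> C'" "P C z" for C C' z
  proof -
    have "C * \<phi> (to_torus z) \<le> C' * \<phi> (to_torus z)" using that(1) \<phi>0 by (intro mult_right_mono)
    then show ?thesis using that(2) unfolding P_def by linarith
  qed
  have contg: "continuous_on UNIV (\<lambda>z. g (to_torus z))"
    by (rule continuous_on_compose2[OF g continuous_on_to_torus]) simp
  have F3: "C_k 3 (\<lambda>z. \<phi> (to_torus z))" using C3 by (simp add: torus_C_k_def)
  have loc: "\<exists>C. \<forall>\<^sub>F w in nhds z. P C w" for z
  proof -
    have g_at: "continuous (at z) (\<lambda>z. g (to_torus z))"
      using contg continuous_on_eq_continuous_at[OF open_UNIV] by blast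
    have \<phi>_at: "continuous (at z) (\<lambda>z. \<phi> (to_torus z))"
      using C_k_3_continuous_hessian(1)[OF F3] by (rule differentiable_imp_continuous_within)
    note lim = continuous_at_tendsto_nhds[OF g_at] continuous_at_tendsto_nhds[OF \<phi>_at]
    show ?thesis
    proof (cases "\<phi> (to_torus z) = 0")
      case True
      have "((\<lambda>z. \<bar>g (to_torus z)\<bar>) \<longlongrightarrow> 0) (nhds z)"
        using tendsto_rabs[OF lim(1)] zero[OF True] by simp
      from order_tendstoD(2)[OF this e]
      have "\<forall>\<^sub>F w in nhds z. P 0 w" by (rule eventually_mono) (simp add: P_def)
      then show ?thesis by blast
    next
      case False
      define f where "f = \<phi> (to_torus z) / 2"
      have f: "0 < f" "f < \<phi> (to_torus z)" using False \<phi>0[of "to_torus z"] by (auto simp: f_def)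
      define M where "M = \<bar>g (to_torus z)\<bar> + 1"
      have gM: "\<bar>g (to_torus z)\<bar> < M" by (simp add: M_def)
      have "\<forall>\<^sub>F w in nhds z. P (M / f) w"
        using order_tendstoD(1)[OF lim(2) f(2)] order_tendstoD(2)[OF tendsto_rabs[OF lim(1)] gM]
      proof eventually_elim
        case (elim w)
        have "M = M / f * f" using f by simp
        also have "\<dots> \<le> M / f * \<phi> (to_torus w)" using elim f by (intro mult_left_mono) (auto simp: M_def)
        finally show ?case using elim e unfolding P_def by linarith
      qed
      then show ?thesis by blast
    qed
  qed
  have "\<exists>C. \<forall>z. P C z"
    by (rule periodic_uniform_constant[OF mono _ loc]) (auto simp: P_def)
  then obtain C where C: "\<forall>z. P C z" by blast
  have "P (max C 1) z" for z using mono[of C "max C 1"] C by simp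
  then have "\<bar>g x\<bar> \<le> e + max C 1 * \<phi> x" for x
    using to_torus_surj[of x] unfolding P_def by metis
  then show ?thesis by (intro exI[of _ "max C 1"]) auto
qed

lemma ex_sum_sq_dist_bound:
  assumes "to_circle b \<noteq> to_circle 0"
  shows "\<exists>m>0. \<forall>z. 1 \<le> m * (lattice_sq_dist 0 z + lattice_sq_dist b z)"
proof -
  define P where "P = (\<lambda>C z. 1 \<le> C * (lattice_sq_dist 0 z + lattice_sq_dist b z))"
  let ?E = "\<lambda>z. lattice_sq_dist 0 z + lattice_sq_dist b z"
  have mono: "P C' z" if "C \<le> C'" "P C z" for C C' z
  proof -
    have "C * ?E z \<le> C' * ?E z" using that(1) by (intro mult_right_mono) simp_all
    then show ?thesis using that(2) unfolding P_def by linarith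
  qed
  have Epos: "0 < ?E z" for z
  proof -
    have "lattice_sq_dist 0 z \<noteq> 0 \<or> lattice_sq_dist b z \<noteq> 0"
      using assms by (auto simp: lattice_sq_dist_zero_iff)
    then show ?thesis
      using lattice_sq_dist_nonneg[of 0 z] lattice_sq_dist_nonneg[of b z] by linarith
  qed
  have loc: "\<exists>C. \<forall>\<^sub>F w in nhds z. P C w" for z
  proof -
    have "continuous_on UNIV ?E" by (intro continuous_intros continuous_on_lattice_sq_dist)
    then have "continuous (at z) ?E"
      using continuous_on_eq_continuous_at[OF open_UNIV] by blast
    then have "(?E \<longlongrightarrow> ?E z) (nhds z)" by (rule continuous_at_tendsto_nhds)
    moreover have "?E z / 2 < ?E z" using Epos[of z] by simp
    ultimately have "\<forall>\<^sub>F w in nhds z. ?E z / 2 < ?E w" by (rule order_tendstoD(1))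
    then have "\<forall>\<^sub>F w in nhds z. P (2 / ?E z) w"
    proof (rule eventually_mono)
      fix w assume "?E z / 2 < ?E w"
      moreover have "1 \<le> 2 / c * d" if "0 < c" "c / 2 < d" for c d :: real
        using that by (simp add: field_simps)
      ultimately show "P (2 / ?E z) w" using Epos[of z] unfolding P_def by blast
    qed
    then show ?thesis by blast
  qed
  have "\<exists>C. \<forall>z. P C z"
  proof (rule periodic_uniform_constant[OF mono _ loc])
    show "P C z'" if "to_torus z = to_torus z'" "P C z" for C z z'
      using that lattice_sq_dist_cong[OF that(1)] by (simp add: P_def)
  qed
  then obtain C where C: "\<forall>z. P C z" by blast
  have "P (max C 1) z" for z using mono[of C "max C 1"] C by simp
  then show ?thesis unfolding P_def by (intro exI[of _ "max C 1"]) auto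
qed

lemma inv_sq_dist_eq: "inv_sq_dist \<alpha> (y - b) s = 1 / lattice_sq_dist b (s, y + s * \<alpha>)"
  by (simp add: inv_sq_dist_def lattice_sq_dist_def algebra_simps)

text \<open>The lifted orbit stays on the line of height y, so its abscissa satisfies an autonomous
  equation with speed G, and the passage estimates apply, also with the stopping points
  exchanged.\<close>

lemma p_omega_of_good_orbit:
  fixes \<alpha> b :: real
  defines "p \<equiv> (to_circle 0, to_circle 0)" and "q \<equiv> (to_circle 0, to_circle b)"
  assumes L: "liouville_approximable \<alpha>" and flow: "reparam_linear_flow \<alpha> p q \<phi> \<Psi>"
    and z: "z \<in> {0..<1} \<times> {0..<1}" and y: "y = snd z - \<alpha> * fst z"
    and av: "avoids_lattice \<alpha> y" "avoids_lattice \<alpha> (y - b)"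
    and sw: "swamps \<alpha> y (y - b)" "swamps \<alpha> (y - b) y"
  shows "p_omega \<Psi> (to_torus z) = dirac_segment p q"
proof -
  let ?x = "to_torus z"
  have C3: "torus_C_k 3 \<phi>" and pq: "p \<noteq> q" "\<phi> p = 0" "\<phi> q = 0"
    and pos: "\<And>x. x \<noteq> p \<Longrightarrow> x \<noteq> q \<Longrightarrow> 0 < \<phi> x"
    and hess: "torus_hessian_pos_def \<phi> p" "torus_hessian_pos_def \<phi> q"
    and gen: "generates_flow (\<lambda>x. \<phi> x *\<^sub>R (1, \<alpha>)) \<Psi>"
    using flow unfolding reparam_linear_flow_def by blast+
  have \<phi>0: "0 \<le> \<phi> x" for x using pos[of x] pq by (cases "x = p \<or> x = q") auto
  obtain C where C: "0 < C" and bounds: "\<And>z. lattice_sq_dist 0 z * lattice_sq_dist b z \<le> C * \<phi> (to_torus z)"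
      "\<And>z. \<phi> (to_torus z) \<le> C * lattice_sq_dist 0 z" "\<And>z. \<phi> (to_torus z) \<le> C * lattice_sq_dist b z"
    using speed_bounds[OF C3 pq[unfolded p_def q_def] pos[unfolded p_def q_def] hess[unfolded p_def q_def]] by blast
  have b0: "to_circle b \<noteq> to_circle 0" using pq(1) by (auto simp: p_def q_def)
  obtain m where m: "0 < m" "\<And>z. 1 \<le> m * (lattice_sq_dist 0 z + lattice_sq_dist b z)"
    using ex_sum_sq_dist_bound[OF b0] by blast
  obtain Z where Z: "Z 0 = z" "\<And>t. (Z has_vector_derivative \<phi> (to_torus (Z t)) *\<^sub>R (1, \<alpha>)) (at t)"
    "\<And>t. \<Psi> t ?x = to_torus (Z t)"
    using gen unfolding generates_flow_def by meson
  define \<tau> where "\<tau> = (\<lambda>t. fst (Z t))"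
  have d1: "(\<tau> has_real_derivative \<phi> (to_torus (Z t))) (at t)" for t
    using bounded_linear.has_vector_derivative[OF bounded_linear_fst Z(2)[of t]]
    by (simp add: \<tau>_def has_real_derivative_iff_has_vector_derivative)
  have d2: "((\<lambda>t. snd (Z t)) has_real_derivative \<phi> (to_torus (Z t)) * \<alpha>) (at t)" for t
    using bounded_linear.has_vector_derivative[OF bounded_linear_snd Z(2)[of t]]
    by (simp add: has_real_derivative_iff_has_vector_derivative)
  have line: "Z t = (\<tau> t, y + \<tau> t * \<alpha>)" for t
  proof -
    have "((\<lambda>t. snd (Z t) - \<tau> t * \<alpha>) has_real_derivative 0) (at t)" for t
      using DERIV_diff[OF d2 DERIV_cmult_right[OF d1, of \<alpha>]] by simp
    then have "snd (Z t) - \<tau> t * \<alpha> = snd (Z 0) - \<tau> 0 * \<alpha>"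
      by (intro DERIV_isconst_all) blast
    also have "\<dots> = y" by (simp add: Z(1) \<tau>_def y mult.commute)
    finally have "snd (Z t) = y + \<tau> t * \<alpha>" by simp
    then show ?thesis by (metis \<tau>_def prod.collapse)
  qed
  define G where "G = (\<lambda>s. \<phi> (to_torus (s, y + s * \<alpha>)))"
  have inv0: "inv_sq_dist \<alpha> y s = 1 / lattice_sq_dist 0 (s, y + s * \<alpha>)" for s
    using inv_sq_dist_eq[of \<alpha> y 0 s] by simp
  note invb = inv_sq_dist_eq[of \<alpha> y b]
  have E0: "0 < lattice_sq_dist 0 (s, y + s * \<alpha>)" for s
    using inv_sq_dist_pos[OF av(1), of s] by (simp add: inv0)
  have Eb: "0 < lattice_sq_dist b (s, y + s * \<alpha>)" for s
    using inv_sq_dist_pos[OF av(2), of s] by (simp add: invb)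
  interpret S: slowed_motion \<alpha> y "y - b" "1 / C" C \<tau> G
  proof
    show "(\<tau> has_real_derivative G (\<tau> t)) (at t)" for t
      using d1[of t] by (simp add: G_def line)
    show "1 / C \<le> G s * inv_sq_dist \<alpha> y s * inv_sq_dist \<alpha> (y - b) s" for s
      using bounds(1)[of "(s, y + s * \<alpha>)"] C E0[of s] Eb[of s] by (simp add: inv0 invb G_def field_simps)
    show "G s * inv_sq_dist \<alpha> y s \<le> C" for s
      using bounds(2)[of "(s, y + s * \<alpha>)"] E0[of s] by (simp add: inv0 G_def field_simps)
    show "G s * inv_sq_dist \<alpha> (y - b) s \<le> C" for s
      using bounds(3)[of "(s, y + s * \<alpha>)"] Eb[of s] by (simp add: invb G_def field_simps)
    show "0 \<le> \<tau> 0" "\<tau> 0 < 1" using z by (auto simp: \<tau>_def Z(1))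
  qed (use av C in auto)
  interpret S': slowed_motion \<alpha> "y - b" y "1 / C" C \<tau> G by (rule S.swapped)
  have orbit: "continuous_on UNIV (\<lambda>s. \<Psi> s ?x)" by (rule generates_flow_continuous_orbit[OF gen])
  note integrable_orbit = integrable_along_orbit[where \<Psi> = \<Psi> and x = ?x, OF orbit]
  note continuous_orbit = continuous_on_along_orbit[where \<Psi> = \<Psi> and x = ?x, OF orbit]
  \<comment> \<open>Equal to 1 at p and 0 at q, and \<open>1 - h\<close> is the same quotient with
    the two points exchanged, so that the two bounds along the orbit have the same form.\<close>
  define h where "h = (\<lambda>x. torus_sq_dist b x / (torus_sq_dist 0 x + torus_sq_dist b x))"
  have Epos: "0 < torus_sq_dist 0 x + torus_sq_dist b x" for x
  proof -
    obtain w where w: "x = to_torus w" using to_torus_surj by blast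
    have "0 < m * (lattice_sq_dist 0 w + lattice_sq_dist b w)" using m(2)[of w] by linarith
    then show ?thesis using m(1) by (simp add: w torus_sq_dist_to_torus zero_less_mult_iff)
  qed
  have cont_h: "continuous_on UNIV h" unfolding h_def
    by (intro continuous_on_divide continuous_on_add continuous_on_torus_sq_dist) (use Epos in \<open>simp add: less_le\<close>)
  have cont_h': "continuous_on UNIV (\<lambda>x. 1 - h x)" by (intro continuous_intros cont_h)
  have h_along: "h (\<Psi> s ?x) \<le> m * C * (G (\<tau> s) * inv_sq_dist \<alpha> y (\<tau> s))"
    "1 - h (\<Psi> s ?x) \<le> m * C * (G (\<tau> s) * inv_sq_dist \<alpha> (y - b) (\<tau> s))" for s
  proof -
    let ?w = "(\<tau> s, y + \<tau> s * \<alpha>)"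
    let ?a = "lattice_sq_dist 0 ?w" and ?b = "lattice_sq_dist b ?w"
    have ab: "0 < ?a" "0 < ?b" by (rule E0, rule Eb)
    have hs: "h (\<Psi> s ?x) = ?b / (?a + ?b)" by (simp add: h_def Z(3) line torus_sq_dist_to_torus)
    have inv: "1 / (?a + ?b) \<le> m" using m(2)[of ?w] ab by (simp add: field_simps)
    have GC: "?a * ?b \<le> C * G (\<tau> s)" using bounds(1)[of ?w] by (simp add: G_def)
    have "?b / (?a + ?b) \<le> m * ?b" using mult_right_mono[OF inv, of ?b] ab by simp
    also have "\<dots> \<le> m * (C * G (\<tau> s) / ?a)" using m(1) GC ab by (intro mult_left_mono) (simp_all add: field_simps)
    finally show "h (\<Psi> s ?x) \<le> m * C * (G (\<tau> s) * inv_sq_dist \<alpha> y (\<tau> s))"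
      by (simp add: hs inv0 mult.assoc)
    have "1 - h (\<Psi> s ?x) = ?a / (?a + ?b)" using ab by (simp add: hs field_simps)
    also have "\<dots> \<le> m * ?a" using mult_right_mono[OF inv, of ?a] ab by simp
    also have "\<dots> \<le> m * (C * G (\<tau> s) / ?b)" using m(1) GC ab by (intro mult_left_mono) (simp_all add: field_simps)
    finally show "1 - h (\<Psi> s ?x) \<le> m * C * (G (\<tau> s) * inv_sq_dist \<alpha> (y - b) (\<tau> s))"
      by (simp add: invb mult.assoc)
  qed
  have mC: "0 < m * C" using m C by simp
  show ?thesis
  proof (rule p_omega_eq_dirac_segment[where \<Psi> = \<Psi> and x = ?x, OF orbit pq(1), where h = h and \<eta> = "\<lambda>x. torus_sq_dist 0 x * torus_sq_dist b x" and K = 1])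
    show "continuous_on UNIV h" by (rule cont_h)
    show "0 \<le> h x" for x using Epos[of x] by (simp add: h_def)
    show "h x \<le> 1" for x using Epos[of x] by (simp add: h_def)
    have "torus_sq_dist 0 p = 0" "torus_sq_dist b q = 0" by (simp_all add: torus_sq_dist_zero_iff p_def q_def)
    then show "h p = 1" "h q = 0" using Epos[of p] by (simp_all add: h_def)
    show "continuous_on UNIV (\<lambda>x. torus_sq_dist 0 x * torus_sq_dist b x)"
      by (intro continuous_on_mult continuous_on_torus_sq_dist)
    show "0 \<le> torus_sq_dist 0 x * torus_sq_dist b x" for x by simp
    show "torus_sq_dist 0 x * torus_sq_dist b x \<le> 1" for x
      using mult_mono[OF torus_sq_dist_le torus_sq_dist_le, of b x 0 x] by simp
    show "torus_sq_dist 0 x * torus_sq_dist b x = 0 \<longleftrightarrow> x = p \<or> x = q" for x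
      by (simp add: torus_sq_dist_zero_iff p_def q_def)
  next
    fix g :: "torus \<Rightarrow> real" assume g: "continuous_on UNIV g" "g p = 0" "g q = 0"
    show "(time_average \<Psi> ?x g \<longlongrightarrow> 0) at_top"
    proof (rule tendstoI)
      fix e :: real assume e: "0 < e"
      have "g x = 0" if "\<phi> x = 0" for x using pos[of x] that g by fastforce
      from vanishing_bounded_by_speed[OF C3 \<phi>0 this g(1), of "e / 2"] e
      obtain D where D: "0 < D" "\<And>x. \<bar>g x\<bar> \<le> e / 2 + D * \<phi> x" by auto
      \<comment> \<open>The fraction \<open>e / (4 * D)\<close> turns the bound for the average into
        \<open>3 / 4 * e\<close>, strictly below e.\<close>
      have "eventually (\<lambda>t. \<tau> t \<le> e / (4 * D) * t) at_top"
        using e D by (intro S.tau_sublinear L) simp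
      then show "eventually (\<lambda>t. dist (time_average \<Psi> ?x g t) 0 < e) at_top"
        using eventually_gt_at_top[of 0]
      proof eventually_elim
        case (elim t)
        have "((\<lambda>s. G (\<tau> s)) has_integral \<tau> t - \<tau> 0) {0..t}"
          using S.deriv elim
          by (intro fundamental_theorem_of_calculus)
            (auto simp: has_real_derivative_iff_has_vector_derivative intro: has_vector_derivative_at_within)
        then have bnd: "((\<lambda>s. e / 2 + D * G (\<tau> s)) has_integral e / 2 * t + D * (\<tau> t - \<tau> 0)) {0..t}"
          using elim has_integral_const_real[of "e / 2" 0 t]
          by (intro has_integral_add has_integral_mult_right) (simp_all add: mult.commute)
        have int: "((\<lambda>s. g (\<Psi> s ?x)) has_integral integral {0..t} (\<lambda>s. g (\<Psi> s ?x))) {0..t}"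
          by (rule integrable_integral[OF integrable_orbit[OF g(1)]])
        have le: "g (\<Psi> s ?x) \<le> e / 2 + D * G (\<tau> s)" "- g (\<Psi> s ?x) \<le> e / 2 + D * G (\<tau> s)" for s
          using D(2)[of "\<Psi> s ?x"] by (simp_all add: Z(3) line G_def abs_le_iff)
        have "\<bar>integral {0..t} (\<lambda>s. g (\<Psi> s ?x))\<bar> \<le> e / 2 * t + D * (\<tau> t - \<tau> 0)"
          using has_integral_le[OF int bnd le(1)] has_integral_le[OF has_integral_neg[OF int] bnd le(2)]
          by linarith
        also have "\<dots> \<le> e / 2 * t + D * (e / (4 * D) * t)"
          using elim S.start D by (intro add_left_mono mult_left_mono) auto
        also have "\<dots> = 3 / 4 * e * t" using D by (simp add: field_simps)
        also have "\<dots> < e * t" using e elim by simp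
        finally have "\<bar>integral {0..t} (\<lambda>s. g (\<Psi> s ?x))\<bar> < e * t" .
        then show ?case using elim by (simp add: time_average_def abs_mult field_simps)
      qed
    qed
  next
    fix e T :: real assume e: "0 < e"
    obtain t where t: "t \<ge> T" "0 < t" "integral {0..t} (\<lambda>s. 1 - h (\<Psi> s ?x)) \<le> e * t"
      using S.small_average[OF _ continuous_orbit[OF cont_h'] h_along(2) mC e, of T] sw(1)
      unfolding swamps_def by blast
    have "integral {0..t} (\<lambda>s. 1 - h (\<Psi> s ?x)) = t - integral {0..t} (\<lambda>s. h (\<Psi> s ?x))"
      using t(2) by (subst Henstock_Kurzweil_Integration.integral_diff)
        (auto intro: integrable_orbit[OF cont_h])
    then have "(1 - e) * t \<le> integral {0..t} (\<lambda>s. h (\<Psi> s ?x))" using t(3) by (simp add: algebra_simps)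
    then have "1 - e \<le> time_average \<Psi> ?x h t" using t(2) by (simp add: time_average_def field_simps)
    then show "\<exists>t\<ge>T. 0 < t \<and> 1 - e \<le> time_average \<Psi> ?x h t" using t by blast
  next
    fix e T :: real assume e: "0 < e"
    obtain t where t: "t \<ge> T" "0 < t" "integral {0..t} (\<lambda>s. h (\<Psi> s ?x)) \<le> e * t"
      using S'.small_average[OF _ continuous_orbit[OF cont_h] h_along(1) mC e, of T] sw(2)
      unfolding swamps_def by blast
    then have "time_average \<Psi> ?x h t \<le> e" by (simp add: time_average_def field_simps)
    then show "\<exists>t\<ge>T. 0 < t \<and> time_average \<Psi> ?x h t \<le> e" using t by blast
  qed
qed

theorem theorem6p7:
  fixes \<alpha> :: real
  assumes "liouville_number \<alpha>"
  shows "\<exists>B :: circle set. gdelta B \<and> closure B = UNIV \<and>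
           (\<forall>\<beta>\<in>B. \<forall>\<phi> \<Psi>.
              reparam_linear_flow \<alpha> (to_circle 0, to_circle 0) (to_circle 0, \<beta>) \<phi> \<Psi> \<longrightarrow>
              extreme_historic_behaviour \<Psi> (to_circle 0, to_circle 0) (to_circle 0, \<beta>))"
proof -
  have L: "liouville_approximable \<alpha>" by (rule liouville_number_approximable[OF assms])
  \<comment> \<open>Powers of 1/2 are summable, and the shift by 3 makes the largest of them 1/8,
    the bound imposed by \<open>liouville_ratio\<close>.\<close>
  define e where "e = (\<lambda>j::nat. (1/2::real) ^ (j + 3))"
  have e: "0 < e j" "e j \<le> 1/8" for j
    using power_le_one[of "1/2::real" j] by (simp_all add: e_def power_add power3_eq_cube)
  have e_sum: "summable e"
    unfolding e_def power_add by (intro summable_mult2 summable_geometric) simp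
  obtain B :: "circle set" where B: "gdelta B" "closure B = UNIV"
    and Bb: "\<And>\<beta>. \<beta> \<in> B \<Longrightarrow> \<exists>b. \<beta> = to_circle b \<and>
      (\<forall>j. b \<in> swamping_set \<alpha> 1 (e j) j \<and> b \<in> swamping_set \<alpha> (-1) (e j) j)"
    using ex_dense_gdelta_swamping[where e = e, OF L e] by blast
  have "extreme_historic_behaviour \<Psi> (to_circle 0, to_circle 0) (to_circle 0, \<beta>)"
    if "\<beta> \<in> B" and flow: "reparam_linear_flow \<alpha> (to_circle 0, to_circle 0) (to_circle 0, \<beta>) \<phi> \<Psi>" for \<beta> \<phi> \<Psi>
  proof -
    obtain b where b: "\<beta> = to_circle b" "\<And>j. b \<in> swamping_set \<alpha> 1 (e j) j" "\<And>j. - b \<in> swamping_set \<alpha> 1 (e j) j"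
      using Bb[OF \<open>\<beta> \<in> B\<close>] swamping_set_minus by blast
    have "AE y in lborel. avoids_lattice \<alpha> y \<and> avoids_lattice \<alpha> (y - b) \<and> swamps \<alpha> y (y - b) \<and> swamps \<alpha> (y - b) y"
      using AE_avoids_lattice[of \<alpha> 0] AE_avoids_lattice[of \<alpha> b]
        AE_swamps[OF b(2) e e_sum, of 0] AE_swamps[OF b(3) e e_sum, of b]
      by eventually_elim simp
    from AE_torus_lebesgueI[OF AE_shear[OF this, of \<alpha>]]
    show ?thesis unfolding extreme_historic_behaviour_def
    proof (rule AE_mp, intro AE_I2 impI)
      fix x assume "\<exists>z\<in>{0..<1} \<times> {0..<1}. to_torus z = x \<and>
        avoids_lattice \<alpha> (snd z - \<alpha> * fst z) \<and> avoids_lattice \<alpha> (snd z - \<alpha> * fst z - b) \<and>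
        swamps \<alpha> (snd z - \<alpha> * fst z) (snd z - \<alpha> * fst z - b) \<and> swamps \<alpha> (snd z - \<alpha> * fst z - b) (snd z - \<alpha> * fst z)"
      then obtain z where z: "z \<in> {0..<1} \<times> {0..<1}" "to_torus z = x"
        "avoids_lattice \<alpha> (snd z - \<alpha> * fst z)" "avoids_lattice \<alpha> (snd z - \<alpha> * fst z - b)"
        "swamps \<alpha> (snd z - \<alpha> * fst z) (snd z - \<alpha> * fst z - b)" "swamps \<alpha> (snd z - \<alpha> * fst z - b) (snd z - \<alpha> * fst z)"
        by (elim bexE conjE)
      show "p_omega \<Psi> x = dirac_segment (to_circle 0, to_circle 0) (to_circle 0, \<beta>)"
        using p_omega_of_good_orbit[OF L flow[unfolded b(1)] z(1) refl z(3-6)] unfolding z(2) b(1) .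
    qed
  qed
  with B show ?thesis by blast
qed

end
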